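(* Let $R$ be a Noetherian local ring, let $I \neq 0$ be a proper ideal of $R$ and let $a,b\in R$. The following conditions are equivalent: (1) $R$ is a Cohen-Macaulay ring and $I$ is a maximal Cohen-Macaulay $R$-module; (2) $R(I)_{a,b}$ is a Cohen-Macaulay $R$-module; (3) $R(I)_{a,b}$ is a Cohen-Macaulay ring; (4) $R$ is a Cohen-Macaulay ring and each $R$-regular sequence of elements of $R$ is also an $R(I)_{a,b}$-regular sequence.
   Context: All rings are commutative with unity. For a Noetherian ring $R$, a nonzero proper ideal $I$ and $a,b\in R$, the Rees algebra is the subring $\bigoplus_{n\ge 0} I^n t^n$ of $R[t]$, and $R(I)_{a,b}$ denotes the quotient of $\bigoplus_{n\ge 0} I^n t^n$ by the ideal $\big((t^2+at+b)R[t]\big)\cap \bigoplus_{n\ge 0} I^n t^n$. As an $R$-module $R(I)_{a,b}\cong R\oplus I$; its elements are written uniquely as $r+it$ with $r\in R$, $i\in I$, with product $(r+it)(s+jt)=rs-bij+(rj+is-aij)t$. If $(R,\mathfrak m)$ is local, then $R(I)_{a,b}$ is local with maximal ideal $\{m+it \mid m\in\mathfrak m, i\in I\}$. A maximal Cohen-Macaulay $R$-module is a finitely generated module whose depth equals $\dim R$. *)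

theory Defs
  imports
    "HOL-Algebra.Ideal_Product"
    "HOL-Algebra.UnivPoly"
    "HOL-Algebra.Ring_Divisibility"
    "HOL-Library.Extended_Nat"
begin

section \<open>Noetherian local rings and Krull dimension\<close>

locale noetherian_local_ring = noetherian_ring R + cring R for R (structure) +
  assumes ex1_maximalideal: "\<exists>!\<mm>. maximalideal \<mm> R"

definition max_ideal :: "('a, 'm) ring_scheme \<Rightarrow> 'a set"
  where "max_ideal R = (THE \<mm>. maximalideal \<mm> R)"

text \<open>The supremum of the lengths \<open>n\<close> of chains \<open>P 0 \<subset> \<dots> \<subset> P n\<close> of prime ideals. (The zero ring gets
  dimension \<open>0\<close>, but only nonzero rings matter below.)\<close>

definition krull_dim :: "('a, 'm) ring_scheme \<Rightarrow> enat"
  where "krull_dim R =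
    Sup {enat n | n. \<exists>P. (\<forall>i\<le>n. primeideal (P i) R) \<and> (\<forall>i<n. P i \<subset> P (Suc i))}"

section \<open>Modules\<close>

definition submodule_span ::
    "('a, 'm) ring_scheme \<Rightarrow> ('a, 'b, 'n) module_scheme \<Rightarrow> 'b set \<Rightarrow> 'b set"
  where "submodule_span R M S = \<Inter>{N. submodule N R M \<and> S \<subseteq> N}"

definition finitely_generated_module ::
    "('a, 'm) ring_scheme \<Rightarrow> ('a, 'b, 'n) module_scheme \<Rightarrow> bool"
  where "finitely_generated_module R M \<longleftrightarrow>
    module R M \<and> (\<exists>S\<subseteq>carrier M. finite S \<and> carrier M = submodule_span R M S)"

definition annihilator :: "('a, 'm) ring_scheme \<Rightarrow> ('a, 'b, 'n) module_scheme \<Rightarrow> 'a set"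
  where "annihilator R M = {r \<in> carrier R. \<forall>x\<in>carrier M. r \<odot>\<^bsub>M\<^esub> x = \<zero>\<^bsub>M\<^esub>}"

definition module_dim :: "('a, 'm) ring_scheme \<Rightarrow> ('a, 'b, 'n) module_scheme \<Rightarrow> enat"
  where "module_dim R M = krull_dim (R Quot annihilator R M)"

text \<open>\<open>S\<close> as a module over the domain of a ring homomorphism \<open>\<phi>\<close> into \<open>S\<close>.\<close>

definition restrict_scalars :: "('b, 'm) ring_scheme \<Rightarrow> ('a \<Rightarrow> 'b) \<Rightarrow> ('a, 'b) module"
  where "restrict_scalars S \<phi> =
    \<lparr>carrier = carrier S, monoid.mult = monoid.mult S, one = \<one>\<^bsub>S\<^esub>,
     ring.zero = \<zero>\<^bsub>S\<^esub>, add = add S, smult = (\<lambda>r x. \<phi> r \<otimes>\<^bsub>S\<^esub> x)\<rparr>"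

abbreviation self_module :: "('a, 'm) ring_scheme \<Rightarrow> ('a, 'a) module"
  where "self_module R \<equiv> restrict_scalars R (\<lambda>r. r)"

abbreviation ideal_module :: "('a, 'm) ring_scheme \<Rightarrow> 'a set \<Rightarrow> ('a, 'a) module"
  where "ideal_module R I \<equiv> (self_module R)\<lparr>carrier := I\<rparr>"

section \<open>Regular sequences, depth and the Cohen-Macaulay property\<close>

text \<open>The submodule \<open>(x\<^sub>1, \<dots>, x\<^sub>n)M\<close>.\<close>

definition seq_submodule ::
    "('a, 'm) ring_scheme \<Rightarrow> ('a, 'b, 'n) module_scheme \<Rightarrow> 'a list \<Rightarrow> 'b set"
  where "seq_submodule R M xs =
    submodule_span R M {x \<odot>\<^bsub>M\<^esub> m | x m. x \<in> set xs \<and> m \<in> carrier M}"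

text \<open>Each \<open>x\<^sub>i\<close> is a nonzerodivisor on \<open>M/(x\<^sub>1, \<dots>, x\<^sub>i\<^sub>-\<^sub>1)M\<close>, spelled out on representatives, and
  \<open>M \<noteq> (x\<^sub>1, \<dots>, x\<^sub>n)M\<close>.\<close>

definition regular_sequence ::
    "('a, 'm) ring_scheme \<Rightarrow> ('a, 'b, 'n) module_scheme \<Rightarrow> 'a list \<Rightarrow> bool"
  where "regular_sequence R M xs \<longleftrightarrow>
    set xs \<subseteq> carrier R \<and>
    (\<forall>i<length xs. \<forall>m\<in>carrier M.
       (xs ! i) \<odot>\<^bsub>M\<^esub> m \<in> seq_submodule R M (take i xs) \<longrightarrow>
       m \<in> seq_submodule R M (take i xs)) \<and>
    seq_submodule R M xs \<noteq> carrier M"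

text \<open>For a module over a local ring; the zero module has depth \<open>\<infinity>\<close> by convention.\<close>

definition depth :: "('a, 'm) ring_scheme \<Rightarrow> ('a, 'b, 'n) module_scheme \<Rightarrow> enat"
  where "depth R M =
    (if carrier M = {\<zero>\<^bsub>M\<^esub>} then \<infinity>
     else Sup {enat (length xs) | xs. regular_sequence R M xs \<and> set xs \<subseteq> max_ideal R})"

definition cohen_macaulay_module ::
    "('a, 'm) ring_scheme \<Rightarrow> ('a, 'b, 'n) module_scheme \<Rightarrow> bool"
  where "cohen_macaulay_module R M \<longleftrightarrow>
    noetherian_local_ring R \<and> finitely_generated_module R M \<and> carrier M \<noteq> {\<zero>\<^bsub>M\<^esub>} \<and>
    depth R M = module_dim R M"

definition maximal_cohen_macaulay_module ::
    "('a, 'm) ring_scheme \<Rightarrow> ('a, 'b, 'n) module_scheme \<Rightarrow> bool"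
  where "maximal_cohen_macaulay_module R M \<longleftrightarrow>
    noetherian_local_ring R \<and> finitely_generated_module R M \<and> depth R M = krull_dim R"

text \<open>Cohen-Macaulay rings, for local rings only; \<open>R(I)\<^bsub>a,b\<^esub>\<close> is local if \<open>R\<close> is and \<open>I\<close> is proper.\<close>

definition cohen_macaulay_local_ring :: "('a, 'm) ring_scheme \<Rightarrow> bool"
  where "cohen_macaulay_local_ring R \<longleftrightarrow>
    noetherian_local_ring R \<and> depth R (self_module R) = krull_dim R"

section \<open>The rings \<open>R(I)\<^bsub>a,b\<^esub>\<close>\<close>

text \<open>The Rees algebra \<open>\<Oplus>\<^sub>n I\<^sup>n t\<^sup>n\<close> as a subring of \<open>R[t]\<close>. Powers of \<open>I\<close> are taken in the monoid of
  ideals, so \<open>I\<^sup>0 = R\<close>.\<close>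

definition rees_algebra :: "('a, 'm) ring_scheme \<Rightarrow> 'a set \<Rightarrow> ('a, nat \<Rightarrow> 'a) up_ring"
  where "rees_algebra R I =
    (UP R)\<lparr>carrier := {p \<in> carrier (UP R). \<forall>n. coeff (UP R) p n \<in> I [^]\<^bsub>ideals_set R\<^esub> n}\<rparr>"

definition quadratic_poly :: "('a, 'm) ring_scheme \<Rightarrow> 'a \<Rightarrow> 'a \<Rightarrow> nat \<Rightarrow> 'a"
  where "quadratic_poly R a b =
    monom (UP R) \<one>\<^bsub>R\<^esub> 2 \<oplus>\<^bsub>UP R\<^esub> monom (UP R) a 1 \<oplus>\<^bsub>UP R\<^esub> monom (UP R) b 0"

definition rees_kernel :: "('a, 'm) ring_scheme \<Rightarrow> 'a set \<Rightarrow> 'a \<Rightarrow> 'a \<Rightarrow> (nat \<Rightarrow> 'a) set"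
  where "rees_kernel R I a b =
    (PIdl\<^bsub>UP R\<^esub> (quadratic_poly R a b)) \<inter> carrier (rees_algebra R I)"

definition rees_quotient ::
    "('a, 'm) ring_scheme \<Rightarrow> 'a set \<Rightarrow> 'a \<Rightarrow> 'a \<Rightarrow> ((nat \<Rightarrow> 'a) set) ring"
  where "rees_quotient R I a b = rees_algebra R I Quot rees_kernel R I a b"

text \<open>\<open>R(I)\<^bsub>a,b\<^esub>\<close> as an \<open>R\<close>-module via \<open>R \<rightarrow> R(I)\<^bsub>a,b\<^esub>\<close>, sending \<open>r\<close> to the class of the constant
  polynomial \<open>r\<close>.\<close>

definition rees_quotient_module ::
    "('a, 'm) ring_scheme \<Rightarrow> 'a set \<Rightarrow> 'a \<Rightarrow> 'a \<Rightarrow> ('a, (nat \<Rightarrow> 'a) set) module"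
  where "rees_quotient_module R I a b =
    restrict_scalars (rees_quotient R I a b)
      (\<lambda>r. rees_kernel R I a b +>\<^bsub>rees_algebra R I\<^esub> monom (UP R) r 0)"

end

theory Submission
  imports Defs "HOL-Algebra.Subrings"
begin

text \<open>
  Write \<open>A = R(I)\<^bsub>a,b\<^esub>\<close>. As an \<open>R\<close>-module \<open>A\<close> is \<open>R \<oplus> I\<close>, so for elements of the maximal ideal being an
  \<open>A\<close>-regular sequence means being both an \<open>R\<close>-regular and an \<open>I\<close>-regular sequence
  (\<open>regular_on_A_iff\<close>). Hence the depth of \<open>A\<close> over \<open>R\<close> is at most the depths of \<open>R\<close> and of \<open>I\<close>, and
  these are at most \<open>dim R\<close>. As \<open>R\<close> embeds into \<open>A\<close>, the dimension of the module \<open>A\<close> is \<open>dim R\<close>. So (2)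
  forces both depths to be \<open>dim R\<close>, which is (1). Condition (4) yields (2), because it makes a longest
  \<open>R\<close>-regular sequence \<open>A\<close>-regular.

  For (1) implies (4), let \<open>I\<close> have depth \<open>d = dim R\<close>. From an associated prime \<open>P\<close> of \<open>I\<close> starts a
  chain of \<open>d + 1\<close> primes (\<open>prime_chain_from_associated_prime\<close>). An \<open>R\<close>-regular element \<open>x\<close> in \<open>P\<close> would
  prolong this chain below \<open>P\<close> (\<open>smaller_prime_avoiding_nonzerodivisor\<close>), beyond the dimension. So \<open>x\<close> is
  \<open>I\<close>-regular, and one passes to \<open>R / xR\<close> and \<open>I / xI\<close>, where the bound on chains and the depth both drop
  by one (\<open>regular_on_transfer\<close>). That the depth drops by no more than one whatever regular element is
  divided out is \<open>regular_on_quotient\<close>; it rests on an elementary exchange of socle elements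
  (\<open>socle_exchange\<close>) and on prime avoidance.

  For (2) iff (3), each \<open>y\<close> in \<open>A\<close> satisfies an equation \<open>y\<^sup>2 = p y - q\<close> with \<open>p\<close>, \<open>q\<close> in \<open>R\<close>, and \<open>p\<close>, \<open>q\<close> lie in
  any ideal that contains the two coordinates of \<open>y\<close> (\<open>integral_over\<close>). This gives lying over and
  incomparability, hence \<open>dim A = dim R\<close> (\<open>krull_dim_A\<close>). It also shows that a prime of \<open>A\<close> containing the
  maximal ideal of \<open>R\<close> is the maximal ideal of \<open>A\<close>; so regular elements of \<open>A\<close> can be replaced, one at a
  time, by elements of \<open>R\<close>, and the depth of \<open>A\<close> is the same over \<open>A\<close> and over \<open>R\<close> (\<open>depth_A\<close>).

  All modules involved are subquotients of \<open>R\<close> or of \<open>A\<close> by ideals. The commutative algebra is therefore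
  carried out for pairs of ideals \<open>L\<close>, \<open>N\<close>, where \<open>L / N\<close> is short for \<open>(L + N) / N\<close>.
\<close>

section \<open>Subquotients by ideals\<close>

text \<open>
  \<open>N + x L\<close>. Passing from \<open>N\<close> to this ideal replaces \<open>M = L / N\<close> by \<open>M / x M\<close>, so no quotient
  modules have to be formed.
\<close>

definition add_multiples :: "('a, 'm) ring_scheme \<Rightarrow> 'a set \<Rightarrow> 'a set \<Rightarrow> 'a \<Rightarrow> 'a set"
  where "add_multiples R L N x = {n \<oplus>\<^bsub>R\<^esub> x \<otimes>\<^bsub>R\<^esub> l | n l. n \<in> N \<and> l \<in> L}"

definition nonzerodivisor_on :: "('a, 'm) ring_scheme \<Rightarrow> 'a set \<Rightarrow> 'a set \<Rightarrow> 'a \<Rightarrow> bool"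
  where "nonzerodivisor_on R L N x \<longleftrightarrow> (\<forall>l\<in>L. x \<otimes>\<^bsub>R\<^esub> l \<in> N \<longrightarrow> l \<in> N)"

text \<open>
  Regular sequences on \<open>L / N\<close>. The recursion moves the first element of the sequence into \<open>N\<close>, which
  is the form in which sequences are modified by induction.
\<close>

fun regular_on :: "('a, 'm) ring_scheme \<Rightarrow> 'a set \<Rightarrow> 'a set \<Rightarrow> 'a list \<Rightarrow> bool"
  where
    "regular_on R L N [] \<longleftrightarrow> \<not> L \<subseteq> N"
  | "regular_on R L N (x # xs) \<longleftrightarrow>
       nonzerodivisor_on R L N x \<and> regular_on R L (add_multiples R L N x) xs"

text \<open>
  The annihilator of the class of \<open>u\<close> modulo \<open>N\<close>.
\<close>

definition colon :: "('a, 'm) ring_scheme \<Rightarrow> 'a set \<Rightarrow> 'a \<Rightarrow> 'a set"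
  where "colon R N u = {r \<in> carrier R. r \<otimes>\<^bsub>R\<^esub> u \<in> N}"

text \<open>
  The maximal ones among the annihilators of nonzero elements of \<open>L / N\<close>. They are finitely many primes
  that cover the zero divisors of \<open>L / N\<close>, and take the place of the set of all associated primes.
\<close>

definition max_annihilator :: "('a, 'm) ring_scheme \<Rightarrow> 'a set \<Rightarrow> 'a set \<Rightarrow> 'a set \<Rightarrow> bool"
  where "max_annihilator R L N P \<longleftrightarrow>
    (\<exists>u\<in>L - N. P = colon R N u) \<and> (\<forall>u\<in>L - N. P \<subseteq> colon R N u \<longrightarrow> colon R N u = P)"

definition prime_chain :: "('a, 'm) ring_scheme \<Rightarrow> (nat \<Rightarrow> 'a set) \<Rightarrow> nat \<Rightarrow> bool"
  where "prime_chain R P n \<longleftrightarrow> (\<forall>i\<le>n. primeideal (P i) R) \<and> (\<forall>i<n. P i \<subset> P (Suc i))"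

lemma prime_chain_Suc:
  assumes "primeideal Q R" and "Q \<subset> P 0" and "prime_chain R P n"
  shows "prime_chain R (case_nat Q P) (Suc n)"
  using assms unfolding prime_chain_def by (auto split: nat.split)

lemma prime_chain_mono:
  assumes "prime_chain R P n" "k \<le> n" shows "prime_chain R P k"
  using assms unfolding prime_chain_def by auto

lemma ideal_sub_closed:
  assumes "ideal J R" "x \<in> J" "y \<in> J" shows "x \<ominus>\<^bsub>R\<^esub> y \<in> J"
proof -
  interpret ideal J R by fact
  show ?thesis using assms by (simp add: a_minus_def)
qed

lemma ideal_add_closed:
  assumes "ideal J R" "x \<in> J" "y \<in> J" shows "x \<oplus>\<^bsub>R\<^esub> y \<in> J"
  using assms by (simp add: additive_subgroup.a_closed ideal.axioms(1))

lemma ideal_zero_closed: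
  assumes "ideal J R" shows "\<zero>\<^bsub>R\<^esub> \<in> J"
  using assms by (simp add: additive_subgroup.zero_closed ideal.axioms(1))

context cring
begin

lemma ideal_criterion:
  assumes "J \<subseteq> carrier R" and "\<zero> \<in> J"
    and add: "\<And>x y. x \<in> J \<Longrightarrow> y \<in> J \<Longrightarrow> x \<oplus> y \<in> J"
    and mult: "\<And>r x. r \<in> carrier R \<Longrightarrow> x \<in> J \<Longrightarrow> r \<otimes> x \<in> J"
  shows "ideal J R"
proof (rule idealI)
  show "ring R" by (rule ring_axioms)
  show "subgroup J (add_monoid R)"
  proof (rule add.subgroupI)
    show "J \<subseteq> carrier R" "J \<noteq> {}" using assms by auto
    show "\<ominus> x \<in> J" if "x \<in> J" for x
    proof -
      have "x \<in> carrier R" using that assms by auto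
      then have "\<ominus> x = \<ominus> \<one> \<otimes> x" by algebra
      then show ?thesis using mult[of "\<ominus> \<one>" x] that by simp
    qed
  qed (use add in auto)
  show "x \<otimes> y \<in> J" "y \<otimes> x \<in> J" if "y \<in> J" "x \<in> carrier R" for x y
    using mult[OF that(2,1)] that m_comm[of x y] assms(1) by auto
qed

lemma add_multiplesI:
  assumes "n \<in> N" "l \<in> L" shows "n \<oplus> x \<otimes> l \<in> add_multiples R L N x"
  using assms unfolding add_multiples_def by auto

lemma add_multiplesE:
  assumes "y \<in> add_multiples R L N x"
  obtains n l where "n \<in> N" "l \<in> L" "y = n \<oplus> x \<otimes> l"
  using assms unfolding add_multiples_def by auto

lemma add_multiples_least:
  assumes "ideal J R" "N \<subseteq> J" "\<And>l. l \<in> L \<Longrightarrow> x \<otimes> l \<in> J"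
  shows "add_multiples R L N x \<subseteq> J"
proof
  fix y assume "y \<in> add_multiples R L N x"
  then show "y \<in> J" using assms by (auto elim!: add_multiplesE intro: ideal_add_closed)
qed

context
  fixes L N assumes L: "ideal L R" and N: "ideal N R"
begin

lemma add_multiples_ideal:
  assumes x: "x \<in> carrier R"
  shows "ideal (add_multiples R L N x) R"
proof (rule ideal_criterion)
  note LN = ideal.Icarr[OF L] ideal.Icarr[OF N]
  show "add_multiples R L N x \<subseteq> carrier R"
    using x LN by (auto elim!: add_multiplesE)
  have "\<zero> \<oplus> x \<otimes> \<zero> \<in> add_multiples R L N x"
    by (intro add_multiplesI ideal_zero_closed L N)
  then show "\<zero> \<in> add_multiples R L N x" using x by simp
  show "u \<oplus> v \<in> add_multiples R L N x"
    if uv: "u \<in> add_multiples R L N x" "v \<in> add_multiples R L N x" for u v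
  proof -
    obtain n l n' l' where *: "n \<in> N" "l \<in> L" "u = n \<oplus> x \<otimes> l" "n' \<in> N" "l' \<in> L" "v = n' \<oplus> x \<otimes> l'"
      using uv by (elim add_multiplesE) metis
    have "u \<oplus> v = (n \<oplus> n') \<oplus> x \<otimes> (l \<oplus> l')"
      using * LN(1)[of l] LN(1)[of l'] LN(2)[of n] LN(2)[of n'] x by (simp only:, algebra)
    then show ?thesis
      using * by (simp only:, intro add_multiplesI ideal_add_closed L N)
  qed
  show "r \<otimes> u \<in> add_multiples R L N x"
    if r: "r \<in> carrier R" and u: "u \<in> add_multiples R L N x" for r u
  proof -
    obtain n l where *: "n \<in> N" "l \<in> L" "u = n \<oplus> x \<otimes> l" using u by (elim add_multiplesE) metis
    have "r \<otimes> u = r \<otimes> n \<oplus> x \<otimes> (r \<otimes> l)"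
      using * LN(1)[of l] LN(2)[of n] x r by (simp only:, algebra)
    then show ?thesis
      using * r by (simp only:, intro add_multiplesI ideal.I_l_closed[OF L] ideal.I_l_closed[OF N])
  qed
qed

lemma subset_add_multiples:
  assumes x: "x \<in> carrier R"
  shows "N \<subseteq> add_multiples R L N x"
proof
  fix n assume "n \<in> N"
  then have "n \<oplus> x \<otimes> \<zero> \<in> add_multiples R L N x" by (intro add_multiplesI ideal_zero_closed L)
  then show "n \<in> add_multiples R L N x" using x \<open>n \<in> N\<close> ideal.Icarr[OF N] by simp
qed

lemma multiple_in_add_multiples:
  assumes x: "x \<in> carrier R" and "l \<in> L"
  shows "x \<otimes> l \<in> add_multiples R L N x"
  using add_multiplesI[of \<zero> N l L x] ideal_zero_closed[OF N] assms ideal.Icarr[OF L] by simp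

lemma add_multiples_commute_le:
  assumes x: "x \<in> carrier R" and y: "y \<in> carrier R"
  shows "add_multiples R L (add_multiples R L N x) y \<subseteq> add_multiples R L (add_multiples R L N y) x"
proof -
  note LN = ideal.Icarr[OF L] ideal.Icarr[OF N]
  show ?thesis
  proof
    fix u assume "u \<in> add_multiples R L (add_multiples R L N x) y"
    then obtain n l l' where *: "n \<in> N" "l \<in> L" "l' \<in> L" "u = (n \<oplus> x \<otimes> l) \<oplus> y \<otimes> l'"
      by (elim add_multiplesE) metis
    have "u = (n \<oplus> y \<otimes> l') \<oplus> x \<otimes> l"
      using * LN(1)[of l] LN(1)[of l'] LN(2)[of n] x y by (simp only:, algebra)
    then show "u \<in> add_multiples R L (add_multiples R L N y) x"
      using * by (simp only:, intro add_multiplesI)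
  qed
qed

lemma colon_ideal:
  assumes u: "u \<in> carrier R"
  shows "ideal (colon R N u) R"
proof (rule ideal_criterion)
  show "colon R N u \<subseteq> carrier R" "\<zero> \<in> colon R N u"
    using u ideal_zero_closed[OF N] by (auto simp: colon_def)
  show "x \<oplus> y \<in> colon R N u" if "x \<in> colon R N u" "y \<in> colon R N u" for x y
    using that u ideal_add_closed[OF N] by (auto simp: colon_def l_distr)
  show "r \<otimes> x \<in> colon R N u" if "r \<in> carrier R" "x \<in> colon R N u" for r x
    using that u ideal.I_l_closed[OF N] by (auto simp: colon_def m_assoc)
qed

text \<open>
  The part of the permutability of regular sequences that holds without finiteness: if \<open>x\<close>, \<open>y\<close> is
  a regular sequence then \<open>x\<close> stays regular modulo \<open>y\<close>.
\<close>

lemma nonzerodivisor_swap: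
  assumes x: "x \<in> carrier R" and y: "y \<in> carrier R"
    and regx: "nonzerodivisor_on R L N x"
    and regy: "nonzerodivisor_on R L (add_multiples R L N x) y"
  shows "nonzerodivisor_on R L (add_multiples R L N y) x"
  unfolding nonzerodivisor_on_def
proof (intro ballI impI)
  note LN = ideal.Icarr[OF L] ideal.Icarr[OF N]
  fix u assume u: "u \<in> L" and "x \<otimes> u \<in> add_multiples R L N y"
  then obtain n v where n: "n \<in> N" and v: "v \<in> L" and eq: "x \<otimes> u = n \<oplus> y \<otimes> v"
    by (elim add_multiplesE)
  have "y \<otimes> v = \<ominus> n \<oplus> x \<otimes> u"
    using eq LN(1)[OF u] LN(1)[OF v] LN(2)[OF n] x y by (simp only:, algebra)
  then have "y \<otimes> v \<in> add_multiples R L N x"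
    using n u additive_subgroup.a_inv_closed[OF ideal.axioms(1)[OF N]] by (simp add: add_multiplesI)
  then obtain n' w where n': "n' \<in> N" and w: "w \<in> L" and veq: "v = n' \<oplus> x \<otimes> w"
    using regy v unfolding nonzerodivisor_on_def by (meson add_multiplesE)
  note carr = LN(1)[OF u] LN(1)[OF v] LN(1)[OF w] LN(2)[OF n] LN(2)[OF n'] x y
  have "x \<otimes> (u \<ominus> y \<otimes> w) = x \<otimes> u \<ominus> x \<otimes> (y \<otimes> w)"
    using carr by algebra
  also have "\<dots> = n \<oplus> y \<otimes> n'"
    unfolding eq veq using carr by algebra
  finally have "x \<otimes> (u \<ominus> y \<otimes> w) \<in> N"
    using n n' y by (simp add: ideal_add_closed[OF N] ideal.I_l_closed[OF N])
  moreover have "u \<ominus> y \<otimes> w \<in> L"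
    using u w y by (simp add: ideal_sub_closed[OF L] ideal.I_l_closed[OF L])
  ultimately have "u \<ominus> y \<otimes> w \<in> N" using regx unfolding nonzerodivisor_on_def by blast
  moreover have "u = (u \<ominus> y \<otimes> w) \<oplus> y \<otimes> w" using carr by algebra
  ultimately show "u \<in> add_multiples R L N y" using add_multiplesI[OF _ w, of _ N y] by metis
qed

text \<open>
  For regular \<open>x\<close> and \<open>y\<close> in \<open>J\<close>, an element \<open>z\<close> whose class modulo \<open>x\<close> is killed by \<open>J\<close> gives \<open>y z = x w\<close>, and
  the class of \<open>w\<close> modulo \<open>y\<close> is then killed by \<open>J\<close>. This is the isomorphism
  \<open>Hom (R / J, M / x M) \<cong> Ext\<^sup>1 (R / J, M) \<cong> Hom (R / J, M / y M)\<close> on representatives. It shows that having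
  positive depth after division by one regular element does not depend on that element.
\<close>

lemma socle_exchange:
  assumes x: "x \<in> carrier R" and y: "y \<in> J" and J: "J \<subseteq> carrier R"
    and regx: "nonzerodivisor_on R L N x" and regy: "nonzerodivisor_on R L N y"
    and z: "z \<in> L" "z \<notin> add_multiples R L N x"
    and kill: "\<And>r. r \<in> J \<Longrightarrow> r \<otimes> z \<in> add_multiples R L N x"
  shows "\<exists>w\<in>L. w \<notin> add_multiples R L N y \<and> (\<forall>r\<in>J. r \<otimes> w \<in> add_multiples R L N y)"
proof -
  note LN = ideal.Icarr[OF L] ideal.Icarr[OF N]
  have yc: "y \<in> carrier R" using y J by auto
  obtain n w where n: "n \<in> N" and w: "w \<in> L" and eq: "y \<otimes> z = n \<oplus> x \<otimes> w"
    using kill[OF y] by (elim add_multiplesE)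
  note carr = LN(1)[OF z(1)] LN(1)[OF w] LN(2)[OF n] x yc
  have "w \<notin> add_multiples R L N y"
  proof
    assume "w \<in> add_multiples R L N y"
    then obtain n' u where n': "n' \<in> N" and u: "u \<in> L" and weq: "w = n' \<oplus> y \<otimes> u"
      by (elim add_multiplesE)
    note c = carr LN(2)[OF n'] LN(1)[OF u]
    have "y \<otimes> (z \<ominus> x \<otimes> u) = y \<otimes> z \<ominus> x \<otimes> (y \<otimes> u)" using c by algebra
    also have "\<dots> = n \<oplus> x \<otimes> n'" unfolding eq weq using c by algebra
    finally have "y \<otimes> (z \<ominus> x \<otimes> u) \<in> N"
      using n n' x by (simp add: ideal_add_closed[OF N] ideal.I_l_closed[OF N])
    moreover have "z \<ominus> x \<otimes> u \<in> L"
      using z u x by (simp add: ideal_sub_closed[OF L] ideal.I_l_closed[OF L])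
    ultimately have "z \<ominus> x \<otimes> u \<in> N" using regy unfolding nonzerodivisor_on_def by blast
    moreover have "z = (z \<ominus> x \<otimes> u) \<oplus> x \<otimes> u" using c by algebra
    ultimately show False using z(2) add_multiplesI[OF _ u, of _ N x] by metis
  qed
  moreover have "r \<otimes> w \<in> add_multiples R L N y" if r: "r \<in> J" for r
  proof -
    have rc: "r \<in> carrier R" using r J by auto
    obtain n' v where n': "n' \<in> N" and v: "v \<in> L" and req: "r \<otimes> z = n' \<oplus> x \<otimes> v"
      using kill[OF r] by (elim add_multiplesE)
    note c = carr rc LN(2)[OF n'] LN(1)[OF v]
    have "x \<otimes> (r \<otimes> w \<ominus> y \<otimes> v) = r \<otimes> (n \<oplus> x \<otimes> w) \<ominus> r \<otimes> n \<ominus> x \<otimes> (y \<otimes> v)" using c by algebra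
    also have "\<dots> = y \<otimes> (r \<otimes> z) \<ominus> r \<otimes> n \<ominus> x \<otimes> (y \<otimes> v)" unfolding eq[symmetric] using c by algebra
    also have "\<dots> = y \<otimes> n' \<ominus> r \<otimes> n" unfolding req using c by algebra
    finally have "x \<otimes> (r \<otimes> w \<ominus> y \<otimes> v) \<in> N"
      using n n' yc rc by (simp add: ideal_sub_closed[OF N] ideal.I_l_closed[OF N])
    moreover have "r \<otimes> w \<ominus> y \<otimes> v \<in> L"
      using w v yc rc by (simp add: ideal_sub_closed[OF L] ideal.I_l_closed[OF L])
    ultimately have "r \<otimes> w \<ominus> y \<otimes> v \<in> N" using regx unfolding nonzerodivisor_on_def by blast
    moreover have "r \<otimes> w = (r \<otimes> w \<ominus> y \<otimes> v) \<oplus> y \<otimes> v" using c by algebra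
    ultimately show ?thesis using add_multiplesI[OF _ v, of _ N y] by metis
  qed
  ultimately show ?thesis using w by blast
qed

text \<open>
  If \<open>r s\<close> kills \<open>u\<close> and \<open>s\<close> does not, then the annihilator of \<open>s u\<close> contains that of \<open>u\<close>, so equals it by
  maximality, and it contains \<open>r\<close>.
\<close>

lemma max_annihilator_prime:
  assumes "max_annihilator R L N P"
  shows "primeideal P R"
proof -
  obtain u where u: "u \<in> L" "u \<notin> N" and P: "P = colon R N u"
    and max: "\<And>v. v \<in> L - N \<Longrightarrow> P \<subseteq> colon R N v \<Longrightarrow> colon R N v = P"
    using assms unfolding max_annihilator_def by blast
  have uc: "u \<in> carrier R" using u ideal.Icarr[OF L] by auto
  show ?thesis
  proof (rule primeidealI)
    show "ideal P R" unfolding P by (rule colon_ideal[OF uc])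
    show "cring R" by (rule cring_axioms)
    have "\<one> \<notin> P" using u uc by (simp add: P colon_def)
    then show "carrier R \<noteq> P" by auto
    show "r \<in> P \<or> s \<in> P" if rs: "r \<in> carrier R" "s \<in> carrier R" "r \<otimes> s \<in> P" for r s
    proof (cases "s \<in> P")
      case False
      have "s \<otimes> u \<in> L - N"
        using False rs u ideal.I_l_closed[OF L] by (auto simp: P colon_def)
      moreover have "P \<subseteq> colon R N (s \<otimes> u)"
      proof
        fix p assume "p \<in> P"
        then have p: "p \<in> carrier R" "p \<otimes> u \<in> N" by (auto simp: P colon_def)
        have "p \<otimes> (s \<otimes> u) = s \<otimes> (p \<otimes> u)" using p rs uc by algebra
        then show "p \<in> colon R N (s \<otimes> u)" using p rs ideal.I_l_closed[OF N] by (simp add: colon_def)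
      qed
      ultimately have "colon R N (s \<otimes> u) = P" by (rule max)
      moreover have "r \<otimes> (s \<otimes> u) \<in> N" using rs uc by (simp add: P colon_def m_assoc)
      ultimately show ?thesis using rs by (auto simp: colon_def)
    qed simp
  qed
qed

end

lemma add_multiples_commute:
  assumes "ideal L R" "ideal N R" "x \<in> carrier R" "y \<in> carrier R"
  shows "add_multiples R L (add_multiples R L N x) y = add_multiples R L (add_multiples R L N y) x"
  using add_multiples_commute_le assms by (intro equalityI) auto

text \<open>
  Multiply one element of each ideal lying outside the prime.
\<close>

lemma exists_in_all_not_in_prime:
  assumes Q: "primeideal Q R" and F: "finite F"
    and ideals: "\<And>J. J \<in> F \<Longrightarrow> ideal J R" and nsub: "\<And>J. J \<in> F \<Longrightarrow> \<not> J \<subseteq> Q"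
  shows "\<exists>y\<in>carrier R. y \<notin> Q \<and> (\<forall>J\<in>F. y \<in> J)"
  using F ideals nsub
proof (induction F rule: finite_induct)
  case empty
  interpret primeideal Q R by fact
  show ?case using I_notcarr a_subset by blast
next
  case (insert J F)
  then obtain y where y: "y \<in> carrier R" "y \<notin> Q" "\<forall>J\<in>F. y \<in> J" by auto
  obtain j where j: "j \<in> J" "j \<notin> Q" using insert.prems by blast
  have J: "ideal J R" and FI: "\<And>K. K \<in> F \<Longrightarrow> ideal K R" using insert.prems by auto
  have jc: "j \<in> carrier R" using ideal.Icarr[OF J j(1)] .
  have "y \<otimes> j \<notin> Q" using primeideal.I_prime[OF Q y(1) jc] y j by blast
  moreover have "y \<otimes> j \<in> J" using ideal.I_l_closed[OF J j(1) y(1)] .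
  moreover have "y \<otimes> j \<in> K" if "K \<in> F" for K
    using ideal.I_r_closed[OF FI[OF that]] y jc that by blast
  ultimately show ?case using y jc by (intro bexI[of _ "y \<otimes> j"]) auto
qed

text \<open>
  By induction there is \<open>z\<close> in \<open>J\<close> avoiding all primes but \<open>Q\<close>. If \<open>z\<close> lies in \<open>Q\<close>, add to it an element of
  \<open>J\<close> that lies in all other primes but not in \<open>Q\<close>.
\<close>

lemma prime_avoidance:
  assumes J: "ideal J R" and "finite F"
    and "\<And>P. P \<in> F \<Longrightarrow> primeideal P R" and "\<And>P. P \<in> F \<Longrightarrow> \<not> J \<subseteq> P"
  shows "\<exists>z\<in>J. \<forall>P\<in>F. z \<notin> P"
  using assms(2-)
proof (induction "card F" arbitrary: F rule: less_induct)
  case less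
  show ?case
  proof (cases "F = {}")
    case True
    then show ?thesis using ideal_zero_closed[OF J] by auto
  next
    case False
    then obtain Q where Q: "Q \<in> F" by auto
    let ?G = "F - {Q}"
    have card: "card ?G < card F" using Q less.prems by (meson card_Diff1_less)
    have Qp: "primeideal Q R" using Q less.prems by auto
    obtain z where z: "z \<in> J" "\<forall>P\<in>?G. z \<notin> P"
      using less.hyps[OF card] less.prems by auto
    show ?thesis
    proof (cases "z \<in> Q")
      case zQ: True
      show ?thesis
      proof (cases "\<exists>P\<in>?G. P \<subseteq> Q")
        case True
        then obtain P where P: "P \<in> ?G" "P \<subseteq> Q" by auto
        \<comment> \<open>Avoiding \<open>Q\<close> already avoids \<open>P\<close>, so \<open>P\<close> can be dropped.\<close>
        have "card (F - {P}) < card F" using P less.prems by (meson DiffD1 card_Diff1_less)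
        then obtain w where "w \<in> J" "\<forall>P'\<in>F - {P}. w \<notin> P'"
          using less.hyps[of "F - {P}"] less.prems by auto
        then show ?thesis using P Q by (metis DiffD2 DiffI insertCI singletonD subsetD)
      next
        case False
        have "\<exists>y\<in>carrier R. y \<notin> Q \<and> (\<forall>K\<in>insert J ?G. y \<in> K)"
          using False J Q less.prems
          by (intro exists_in_all_not_in_prime[OF Qp]) (auto dest: primeideal.axioms(1))
        then obtain y where y: "y \<in> carrier R" "y \<notin> Q" "y \<in> J" "\<forall>P\<in>?G. y \<in> P" by auto
        have zc: "z \<in> carrier R" using ideal.Icarr[OF J z(1)] .
        have e: "z = (z \<oplus> y) \<ominus> y" "y = (z \<oplus> y) \<ominus> z" using zc y by algebra+
        have "z \<oplus> y \<notin> P" if P: "P \<in> F" for P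
        proof
          assume zy: "z \<oplus> y \<in> P"
          have PI: "ideal P R" using P less.prems by (auto dest: primeideal.axioms(1))
          show False
          proof (cases "P = Q")
            case True
            then show False using e(2) ideal_sub_closed[OF PI zy, of z] zQ y by metis
          next
            case False
            then show False using e(1) ideal_sub_closed[OF PI zy, of y] z y P by auto
          qed
        qed
        then show ?thesis using ideal_add_closed[OF J z(1) y(3)] by auto
      qed
    qed (use z in auto)
  qed
qed

end

section \<open>Noetherian rings\<close>

context noetherian_ring
begin

text \<open>
  The ascending chain condition in the form in which it is applied throughout.
\<close>

lemma exists_maximal_ideal_in:
  assumes "C \<noteq> {}" and ideals: "\<And>J. J \<in> C \<Longrightarrow> ideal J R"
  shows "\<exists>M\<in>C. \<forall>J\<in>C. M \<subseteq> J \<longrightarrow> J = M"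
proof (rule subset_Zorn)
  fix D assume D: "subset.chain C D"
  then have DC: "D \<subseteq> C" unfolding pred_on.chain_def by blast
  show "\<exists>U\<in>C. \<forall>X\<in>D. X \<subseteq> U"
  proof (cases "D = {}")
    case False
    have "subset.chain {I. ideal I R} D"
      using D ideals unfolding pred_on.chain_def by blast
    then have "\<Union>D \<in> C" using ideal_chain_is_trivial False DC by blast
    then show ?thesis by (intro bexI[of _ "\<Union>D"]) auto
  qed (use assms(1) in auto)
qed

end

locale noetherian_cring = noetherian_ring R + cring R for R (structure)
begin

lemma annihilator_below_max:
  assumes N: "ideal N R" and L: "ideal L R" and u: "u \<in> L" "u \<notin> N"
  obtains P where "max_annihilator R L N P" "colon R N u \<subseteq> P"
proof -
  let ?C = "{colon R N v | v. v \<in> L - N \<and> colon R N u \<subseteq> colon R N v}"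
  have nonempty: "?C \<noteq> {}" using u by auto
  have ideals: "ideal J R" if "J \<in> ?C" for J
    using that colon_ideal[OF L N] ideal.Icarr[OF L] by auto
  have "\<exists>M\<in>?C. \<forall>J\<in>?C. M \<subseteq> J \<longrightarrow> J = M"
    by (rule exists_maximal_ideal_in[OF nonempty ideals])
  then obtain P where P: "P \<in> ?C" "\<forall>J\<in>?C. P \<subseteq> J \<longrightarrow> J = P"
    by (elim bexE)
  obtain v where v: "P = colon R N v" "v \<in> L - N" "colon R N u \<subseteq> colon R N v"
    using P(1) by blast
  have "colon R N w = P" if w: "w \<in> L - N" "P \<subseteq> colon R N w" for w
  proof -
    have "colon R N w \<in> ?C" using w v by blast
    then show ?thesis using P(2) w by simp
  qed
  then have "max_annihilator R L N P"
    unfolding max_annihilator_def using v by auto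
  then show thesis using that v by auto
qed

lemma nonzerodivisor_iff_max_annihilators:
  assumes N: "ideal N R" and L: "ideal L R" and x: "x \<in> carrier R"
  shows "nonzerodivisor_on R L N x \<longleftrightarrow> (\<forall>P. max_annihilator R L N P \<longrightarrow> x \<notin> P)"
proof
  assume "nonzerodivisor_on R L N x"
  then show "\<forall>P. max_annihilator R L N P \<longrightarrow> x \<notin> P"
    unfolding nonzerodivisor_on_def max_annihilator_def colon_def by blast
next
  assume *: "\<forall>P. max_annihilator R L N P \<longrightarrow> x \<notin> P"
  show "nonzerodivisor_on R L N x"
    unfolding nonzerodivisor_on_def
  proof (intro ballI impI, rule ccontr)
    fix u assume u: "u \<in> L" "u \<notin> N" "x \<otimes> u \<in> N"
    obtain P where "max_annihilator R L N P" "colon R N u \<subseteq> P"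
      using annihilator_below_max[OF N L u(1,2)] .
    then show False using * u x by (auto simp: colon_def)
  qed
qed

text \<open>
  Choose elements \<open>u P\<close> with annihilators \<open>P\<close>. Finitely many of them generate all the others modulo \<open>N\<close>, so
  each maximal annihilator contains an intersection of finitely many others. Being prime, it contains
  one of these, and by maximality it is equal to it.
\<close>

lemma finite_max_annihilators:
  assumes N: "ideal N R" and L: "ideal L R"
  shows "finite {P. max_annihilator R L N P}"
proof -
  let ?A = "{P. max_annihilator R L N P}"
  have "\<exists>u. u \<in> L - N \<and> P = colon R N u" if "P \<in> ?A" for P
    using that unfolding max_annihilator_def by blast
  then obtain u where u: "\<And>P. P \<in> ?A \<Longrightarrow> u P \<in> L - N \<and> P = colon R N (u P)" by metis
  have uc: "u P \<in> carrier R" if "P \<in> ?A" for P using u[OF that] ideal.Icarr[OF L] by auto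
  let ?C = "{Idl (N \<union> u ` F) | F. finite F \<and> F \<subseteq> ?A}"
  have sub: "N \<union> u ` F \<subseteq> carrier R" if "F \<subseteq> ?A" for F
    using that uc ideal.Icarr[OF N] by auto
  have "Idl (N \<union> u ` {}) \<in> ?C" by blast
  then have nonempty: "?C \<noteq> {}" by blast
  have ideals: "ideal J R" if "J \<in> ?C" for J
    using that sub genideal_ideal by auto
  have "\<exists>M\<in>?C. \<forall>J\<in>?C. M \<subseteq> J \<longrightarrow> J = M"
    by (rule exists_maximal_ideal_in[OF nonempty ideals])
  then obtain M where M: "M \<in> ?C" and max: "\<forall>J\<in>?C. M \<subseteq> J \<longrightarrow> J = M"
    by (elim bexE)
  then obtain F where F: "finite F" "F \<subseteq> ?A" "M = Idl (N \<union> u ` F)" by blast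
  have "?A \<subseteq> F"
  proof
    fix P assume P: "P \<in> ?A"
    have F': "insert P F \<subseteq> ?A" using F P by auto
    have "M \<subseteq> Idl (N \<union> u ` insert P F)"
      unfolding F(3) using sub[OF F']
      by (intro genideal_minimal genideal_ideal order.trans[OF _ genideal_self]) auto
    moreover have "Idl (N \<union> u ` insert P F) \<in> ?C" using F F' by blast
    ultimately have "Idl (N \<union> u ` insert P F) = M" by (intro max[rule_format])
    then have uP: "u P \<in> M" using genideal_self[OF sub[OF F']] by auto
    \<comment> \<open>Whatever kills the generators of \<open>M\<close> modulo \<open>N\<close> kills \<open>u P\<close>, so the intersection of \<open>F\<close> lies in \<open>P\<close>.\<close>
    have PP: "primeideal P R" using P max_annihilator_prime[OF L N] by auto
    have FI: "ideal Q R" if "Q \<in> F" for Q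
      using that F max_annihilator_prime[OF L N] by (auto dest: primeideal.axioms(1))
    have "\<exists>Q\<in>F. Q \<subseteq> P"
    proof (rule ccontr)
      assume "\<not> ?thesis"
      then obtain y where y: "y \<in> carrier R" "y \<notin> P" "\<forall>Q\<in>F. y \<in> Q"
        using exists_in_all_not_in_prime[OF PP F(1)] FI by metis
      let ?K = "{v \<in> carrier R. y \<otimes> v \<in> N}"
      have K: "?K = colon R N y" using y by (auto simp: colon_def m_comm)
      have "N \<union> u ` F \<subseteq> ?K"
      proof
        fix v assume "v \<in> N \<union> u ` F"
        then show "v \<in> ?K"
        proof
          assume "v \<in> N"
          then show ?thesis using y ideal.I_l_closed[OF N] ideal.Icarr[OF N] by auto
        next
          assume "v \<in> u ` F"
          then obtain Q where Q: "Q \<in> F" "v = u Q" by auto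
          then have "y \<in> colon R N (u Q)" using y u F by blast
          then show ?thesis using Q uc F by (auto simp: colon_def)
        qed
      qed
      then have "M \<subseteq> ?K" unfolding F(3) K
        by (intro genideal_minimal colon_ideal[OF L N y(1)])
      then have "y \<in> colon R N (u P)" using uP y by (auto simp: colon_def)
      then show False using u[OF P] y by auto
    qed
    then obtain Q where Q: "Q \<in> F" "Q \<subseteq> P" by auto
    then have "max_annihilator R L N Q" using F by auto
    moreover have "u P \<in> L - N" "P = colon R N (u P)" using u[OF P] by auto
    ultimately have "P = Q" using Q unfolding max_annihilator_def by metis
    then show "P \<in> F" using Q by simp
  qed
  then show ?thesis using F finite_subset by blast
qed

text \<open>
  An ideal that is maximal among those disjoint from a multiplicative set is prime.
\<close>

lemma exists_prime_disjoint:
  assumes J: "ideal J R" and T: "T \<subseteq> carrier R" "\<one> \<in> T"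
    and mult: "\<And>s t. s \<in> T \<Longrightarrow> t \<in> T \<Longrightarrow> s \<otimes> t \<in> T" and disj: "J \<inter> T = {}"
  obtains Q where "primeideal Q R" "J \<subseteq> Q" "Q \<inter> T = {}"
proof -
  let ?C = "{K. ideal K R \<and> J \<subseteq> K \<and> K \<inter> T = {}}"
  have nonempty: "?C \<noteq> {}" using J disj by auto
  have "\<exists>M\<in>?C. \<forall>J\<in>?C. M \<subseteq> J \<longrightarrow> J = M"
    by (rule exists_maximal_ideal_in[OF nonempty]) simp
  then obtain Q where Q: "Q \<in> ?C" and max: "\<forall>K\<in>?C. Q \<subseteq> K \<longrightarrow> K = Q"
    by (elim bexE)
  then have QI: "ideal Q R" by auto
  have meets: "\<exists>q\<in>Q. \<exists>r\<in>carrier R. q \<oplus> a \<otimes> r \<in> T" if a: "a \<in> carrier R" "a \<notin> Q" for a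
  proof (rule ccontr)
    assume no: "\<not> ?thesis"
    let ?K = "add_multiples R (carrier R) Q a"
    have K: "ideal ?K R" "Q \<subseteq> ?K"
      using add_multiples_ideal subset_add_multiples a oneideal QI by auto
    have "?K \<inter> T = {}" using no unfolding add_multiples_def by auto
    then have "?K = Q" using K Q by (intro max[rule_format]) auto
    moreover have "a \<otimes> \<one> \<in> ?K"
      using a multiple_in_add_multiples[OF oneideal QI a(1) one_closed] by simp
    ultimately show False using a by simp
  qed
  have "primeideal Q R"
  proof (rule primeidealI[OF QI cring_axioms])
    show "carrier R \<noteq> Q" using Q T by auto
    show "a \<in> Q \<or> b \<in> Q" if ab: "a \<in> carrier R" "b \<in> carrier R" "a \<otimes> b \<in> Q" for a b
    proof (rule ccontr)
      assume "\<not> (a \<in> Q \<or> b \<in> Q)"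
      then obtain q r q' r' where q: "q \<in> Q" "r \<in> carrier R" "q \<oplus> a \<otimes> r \<in> T"
        "q' \<in> Q" "r' \<in> carrier R" "q' \<oplus> b \<otimes> r' \<in> T"
        using meets[OF ab(1)] meets[OF ab(2)] by blast
      have qc: "q \<in> carrier R" "q' \<in> carrier R" using q ideal.Icarr[OF QI] by auto
      have "(q \<oplus> a \<otimes> r) \<otimes> (q' \<oplus> b \<otimes> r') =
          (q' \<oplus> b \<otimes> r') \<otimes> q \<oplus> ((a \<otimes> r) \<otimes> q' \<oplus> (r \<otimes> r') \<otimes> (a \<otimes> b))"
        using q qc ab by algebra
      also have "\<dots> \<in> Q"
      proof (intro ideal_add_closed[OF QI])
        show "(q' \<oplus> b \<otimes> r') \<otimes> q \<in> Q" "(a \<otimes> r) \<otimes> q' \<in> Q" "(r \<otimes> r') \<otimes> (a \<otimes> b) \<in> Q"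
          using q qc ab by (auto intro!: ideal.I_l_closed[OF QI])
      qed
      finally show False using mult[OF q(3,6)] Q by auto
    qed
  qed
  then show thesis using that Q by blast
qed

text \<open>
  In the localization at \<open>P\<close> the element \<open>x\<close> is still regular modulo \<open>N\<close>, so inverting it leaves a nonzero
  ring, and a prime of that ring gives \<open>Q\<close>. Localizations are avoided by taking a prime disjoint from
  the products \<open>s x\<^sup>k\<close> with \<open>s\<close> outside \<open>P\<close>.
\<close>

lemma smaller_prime_avoiding_nonzerodivisor:
  assumes N: "ideal N R" and P: "primeideal P R" "N \<subseteq> P" and x: "x \<in> P"
    and reg: "nonzerodivisor_on R (carrier R) N x"
  obtains Q where "primeideal Q R" "N \<subseteq> Q" "Q \<subset> P"
proof -
  interpret P: primeideal P R by fact
  have xc: "x \<in> carrier R" using x P.Icarr by auto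
  let ?T = "{s \<otimes> x [^] k | s (k::nat). s \<in> carrier R - P}" 
  have pow: "s \<in> N" if "s \<in> carrier R" "s \<otimes> x [^] k \<in> N" for s and k :: nat
    using that
  proof (induction k)
    case (Suc k)
    have "x \<otimes> (s \<otimes> x [^] k) = s \<otimes> x [^] Suc k" using xc Suc.prems(1) by (simp add: m_ac)
    then have "s \<otimes> x [^] k \<in> N"
      using reg Suc.prems xc unfolding nonzerodivisor_on_def by auto
    then show ?case using Suc by auto
  qed auto
  have one: "\<one> \<notin> P" using P.I_notcarr P.one_imp_carrier by auto
  have T1: "s \<in> ?T" if "s \<in> carrier R - P" for s
    using that by (intro CollectI exI[of _ s] exI[of _ "0::nat"]) auto
  have Tx: "x \<in> ?T"
    using one xc by (intro CollectI exI[of _ \<one>] exI[of _ "1::nat"]) auto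
  have disj: "N \<inter> ?T = {}" using pow P(2) by blast
  have Tc: "?T \<subseteq> carrier R" using xc by auto
  have mult: "s \<otimes> t \<in> ?T" if st: "s \<in> ?T" "t \<in> ?T" for s t
  proof -
    obtain s' k t' l where *: "s' \<in> carrier R - P" "t' \<in> carrier R - P" "s = s' \<otimes> x [^] (k::nat)"
      "t = t' \<otimes> x [^] (l::nat)" using st by blast
    have "s \<otimes> t = (s' \<otimes> t') \<otimes> x [^] (k + l)"
      using * xc by (simp add: nat_pow_mult[symmetric] m_ac)
    moreover have "s' \<otimes> t' \<in> carrier R - P" using * P.I_prime by auto
    ultimately show ?thesis by blast
  qed
  have "\<one> \<in> ?T" using T1 one by auto
  then obtain Q where Q: "primeideal Q R" "N \<subseteq> Q" "Q \<inter> ?T = {}"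
    by (rule exists_prime_disjoint[OF N Tc _ mult disj])
  have "Q \<subseteq> P" using Q(3) T1 ideal.Icarr[OF primeideal.axioms(1)[OF Q(1)]] by blast
  moreover have "x \<notin> Q" using Q(3) Tx by blast
  ultimately show thesis using that Q x by blast
qed

end

section \<open>Noetherian local rings\<close>

sublocale noetherian_local_ring \<subseteq> noetherian_cring ..

context noetherian_local_ring
begin

abbreviation \<mm> where "\<mm> \<equiv> max_ideal R"

lemma max_ideal_maximal: "maximalideal \<mm> R"
  unfolding max_ideal_def by (rule theI'[OF ex1_maximalideal])

lemma max_ideal_prime: "primeideal \<mm> R"
  using maximalideal_prime max_ideal_maximal by blast

lemma max_ideal_ideal: "ideal \<mm> R"
  using max_ideal_maximal by (rule maximalideal.axioms)

lemma max_ideal_carrier: "x \<in> \<mm> \<Longrightarrow> x \<in> carrier R"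
  using ideal.Icarr[OF max_ideal_ideal] .

lemma one_notin_max_ideal: "\<one> \<notin> \<mm>"
  using ideal.one_imp_carrier[OF max_ideal_ideal] maximalideal.I_notcarr[OF max_ideal_maximal] by auto

lemma proper_ideal_subset_max_ideal:
  assumes J: "ideal J R" and "J \<noteq> carrier R"
  shows "J \<subseteq> \<mm>"
proof -
  let ?C = "{K. ideal K R \<and> J \<subseteq> K \<and> \<one> \<notin> K}"
  have nonempty: "?C \<noteq> {}" using assms ideal.one_imp_carrier[OF J] by auto
  have "\<exists>M\<in>?C. \<forall>K\<in>?C. M \<subseteq> K \<longrightarrow> K = M"
    by (rule exists_maximal_ideal_in[OF nonempty]) simp
  then obtain M where M: "M \<in> ?C" and max: "\<forall>K\<in>?C. M \<subseteq> K \<longrightarrow> K = M" by (elim bexE)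
  have "maximalideal M R"
  proof (rule maximalidealI)
    show "ideal M R" using M by simp
    show "carrier R \<noteq> M" using M by auto
    show "K = M \<or> K = carrier R" if K: "ideal K R" "M \<subseteq> K" for K
    proof (cases "\<one> \<in> K")
      case True
      then show ?thesis using ideal.one_imp_carrier[OF K(1)] by simp
    next
      case False
      then have "K \<in> ?C" using K M by auto
      then show ?thesis using max K by auto
    qed
  qed
  then have "M = \<mm>" using ex1_maximalideal max_ideal_maximal by blast
  then show ?thesis using M by simp
qed

text \<open>
  Nakayama's lemma for multiplication by a single element, proved without determinants: divide by an
  ideal that is maximal among those not containing \<open>L\<close>.
\<close>

lemma nakayama:
  assumes N: "ideal N R" and L: "ideal L R" and x: "x \<in> \<mm>"
    and sub: "L \<subseteq> add_multiples R L N x"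
  shows "L \<subseteq> N"
proof (rule ccontr)
  assume nsub: "\<not> L \<subseteq> N"
  have xc: "x \<in> carrier R" using x max_ideal_carrier by simp
  let ?C = "{W. ideal W R \<and> N \<subseteq> W \<and> \<not> L \<subseteq> W}"
  have nonempty: "?C \<noteq> {}" using N nsub by auto
  have "\<exists>M\<in>?C. \<forall>K\<in>?C. M \<subseteq> K \<longrightarrow> K = M"
    by (rule exists_maximal_ideal_in[OF nonempty]) simp
  then obtain W where W: "W \<in> ?C" and max: "\<forall>K\<in>?C. W \<subseteq> K \<longrightarrow> K = W" by (elim bexE)
  then have WI: "ideal W R" and NW: "N \<subseteq> W" by auto
  \<comment> \<open>By maximality of \<open>W\<close> the module \<open>L / W\<close> is simple, so \<open>x\<close> annihilates it.\<close>
  have "x \<otimes> l \<in> W" if l: "l \<in> L" for l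
  proof (rule ccontr)
    assume notW: "x \<otimes> l \<notin> W"
    have lc: "l \<in> carrier R" and xlc: "x \<otimes> l \<in> carrier R" using l xc ideal.Icarr[OF L] by auto
    let ?K = "add_multiples R (carrier R) W (x \<otimes> l)"
    have K: "ideal ?K R" "W \<subseteq> ?K"
      using add_multiples_ideal subset_add_multiples oneideal WI xlc by auto
    have "x \<otimes> l \<in> ?K"
      using multiple_in_add_multiples[OF oneideal WI xlc one_closed] xlc by simp
    then have "?K \<noteq> W" using notW by auto
    then have "L \<subseteq> ?K" using K max NW by auto
    then obtain w r where w: "w \<in> W" and r: "r \<in> carrier R" and leq: "l = w \<oplus> (x \<otimes> l) \<otimes> r"
      using l by (blast elim: add_multiplesE)
    have wc: "w \<in> carrier R" using w ideal.Icarr[OF WI] by simp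
    have "(\<one> \<ominus> x \<otimes> r) \<otimes> l = l \<ominus> (x \<otimes> l) \<otimes> r" using xc r lc by algebra
    also have "\<dots> = (w \<oplus> (x \<otimes> l) \<otimes> r) \<ominus> (x \<otimes> l) \<otimes> r" using leq by simp
    also have "\<dots> = w" using wc xc r lc by algebra
    finally have "\<one> \<ominus> x \<otimes> r \<in> colon R W l" using w xc r by (simp add: colon_def)
    moreover have "colon R W l \<subseteq> \<mm>"
    proof (rule proper_ideal_subset_max_ideal[OF colon_ideal[OF L WI lc]])
      have "l \<notin> W" using notW xc ideal.I_l_closed[OF WI] by auto
      then have "\<one> \<notin> colon R W l" using lc by (simp add: colon_def)
      then show "colon R W l \<noteq> carrier R" by auto
    qed
    ultimately have "(\<one> \<ominus> x \<otimes> r) \<oplus> x \<otimes> r \<in> \<mm>"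
      using x r by (intro ideal_add_closed[OF max_ideal_ideal] ideal.I_r_closed[OF max_ideal_ideal]) auto
    moreover have "(\<one> \<ominus> x \<otimes> r) \<oplus> x \<otimes> r = \<one>" using xc r by algebra
    ultimately show False using one_notin_max_ideal by simp
  qed
  then have "add_multiples R L N x \<subseteq> W" using add_multiples_least[OF WI NW] by blast
  then show False using sub W by auto
qed

text \<open>
  If no nonzero element of either module is killed by \<open>J\<close>, then \<open>J\<close> is contained in no maximal annihilator,
  and prime avoidance applies to all of them at once.
\<close>

lemma exists_nonzerodivisor_on_both:
  assumes ideals: "ideal L R" "ideal N R" "ideal L' R" "ideal N' R" "ideal J R"
    and "\<And>u. u \<in> L \<Longrightarrow> (\<And>r. r \<in> J \<Longrightarrow> r \<otimes> u \<in> N) \<Longrightarrow> u \<in> N"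
    and "\<And>u. u \<in> L' \<Longrightarrow> (\<And>r. r \<in> J \<Longrightarrow> r \<otimes> u \<in> N') \<Longrightarrow> u \<in> N'"
  obtains z where "z \<in> J" "nonzerodivisor_on R L N z" "nonzerodivisor_on R L' N' z"
proof -
  let ?F = "{P. max_annihilator R L N P} \<union> {P. max_annihilator R L' N' P}"
  have "\<exists>z\<in>J. \<forall>P\<in>?F. z \<notin> P"
  proof (rule prime_avoidance)
    show "ideal J R" by fact
    show "finite ?F" using finite_max_annihilators ideals by simp
    show "primeideal P R" if "P \<in> ?F" for P
      using that max_annihilator_prime ideals by auto
    show "\<not> J \<subseteq> P" if "P \<in> ?F" for P
      using that assms(6,7) unfolding max_annihilator_def colon_def by blast
  qed
  then obtain z where z: "z \<in> J" "\<forall>P\<in>?F. z \<notin> P" by auto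
  then have "z \<in> carrier R" using ideal.Icarr[OF ideals(5)] by simp
  then show thesis using that z nonzerodivisor_iff_max_annihilators ideals by auto
qed

text \<open>
  The depth drops by at most one when a regular element \<open>x\<close> is divided out. If \<open>y1, y2, \<dots>\<close> is the given
  sequence, then \<open>y2\<close> shows that the maximal ideal kills no nonzero element modulo \<open>y1\<close>, so by exchange
  it kills none modulo \<open>x\<close>, and there is \<open>z\<close> that is regular modulo \<open>y1\<close> and modulo \<open>x\<close>. By induction modulo
  \<open>y1\<close>, a sequence shorter by two remains modulo \<open>y1\<close> and \<open>z\<close>, and \<open>y1\<close> followed by it is regular modulo \<open>z\<close>.
  By induction modulo \<open>z\<close>, a sequence of the same length remains modulo \<open>z\<close> and \<open>x\<close>, and \<open>z\<close> followed by it
  is the required sequence modulo \<open>x\<close>.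
\<close>

theorem regular_on_quotient:
  assumes "ideal L R" "ideal N R" "x \<in> \<mm>" "nonzerodivisor_on R L N x"
    and "regular_on R L N ys" "set ys \<subseteq> \<mm>" "length ys = Suc n"
  shows "\<exists>zs. length zs = n \<and> set zs \<subseteq> \<mm> \<and> regular_on R L (add_multiples R L N x) zs"
  using assms
proof (induction n arbitrary: N x ys)
  case 0
  then obtain y where ys: "ys = [y]" by (auto simp: length_Suc_conv)
  have "y \<in> carrier R" using 0 ys max_ideal_carrier by auto
  then have "\<not> L \<subseteq> N" using 0 ys subset_add_multiples[of L N y] by auto
  then have "\<not> L \<subseteq> add_multiples R L N x" using nakayama 0 by blast
  then show ?case by simp
next
  case (Suc n)
  note L = \<open>ideal L R\<close> and N = \<open>ideal N R\<close>
  obtain y1 ys' where ys: "ys = y1 # ys'" "length ys' = Suc n"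
    using Suc.prems(7) by (auto simp: length_Suc_conv)
  obtain y2 where y2: "y2 \<in> \<mm>" "nonzerodivisor_on R L (add_multiples R L N y1) y2"
    using ys Suc.prems(5,6) by (cases ys') auto
  have y1: "y1 \<in> \<mm>" "nonzerodivisor_on R L N y1" and x: "x \<in> \<mm>" "nonzerodivisor_on R L N x"
    and ys': "regular_on R L (add_multiples R L N y1) ys'" "set ys' \<subseteq> \<mm>"
    using Suc.prems ys by auto
  note carr = max_ideal_carrier[OF y1(1)] max_ideal_carrier[OF x(1)]
  have Ny: "ideal (add_multiples R L N y1) R" and Nx: "ideal (add_multiples R L N x) R"
    using add_multiples_ideal[OF L N] carr by auto
  have socle_y: "u \<in> add_multiples R L N y1"
    if "u \<in> L" "\<And>r. r \<in> \<mm> \<Longrightarrow> r \<otimes> u \<in> add_multiples R L N y1" for u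
    using y2 that unfolding nonzerodivisor_on_def by blast
  have socle_x: "u \<in> add_multiples R L N x"
    if u: "u \<in> L" "\<And>r. r \<in> \<mm> \<Longrightarrow> r \<otimes> u \<in> add_multiples R L N x" for u
  proof (rule ccontr)
    assume "u \<notin> add_multiples R L N x"
    then have "\<exists>w\<in>L. w \<notin> add_multiples R L N y1 \<and> (\<forall>r\<in>\<mm>. r \<otimes> w \<in> add_multiples R L N y1)"
      using u by (intro socle_exchange[OF L N carr(2) y1(1) _ x(2) y1(2)]) (auto intro: max_ideal_carrier)
    then show False using socle_y by blast
  qed
  obtain z where z: "z \<in> \<mm>" "nonzerodivisor_on R L (add_multiples R L N y1) z"
    "nonzerodivisor_on R L (add_multiples R L N x) z"
    by (rule exists_nonzerodivisor_on_both[OF L Ny L Nx max_ideal_ideal socle_y socle_x])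
  have zc: "z \<in> carrier R" using z max_ideal_carrier by simp
  let ?Nz = "add_multiples R L N z"
  have Nz: "ideal ?Nz R" using add_multiples_ideal[OF L N zc] .
  obtain zs where zs: "length zs = n" "set zs \<subseteq> \<mm>"
    "regular_on R L (add_multiples R L (add_multiples R L N y1) z) zs"
    using Suc.IH[OF L Ny z(1,2) ys' ys(2)] by auto
  have "regular_on R L ?Nz (y1 # zs)"
    using zs nonzerodivisor_swap[OF L N carr(1) zc y1(2) z(2)]
    by (simp add: add_multiples_commute[OF L N carr(1) zc])
  moreover have "nonzerodivisor_on R L ?Nz x"
    using nonzerodivisor_swap[OF L N carr(2) zc x(2) z(3)] .
  ultimately obtain ws where ws: "length ws = n" "set ws \<subseteq> \<mm>"
    "regular_on R L (add_multiples R L ?Nz x) ws"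
    using Suc.IH[OF L Nz x(1), of "y1 # zs"] zs y1 by auto
  have "regular_on R L (add_multiples R L N x) (z # ws)"
    using ws z by (simp add: add_multiples_commute[OF L N carr(2) zc])
  then show ?case using ws z by (intro exI[of _ "z # ws"]) auto
qed

end

context cring
begin

lemma regular_on_imp_nonzero:
  assumes "ideal L R" "ideal N R" "set xs \<subseteq> carrier R" "regular_on R L N xs"
  shows "\<not> L \<subseteq> N"
  using assms
proof (induction xs arbitrary: N)
  case (Cons x xs)
  then have "\<not> L \<subseteq> add_multiples R L N x" using add_multiples_ideal by auto
  then show ?case using Cons.prems subset_add_multiples[of L N x] by auto
qed simp

lemma regular_on_prefix:
  assumes "ideal L R" "ideal N R" "set (xs @ ys) \<subseteq> carrier R" "regular_on R L N (xs @ ys)"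
  shows "regular_on R L N xs"
  using assms
proof (induction xs arbitrary: N)
  case Nil
  then show ?case using regular_on_imp_nonzero by auto
next
  case (Cons x xs)
  then show ?case using add_multiples_ideal by auto
qed

lemma regular_on_take:
  assumes "ideal L R" "ideal N R" "set xs \<subseteq> carrier R" "regular_on R L N xs"
  shows "regular_on R L N (take n xs)"
  using regular_on_prefix[of L N "take n xs" "drop n xs"] assms by simp

end

context noetherian_local_ring
begin

text \<open>
  Take \<open>N\<close> maximal among the ideals for which \<open>L / N\<close> has regular sequences of every length. Dividing out one
  regular element keeps this property and enlarges \<open>N\<close>.
\<close>

lemma regular_sequence_length_bounded:
  assumes L: "ideal L R" and N: "ideal N R"
  shows "\<exists>n. \<forall>ys. set ys \<subseteq> \<mm> \<longrightarrow> regular_on R L N ys \<longrightarrow> length ys \<noteq> n"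
proof (rule ccontr)
  assume unbounded: "\<not> ?thesis"
  let ?C = "{N. ideal N R \<and> (\<forall>n. \<exists>ys. set ys \<subseteq> \<mm> \<and> regular_on R L N ys \<and> length ys = n)}"
  have nonempty: "?C \<noteq> {}" using unbounded N by blast
  have "\<exists>M\<in>?C. \<forall>K\<in>?C. M \<subseteq> K \<longrightarrow> K = M"
    by (rule exists_maximal_ideal_in[OF nonempty]) simp
  then obtain M where M: "M \<in> ?C" and max: "\<forall>K\<in>?C. M \<subseteq> K \<longrightarrow> K = M" by (elim bexE)
  then have MI: "ideal M R"
    and seqs: "\<And>n. \<exists>ys. set ys \<subseteq> \<mm> \<and> regular_on R L M ys \<and> length ys = n" by auto
  obtain zs where zs: "set zs \<subseteq> \<mm>" "regular_on R L M zs" "length zs = Suc 0"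
    using seqs[of "Suc 0"] by auto
  then obtain y ys where "zs = y # ys" by (cases zs) auto
  with zs have y: "y \<in> \<mm>" "nonzerodivisor_on R L M y" "regular_on R L (add_multiples R L M y) ys"
    "set ys \<subseteq> \<mm>" by auto
  have yc: "y \<in> carrier R" using y max_ideal_carrier by simp
  have I: "ideal (add_multiples R L M y) R" "M \<subseteq> add_multiples R L M y"
    using add_multiples_ideal[OF L MI yc] subset_add_multiples[OF L MI yc] by auto
  have "\<exists>zs. set zs \<subseteq> \<mm> \<and> regular_on R L (add_multiples R L M y) zs \<and> length zs = n" for n
    using seqs[of "Suc n"] regular_on_quotient[OF L MI y(1,2)] by blast
  then have "add_multiples R L M y = M" using I max by blast
  then have "L \<subseteq> M"
    using y(2) multiple_in_add_multiples[OF L MI yc] unfolding nonzerodivisor_on_def by auto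
  then show False using regular_on_imp_nonzero[OF L I(1) _ y(3)] y(4) I max_ideal_carrier by auto
qed

text \<open>
  This is \<open>depth M \<le> dim R / P\<close> for an associated prime \<open>P\<close> of \<open>M\<close>. Let \<open>y\<close> be \<open>M\<close>-regular and let \<open>U\<close> be the
  submodule killed by \<open>P\<close>. Regularity gives that \<open>U\<close> inside \<open>y M\<close> would imply \<open>U = y U\<close>, against Nakayama. So
  some element outside \<open>y M\<close> is killed by \<open>P\<close>, and also by \<open>y\<close> modulo \<open>y M\<close>. Its annihilator in \<open>M / y M\<close>
  lies below an associated prime, which contains \<open>P\<close> properly.
\<close>

lemma prime_chain_from_associated_prime:
  assumes L: "ideal L R" and "ideal N R" "set ys \<subseteq> \<mm>" "regular_on R L N ys"
    and "u \<in> L" "u \<notin> N" and "primeideal (colon R N u) R"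
  shows "\<exists>Q. prime_chain R Q (length ys) \<and> Q 0 = colon R N u"
  using assms(2-)
proof (induction ys arbitrary: N u)
  case Nil
  then show ?case by (intro exI[of _ "\<lambda>_. colon R N u"]) (simp add: prime_chain_def)
next
  case (Cons y ys)
  note N = \<open>ideal N R\<close>
  let ?P = "colon R N u" and ?N' = "add_multiples R L N y"
  have y: "y \<in> \<mm>" "nonzerodivisor_on R L N y" "regular_on R L ?N' ys" using Cons.prems by auto
  have yc: "y \<in> carrier R" using y max_ideal_carrier by simp
  have N': "ideal ?N' R" using add_multiples_ideal[OF L N yc] .
  let ?U = "{v \<in> L. \<forall>p\<in>?P. p \<otimes> v \<in> N}"
  note LN = ideal.Icarr[OF L] ideal.Icarr[OF N]
  have Pc: "p \<in> carrier R" if "p \<in> ?P" for p using that by (simp add: colon_def)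
  have U: "ideal ?U R"
  proof (rule ideal_criterion)
    show "?U \<subseteq> carrier R" using LN by auto
    show "\<zero> \<in> ?U" using ideal_zero_closed[OF L] ideal_zero_closed[OF N] Pc by auto
    show "v \<oplus> w \<in> ?U" if "v \<in> ?U" "w \<in> ?U" for v w
      using that Pc LN ideal_add_closed[OF L] ideal_add_closed[OF N] by (auto simp: r_distr)
    show "r \<otimes> v \<in> ?U" if "r \<in> carrier R" "v \<in> ?U" for r v
    proof -
      have "p \<otimes> (r \<otimes> v) = r \<otimes> (p \<otimes> v)" if "p \<in> ?P" for p
        using Pc[OF that] LN(1)[of v] \<open>r \<in> carrier R\<close> \<open>v \<in> ?U\<close> by (intro m_lcomm) auto
      then show ?thesis using that ideal.I_l_closed[OF L] ideal.I_l_closed[OF N] by auto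
    qed
  qed
  have "\<exists>v\<in>?U. v \<notin> ?N'"
  proof (rule ccontr)
    assume "\<not> ?thesis"
    then have sub: "?U \<subseteq> ?N'" by auto
    have "?U \<subseteq> add_multiples R ?U N y"
    proof
      fix v assume v: "v \<in> ?U"
      then obtain n l where n: "n \<in> N" and l: "l \<in> L" and veq: "v = n \<oplus> y \<otimes> l"
        using sub by (blast elim: add_multiplesE)
      have "p \<otimes> l \<in> N" if p: "p \<in> ?P" for p
      proof -
        note c = Pc[OF p] LN(2)[OF n] LN(1)[OF l] yc
        have "y \<otimes> (p \<otimes> l) = p \<otimes> (n \<oplus> y \<otimes> l) \<ominus> p \<otimes> n" using c by algebra
        also have "\<dots> \<in> N" unfolding veq[symmetric]
          using v p n c by (intro ideal_sub_closed[OF N] ideal.I_l_closed[OF N n]) auto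
        finally show ?thesis
          using y(2) ideal.I_l_closed[OF L l Pc[OF p]] unfolding nonzerodivisor_on_def by auto
      qed
      then show "v \<in> add_multiples R ?U N y" using veq n l add_multiplesI[of n N l ?U y] by simp
    qed
    then have "?U \<subseteq> N" using nakayama[OF N U y(1)] by simp
    moreover have "u \<in> ?U" using Cons.prems by (auto simp: colon_def)
    ultimately show False using Cons.prems by auto
  qed
  then obtain v where v: "v \<in> L" "\<forall>p\<in>?P. p \<otimes> v \<in> N" "v \<notin> ?N'" by auto
  obtain P' where P': "max_annihilator R L ?N' P'" "colon R ?N' v \<subseteq> P'"
    using annihilator_below_max[OF N' L v(1,3)] .
  obtain w where w: "w \<in> L" "w \<notin> ?N'" "P' = colon R ?N' w"
    using P'(1) unfolding max_annihilator_def by blast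
  have "primeideal P' R" using max_annihilator_prime[OF L N' P'(1)] .
  then obtain Q where Q: "prime_chain R Q (length ys)" "Q 0 = P'"
    using Cons.IH[OF N' _ y(3) w(1,2)] Cons.prems(2) w(3) by auto
  have "?P \<subseteq> colon R ?N' v"
    using v subset_add_multiples[OF L N yc] unfolding colon_def by auto
  moreover have "y \<in> colon R ?N' v"
    using multiple_in_add_multiples[OF L N yc v(1)] yc by (simp add: colon_def)
  moreover have "y \<notin> ?P" using y(2) Cons.prems unfolding nonzerodivisor_on_def colon_def by auto
  ultimately have "?P \<subset> P'" using P'(2) by auto
  then have "prime_chain R (case_nat ?P Q) (Suc (length ys))"
    using Cons.prems Q by (intro prime_chain_Suc) auto
  then show ?case by (intro exI[of _ "case_nat ?P Q"]) simp
qed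

text \<open>
  Here \<open>R / K\<close> has dimension at most the length of \<open>ys\<close>, and \<open>L / N\<close> is an \<open>R / K\<close>-module with the regular
  sequence \<open>ys\<close>, so it is a maximal Cohen-Macaulay module. Then every \<open>R / K\<close>-regular sequence is regular on it.
\<close>

lemma regular_on_transfer:
  assumes L: "ideal L R" and "ideal K R" "ideal N R" "set xs \<subseteq> \<mm>"
    and "regular_on R (carrier R) K xs"
    and "\<And>r u. r \<in> K \<Longrightarrow> u \<in> L \<Longrightarrow> r \<otimes> u \<in> N"
    and "\<And>Q n. prime_chain R Q n \<Longrightarrow> K \<subseteq> Q 0 \<Longrightarrow> n \<le> length ys"
    and "set ys \<subseteq> \<mm>" "regular_on R L N ys"
  shows "regular_on R L N xs"
  using assms(2-)
proof (induction xs arbitrary: K N ys)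
  case Nil
  have "set ys \<subseteq> carrier R" using Nil max_ideal_carrier by auto
  then show ?case using regular_on_imp_nonzero[OF L] Nil by auto
next
  case (Cons x xs)
  note K = \<open>ideal K R\<close> and N = \<open>ideal N R\<close>
  let ?K' = "add_multiples R (carrier R) K x" and ?N' = "add_multiples R L N x"
  have x: "x \<in> \<mm>" "nonzerodivisor_on R (carrier R) K x" "regular_on R (carrier R) ?K' xs"
    using Cons.prems by auto
  have xc: "x \<in> carrier R" using x max_ideal_carrier by simp
  have K': "ideal ?K' R" "K \<subseteq> ?K'" and N': "ideal ?N' R" "N \<subseteq> ?N'"
    using add_multiples_ideal subset_add_multiples oneideal L K N xc by auto
  have xK': "x \<in> ?K'"
    using multiple_in_add_multiples[OF oneideal K xc one_closed] xc by simp
  \<comment> \<open>A chain above a prime containing \<open>K\<close> and \<open>x\<close> can be prolonged at its lower end.\<close>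
  have longer: "Suc n \<le> length ys" if Q: "prime_chain R Q n" "K \<subseteq> Q 0" "x \<in> Q 0" for Q n
  proof -
    have "primeideal (Q 0) R" using Q by (simp add: prime_chain_def)
    then obtain q where q: "primeideal q R" "K \<subseteq> q" "q \<subset> Q 0"
      using smaller_prime_avoiding_nonzerodivisor[OF K _ Q(2,3) x(2)] by blast
    then have "prime_chain R (case_nat q Q) (Suc n)" using Q by (intro prime_chain_Suc)
    then show ?thesis using Cons.prems(6)[of "case_nat q Q" "Suc n"] q by simp
  qed
  have reg: "nonzerodivisor_on R L N x"
  proof (rule ccontr)
    assume "\<not> ?thesis"
    then obtain P where P: "max_annihilator R L N P" "x \<in> P"
      using nonzerodivisor_iff_max_annihilators[OF N L xc] by auto
    then obtain u where u: "u \<in> L" "u \<notin> N" "P = colon R N u"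
      unfolding max_annihilator_def by blast
    have "primeideal P R" using max_annihilator_prime[OF L N P(1)] .
    then obtain Q where Q: "prime_chain R Q (length ys)" "Q 0 = P"
      using prime_chain_from_associated_prime[OF L N Cons.prems(7,8) u(1,2)] u(3) by auto
    have "K \<subseteq> P" using Cons.prems(5) u ideal.Icarr[OF K] by (auto simp: colon_def)
    then show False using longer[OF Q(1)] Q(2) P(2) by auto
  qed
  have "K \<subseteq> \<mm>"
  proof (rule proper_ideal_subset_max_ideal[OF K])
    have "set (x # xs) \<subseteq> carrier R" using Cons.prems(3) max_ideal_carrier by auto
    then show "K \<noteq> carrier R" using regular_on_imp_nonzero[OF oneideal K _ Cons.prems(4)] by auto
  qed
  then have "Suc 0 \<le> length ys"
    using longer[of "\<lambda>_. \<mm>" 0] x max_ideal_prime by (simp add: prime_chain_def)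
  then obtain d where d: "length ys = Suc d" by (cases "length ys") auto
  obtain zs where zs: "length zs = d" "set zs \<subseteq> \<mm>" "regular_on R L ?N' zs"
    using regular_on_quotient[OF L N x(1) reg Cons.prems(8,7) d] by auto
  have "regular_on R L ?N' xs"
  proof (rule Cons.IH[OF K'(1) N'(1) _ x(3) _ _ zs(2,3)])
    show "set xs \<subseteq> \<mm>" using Cons.prems by auto
    show "r \<otimes> u \<in> ?N'" if r: "r \<in> ?K'" and u: "u \<in> L" for r u
    proof -
      obtain k s where k: "k \<in> K" and s: "s \<in> carrier R" and req: "r = k \<oplus> x \<otimes> s"
        using r by (elim add_multiplesE)
      note c = ideal.Icarr[OF K k] s xc ideal.Icarr[OF L u]
      have "r \<otimes> u = k \<otimes> u \<oplus> x \<otimes> (s \<otimes> u)" unfolding req using c by algebra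
      then show ?thesis
        using add_multiplesI[OF Cons.prems(5)[OF k u] ideal.I_l_closed[OF L u s]] by simp
    qed
    show "n \<le> length zs" if "prime_chain R Q n" "?K' \<subseteq> Q 0" for Q n
      using longer[OF that(1)] that(2) K' xK' zs d by auto
  qed
  then show ?case using reg by simp
qed

end

section \<open>Dimension and depth in terms of ideals\<close>

lemma enat_le_Sup_iff:
  assumes "S \<noteq> {}" and down: "\<And>m k. m \<in> S \<Longrightarrow> k \<le> m \<Longrightarrow> k \<in> S"
  shows "enat n \<le> Sup (enat ` S) \<longleftrightarrow> n \<in> S"
proof
  assume n: "enat n \<le> Sup (enat ` S)"
  show "n \<in> S"
  proof (rule ccontr)
    assume "n \<notin> S"
    then have less: "m < n" if "m \<in> S" for m using down that by (meson not_le)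
    then have "n \<noteq> 0" using assms(1) by auto
    have "Sup (enat ` S) \<le> enat (n - 1)"
      using less by (fastforce intro!: Sup_least)
    then have "enat n \<le> enat (n - 1)" using n by (rule order.trans[rotated])
    then show False using \<open>n \<noteq> 0\<close> by simp
  qed
qed (auto intro: Sup_upper)

text \<open>
  Depths and dimensions are compared through the lengths \<open>n\<close> of sequences and chains, which covers the
  value \<open>\<infinity>\<close> without a separate case.
\<close>

lemma enat_le_if_initial:
  assumes "\<And>n. enat n \<le> x \<Longrightarrow> enat n \<le> y" shows "x \<le> y"
proof (cases x)
  case (enat n) then show ?thesis using assms by simp
next
  case infinity
  then have "\<not> y < enat n" for n using assms[of n] by (simp add: not_less)
  then have "y = \<infinity>" by (cases y) (use enat_ord_simps(2) lessI in blast)+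
  then show ?thesis by simp
qed

lemma enat_le_krull_dim_iff:
  assumes "primeideal P0 R"
  shows "enat n \<le> krull_dim R \<longleftrightarrow> (\<exists>P. prime_chain R P n)"
proof -
  let ?S = "{n. \<exists>P. prime_chain R P n}"
  have "krull_dim R = Sup (enat ` ?S)"
    unfolding krull_dim_def prime_chain_def by (rule arg_cong[where f = Sup]) auto
  moreover have "0 \<in> ?S" using assms by (auto simp: prime_chain_def)
  then have "?S \<noteq> {}" by auto
  then have "enat n \<le> Sup (enat ` ?S) \<longleftrightarrow> n \<in> ?S"
    by (rule enat_le_Sup_iff) (auto dest: prime_chain_mono)
  ultimately show ?thesis by simp
qed

lemma primeideal_vimage:
  assumes "ring_hom_cring R S h" and "primeideal P S"
  shows "primeideal {r \<in> carrier R. h r \<in> P} R"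
proof -
  interpret ring_hom_cring R S h by fact
  interpret P: primeideal P S by fact
  show ?thesis
  proof (rule primeidealI)
    show "ideal {r \<in> carrier R. h r \<in> P} R"
      by (rule ring_hom_ring.ideal_vimage[OF _ P.is_ideal])
        (rule ring_hom_ringI2[OF R.ring_axioms S.ring_axioms homh])
    show "cring R" by (rule R.is_cring)
    have "\<one>\<^bsub>S\<^esub> \<notin> P" using P.one_imp_carrier P.I_notcarr by auto
    then show "carrier R \<noteq> {r \<in> carrier R. h r \<in> P}" using hom_one R.one_closed by force
    show "a \<in> {r \<in> carrier R. h r \<in> P} \<or> b \<in> {r \<in> carrier R. h r \<in> P}"
      if "a \<in> carrier R" "b \<in> carrier R" "a \<otimes>\<^bsub>R\<^esub> b \<in> {r \<in> carrier R. h r \<in> P}" for a b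
      using that P.I_prime[of "h a" "h b"] by auto
  qed
qed

lemma krull_dim_le_if_surjective:
  assumes hom: "ring_hom_cring R S h" and surj: "h ` carrier R = carrier S" and "primeideal P0 S"
  shows "krull_dim S \<le> krull_dim R"
proof (rule enat_le_if_initial)
  let ?v = "\<lambda>P. {r \<in> carrier R. h r \<in> P}"
  fix n assume "enat n \<le> krull_dim S"
  then obtain P where P: "prime_chain S P n" using enat_le_krull_dim_iff assms(3) by blast
  have "?v (P i) \<subset> ?v (P (Suc i))" if "i < n" for i
  proof -
    have "P i \<subset> P (Suc i)" "primeideal (P (Suc i)) S" using P that by (auto simp: prime_chain_def)
    then obtain s where s: "s \<in> P (Suc i)" "s \<notin> P i" by blast
    then have "s \<in> carrier S"
      using ideal.Icarr[OF primeideal.axioms(1)] \<open>primeideal (P (Suc i)) S\<close> by metis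
    then obtain r where "r \<in> carrier R" "s = h r" using surj by auto
    then show ?thesis using s \<open>P i \<subset> P (Suc i)\<close> by blast
  qed
  then have "prime_chain R (\<lambda>i. ?v (P i)) n"
    using P primeideal_vimage[OF hom] by (simp add: prime_chain_def)
  then show "enat n \<le> krull_dim R"
    using enat_le_krull_dim_iff[OF primeideal_vimage[OF hom assms(3)]] by blast
qed

text \<open>
  The dimension of a faithful module is that of \<open>R / {0}\<close>, whose elements are singleton cosets.
\<close>

lemma krull_dim_quotient_zero:
  fixes R (structure)
  assumes "cring R" and P0: "primeideal P0 R"
  shows "krull_dim (R Quot {\<zero>}) = krull_dim R"
proof -
  interpret cring R by fact
  let ?Q = "R Quot {\<zero>}" and ?h = "(+>) {\<zero>}"
  have Q: "cring ?Q" using ideal.quotient_is_cring[OF zeroideal cring_axioms] .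
  have h: "?h r = {r}" if "r \<in> carrier R" for r using that by (auto simp: a_r_coset_def')
  have hom: "ring_hom_cring R ?Q ?h" using ideal.rcos_ring_hom_cring[OF zeroideal cring_axioms] .
  have surj: "?h ` carrier R = carrier ?Q" by (auto simp: FactRing_simps)
  have "inj_on ?h (carrier R)" using h by (auto intro: inj_onI)
  then have iso: "?h \<in> ring_iso R ?Q"
    using surj hom by (auto simp: ring_iso_def bij_betw_def ring_hom_cring.homh)
  let ?g = "inv_into (carrier R) ?h"
  have g: "?g \<in> ring_iso ?Q R" using ring_iso_set_sym[OF ring_axioms iso] .
  then have hom': "ring_hom_cring ?Q R ?g" and surj': "?g ` carrier ?Q = carrier R"
    using Q cring_axioms
    by (auto simp: ring_iso_def bij_betw_def intro!: ring_hom_cring.intro ring_hom_cring_axioms.intro)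
  have "primeideal {q \<in> carrier ?Q. ?g q \<in> P0} ?Q" using primeideal_vimage[OF hom' P0] .
  then show ?thesis
    using krull_dim_le_if_surjective[OF hom surj] krull_dim_le_if_surjective[OF hom' surj' P0]
    by (simp add: antisym)
qed

subsection \<open>Regular sequences on modules\<close>

lemma regular_on_iff_nth:
  "regular_on R L N xs \<longleftrightarrow>
    (\<forall>i<length xs. nonzerodivisor_on R L (foldl (add_multiples R L) N (take i xs)) (xs ! i)) \<and>
    \<not> L \<subseteq> foldl (add_multiples R L) N xs"
proof (induction xs arbitrary: N)
  case (Cons x xs)
  show ?case by (auto simp: Cons.IH All_less_Suc2)
qed simp

text \<open>
  An ideal of \<open>S\<close> as an \<open>R\<close>-module. This covers the \<open>R\<close>-modules \<open>R\<close>, \<open>I\<close> and \<open>A\<close> and the \<open>A\<close>-module \<open>A\<close>, and ties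
  the depth of each of them to ideals of \<open>S\<close>.
\<close>

locale ideal_as_module = \<phi>: ring_hom_cring R S \<phi> for R S \<phi> + fixes L assumes L: "ideal L S"
begin

definition "M = (restrict_scalars S \<phi>)\<lparr>carrier := L\<rparr>"

lemma M_simps [simp]:
  "carrier M = L" "\<zero>\<^bsub>M\<^esub> = \<zero>\<^bsub>S\<^esub>" "x \<oplus>\<^bsub>M\<^esub> y = x \<oplus>\<^bsub>S\<^esub> y" "r \<odot>\<^bsub>M\<^esub> x = \<phi> r \<otimes>\<^bsub>S\<^esub> x"
  by (simp_all add: M_def restrict_scalars_def)

lemma L_carrier: "x \<in> L \<Longrightarrow> x \<in> carrier S"
  using ideal.Icarr[OF L] .

lemma abelian_group_M: "abelian_group M"
proof (rule abelian_groupI)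
  show "\<exists>y\<in>carrier M. y \<oplus>\<^bsub>M\<^esub> x = \<zero>\<^bsub>M\<^esub>" if "x \<in> carrier M" for x
    using that additive_subgroup.a_inv_closed[OF ideal.axioms(1)[OF L]] L_carrier
    by (intro bexI[of _ "\<ominus>\<^bsub>S\<^esub> x"]) (auto simp: \<phi>.S.l_neg)
qed (auto simp: L_carrier \<phi>.S.a_ac ideal_add_closed[OF L] ideal_zero_closed[OF L])

lemma module_M: "module R M"
  by (rule moduleI[OF \<phi>.R.is_cring abelian_group_M])
    (auto simp: L_carrier \<phi>.S.l_distr \<phi>.S.r_distr \<phi>.S.m_assoc ideal.I_l_closed[OF L])

lemma minus_M: "x \<in> L \<Longrightarrow> \<ominus>\<^bsub>M\<^esub> x = \<ominus>\<^bsub>S\<^esub> x"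
proof -
  assume x: "x \<in> L"
  interpret M: abelian_group M by (rule abelian_group_M)
  have "\<ominus>\<^bsub>S\<^esub> x \<in> carrier M" "\<ominus>\<^bsub>S\<^esub> x \<oplus>\<^bsub>M\<^esub> x = \<zero>\<^bsub>M\<^esub>"
    using x additive_subgroup.a_inv_closed[OF ideal.axioms(1)[OF L]] L_carrier by (auto simp: \<phi>.S.l_neg)
  then show ?thesis using x M.minus_equality by auto
qed

lemma submoduleI:
  assumes "ideal J S" "J \<subseteq> L" shows "submodule J R M"
proof (rule module.submoduleI[OF module_M])
  show "\<ominus>\<^bsub>M\<^esub> x \<in> J" if "x \<in> J" for x
    using that assms additive_subgroup.a_inv_closed[OF ideal.axioms(1)] minus_M by fastforce
qed (use assms in \<open>auto simp: ideal_add_closed ideal_zero_closed ideal.I_l_closed\<close>)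

lemma foldl_ideal:
  assumes "ideal N S" "set ys \<subseteq> carrier S"
  shows "ideal (foldl (add_multiples S L) N ys) S \<and> N \<subseteq> foldl (add_multiples S L) N ys \<and>
    (\<forall>y\<in>set ys. \<forall>l\<in>L. y \<otimes>\<^bsub>S\<^esub> l \<in> foldl (add_multiples S L) N ys)"
  using assms
proof (induction ys arbitrary: N)
  case (Cons y ys)
  have y: "y \<in> carrier S" using Cons.prems by auto
  note N' = \<phi>.S.add_multiples_ideal[OF L Cons.prems(1) y] \<phi>.S.subset_add_multiples[OF L Cons.prems(1) y]
    \<phi>.S.multiple_in_add_multiples[OF L Cons.prems(1) y]
  show ?case using Cons.IH[OF N'(1)] N'(2,3) Cons.prems by auto
qed simp

lemma foldl_least:
  assumes "submodule H R M" "N \<subseteq> H" "\<And>x l. x \<in> set xs \<Longrightarrow> l \<in> L \<Longrightarrow> \<phi> x \<otimes>\<^bsub>S\<^esub> l \<in> H"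
  shows "foldl (add_multiples S L) N (map \<phi> xs) \<subseteq> H"
  using assms(2,3)
proof (induction xs arbitrary: N)
  case (Cons x xs)
  have "add_multiples S L N (\<phi> x) \<subseteq> H"
  proof
    fix y assume "y \<in> add_multiples S L N (\<phi> x)"
    then obtain n l where "n \<in> N" "l \<in> L" "y = n \<oplus>\<^bsub>S\<^esub> \<phi> x \<otimes>\<^bsub>S\<^esub> l" by (rule \<phi>.S.add_multiplesE)
    then show "y \<in> H"
      using Cons.prems module.submoduleE(5)[OF module_M assms(1), of n "\<phi> x \<otimes>\<^bsub>S\<^esub> l"] by auto
  qed
  then show ?case using Cons by auto
qed simp

lemma foldl_subset_L:
  assumes xs: "set xs \<subseteq> carrier R"
  shows "foldl (add_multiples S L) {\<zero>\<^bsub>S\<^esub>} (map \<phi> xs) \<subseteq> L"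
proof (rule foldl_least[OF submoduleI[OF L]])
  show "\<phi> x \<otimes>\<^bsub>S\<^esub> l \<in> L" if "x \<in> set xs" "l \<in> L" for x l
    using that xs by (auto intro!: ideal.I_l_closed[OF L])
qed (simp_all add: ideal_zero_closed[OF L])

lemma seq_submodule_eq:
  assumes xs: "set xs \<subseteq> carrier R"
  shows "seq_submodule R M xs = foldl (add_multiples S L) {\<zero>\<^bsub>S\<^esub>} (map \<phi> xs)"
    (is "_ = ?F")
proof (rule antisym)
  let ?G = "{x \<odot>\<^bsub>M\<^esub> m | x m. x \<in> set xs \<and> m \<in> carrier M}"
  have ys: "set (map \<phi> xs) \<subseteq> carrier S" using xs by auto
  have F: "ideal ?F S" "\<And>x l. x \<in> set xs \<Longrightarrow> l \<in> L \<Longrightarrow> \<phi> x \<otimes>\<^bsub>S\<^esub> l \<in> ?F"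
    using foldl_ideal[OF \<phi>.S.zeroideal ys] by auto
  have "?F \<subseteq> L" using foldl_subset_L[OF xs] .
  then have "submodule ?F R M" using submoduleI F by auto
  moreover have "?G \<subseteq> ?F" using F by auto
  ultimately show "seq_submodule R M xs \<subseteq> ?F"
    unfolding seq_submodule_def submodule_span_def by blast
  show "?F \<subseteq> seq_submodule R M xs"
    unfolding seq_submodule_def submodule_span_def
  proof (rule Inter_greatest)
    fix H assume "H \<in> {N. submodule N R M \<and> ?G \<subseteq> N}"
    then have H: "submodule H R M" "?G \<subseteq> H" by auto
    have "\<zero>\<^bsub>S\<^esub> \<in> H" using subgroup.one_closed[OF submodule.axioms(1)[OF H(1)]] by simp
    then show "?F \<subseteq> H" using H by (intro foldl_least[OF H(1)]) auto
  qed
qed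

lemma regular_sequence_iff:
  "regular_sequence R M xs \<longleftrightarrow> set xs \<subseteq> carrier R \<and> regular_on S L {\<zero>\<^bsub>S\<^esub>} (map \<phi> xs)"
proof (cases "set xs \<subseteq> carrier R")
  case True
  then have take: "set (take i xs) \<subseteq> carrier R" for i using set_take_subset by fast
  have "seq_submodule R M xs \<noteq> L \<longleftrightarrow> \<not> L \<subseteq> foldl (add_multiples S L) {\<zero>\<^bsub>S\<^esub>} (map \<phi> xs)"
    using seq_submodule_eq[OF True] foldl_subset_L[OF True] by auto
  then show ?thesis
    using True unfolding regular_sequence_def regular_on_iff_nth nonzerodivisor_on_def
    by (auto simp: seq_submodule_eq[OF take] take_map)
qed (simp add: regular_sequence_def)

lemma enat_le_depth_iff:
  assumes "noetherian_local_ring R" and "L \<noteq> {\<zero>\<^bsub>S\<^esub>}"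
  shows "enat n \<le> depth R M \<longleftrightarrow>
    (\<exists>xs. length xs = n \<and> set xs \<subseteq> max_ideal R \<and> regular_on S L {\<zero>\<^bsub>S\<^esub>} (map \<phi> xs))"
proof -
  interpret R: noetherian_local_ring R by fact
  let ?A = "{xs. set xs \<subseteq> max_ideal R \<and> regular_on S L {\<zero>\<^bsub>S\<^esub>} (map \<phi> xs)}"
  let ?S = "length ` ?A"
  have carr: "set xs \<subseteq> carrier R" if "set xs \<subseteq> max_ideal R" for xs
    using that R.max_ideal_carrier by auto
  have "depth R M = Sup (enat ` ?S)"
    using assms(2) carr unfolding depth_def regular_sequence_iff
    by (auto intro!: arg_cong[where f = Sup])
  moreover have "[] \<in> ?A" using assms(2) ideal_zero_closed[OF L] by auto
  then have "?S \<noteq> {}" by blast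
  then have "enat n \<le> Sup (enat ` ?S) \<longleftrightarrow> n \<in> ?S"
  proof (rule enat_le_Sup_iff)
    fix m k assume "m \<in> ?S" "k \<le> m"
    then obtain xs where xs: "xs \<in> ?A" "m = length xs" by auto
    have "set (map \<phi> xs) \<subseteq> carrier S" using xs carr[of xs] by auto
    then have "regular_on S L {\<zero>\<^bsub>S\<^esub>} (map \<phi> (take k xs))"
      using xs \<phi>.S.regular_on_take[OF L \<phi>.S.zeroideal, of "map \<phi> xs" k] by (simp add: take_map)
    moreover have "set (take k xs) \<subseteq> max_ideal R" using xs set_take_subset[of k xs] by auto
    ultimately have "take k xs \<in> ?A" "length (take k xs) = k" using xs \<open>k \<le> m\<close> by auto
    then show "k \<in> ?S" by (metis imageI)
  qed
  ultimately show ?thesis by auto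
qed

end

section \<open>Quadratic extensions \<open>R \<oplus> I\<close>\<close>

text \<open>
  An axiomatic description of \<open>A = R \<oplus> I\<close>, with \<open>\<phi>\<close> and \<open>\<tau>\<close> the inclusions of the two summands; \<open>\<tau> i\<close> stands for
  \<open>i t\<close>, where \<open>t\<^sup>2 = - a t - b\<close>.
\<close>

locale ideal_extension = R: noetherian_local_ring R + A: cring A
  for R :: "('a, 'm) ring_scheme" (structure) and A :: "('c, 'n) ring_scheme" +
  fixes I :: "'a set" and a b :: 'a and \<phi> \<tau> :: "'a \<Rightarrow> 'c"
  assumes I: "ideal I R" and I_nonzero: "I \<noteq> {\<zero>}" and I_proper: "I \<noteq> carrier R"
    and a [simp]: "a \<in> carrier R" and b [simp]: "b \<in> carrier R"
    and \<phi>: "\<phi> \<in> ring_hom R A"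
    and \<tau>_closed [simp]: "i \<in> I \<Longrightarrow> \<tau> i \<in> carrier A"
    and \<tau>_add: "i \<in> I \<Longrightarrow> j \<in> I \<Longrightarrow> \<tau> (i \<oplus> j) = \<tau> i \<oplus>\<^bsub>A\<^esub> \<tau> j"
    and \<tau>_smult: "r \<in> carrier R \<Longrightarrow> i \<in> I \<Longrightarrow> \<tau> (r \<otimes> i) = \<phi> r \<otimes>\<^bsub>A\<^esub> \<tau> i"
    and \<tau>_\<tau>: "i \<in> I \<Longrightarrow> j \<in> I \<Longrightarrow>
      \<tau> i \<otimes>\<^bsub>A\<^esub> \<tau> j = \<ominus>\<^bsub>A\<^esub> (\<phi> (b \<otimes> (i \<otimes> j)) \<oplus>\<^bsub>A\<^esub> \<tau> (a \<otimes> (i \<otimes> j)))"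
    and decompose: "x \<in> carrier A \<Longrightarrow> \<exists>r\<in>carrier R. \<exists>i\<in>I. x = \<phi> r \<oplus>\<^bsub>A\<^esub> \<tau> i"
    and independent: "r \<in> carrier R \<Longrightarrow> i \<in> I \<Longrightarrow> \<phi> r \<oplus>\<^bsub>A\<^esub> \<tau> i = \<zero>\<^bsub>A\<^esub> \<Longrightarrow> r = \<zero> \<and> i = \<zero>"
begin

sublocale \<phi>: ring_hom_cring R A \<phi>
  by (intro ring_hom_cring.intro ring_hom_cring_axioms.intro R.cring_axioms A.cring_axioms \<phi>)

lemma I_carrier [simp]: "i \<in> I \<Longrightarrow> i \<in> carrier R"
  using ideal.Icarr[OF I] .

lemma I_closed [simp]:
  "i \<in> I \<Longrightarrow> j \<in> I \<Longrightarrow> i \<oplus> j \<in> I" "i \<in> I \<Longrightarrow> j \<in> I \<Longrightarrow> i \<ominus> j \<in> I" "\<zero> \<in> I"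
  "r \<in> carrier R \<Longrightarrow> i \<in> I \<Longrightarrow> r \<otimes> i \<in> I" "r \<in> carrier R \<Longrightarrow> i \<in> I \<Longrightarrow> i \<otimes> r \<in> I"
  using ideal_add_closed[OF I] ideal_sub_closed[OF I] ideal_zero_closed[OF I]
    ideal.I_l_closed[OF I] ideal.I_r_closed[OF I] by auto

lemma I_max: "I \<subseteq> R.\<mm>"
  using R.proper_ideal_subset_max_ideal[OF I I_proper] .

definition pair :: "'a \<Rightarrow> 'a \<Rightarrow> 'c" where "pair r i = \<phi> r \<oplus>\<^bsub>A\<^esub> \<tau> i"

definition pairs :: "'a set \<Rightarrow> 'a set \<Rightarrow> 'c set"
  where "pairs X Y = {pair r i | r i. r \<in> X \<and> i \<in> Y}"

lemma pairsI: "r \<in> X \<Longrightarrow> i \<in> Y \<Longrightarrow> pair r i \<in> pairs X Y"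
  unfolding pairs_def by blast

lemma pair_closed [simp]: "r \<in> carrier R \<Longrightarrow> i \<in> I \<Longrightarrow> pair r i \<in> carrier A"
  by (simp add: pair_def)

lemma pairE:
  assumes "x \<in> carrier A"
  obtains r i where "r \<in> carrier R" "i \<in> I" "x = pair r i"
  using decompose[OF assms] unfolding pair_def by blast

lemma pair_add:
  assumes "r \<in> carrier R" "i \<in> I" "s \<in> carrier R" "j \<in> I"
  shows "pair r i \<oplus>\<^bsub>A\<^esub> pair s j = pair (r \<oplus> s) (i \<oplus> j)"
proof -
  have c: "\<phi> r \<in> carrier A" "\<phi> s \<in> carrier A" "\<tau> i \<in> carrier A" "\<tau> j \<in> carrier A" using assms by auto
  have "(\<phi> r \<oplus>\<^bsub>A\<^esub> \<tau> i) \<oplus>\<^bsub>A\<^esub> (\<phi> s \<oplus>\<^bsub>A\<^esub> \<tau> j) = (\<phi> r \<oplus>\<^bsub>A\<^esub> \<phi> s) \<oplus>\<^bsub>A\<^esub> (\<tau> i \<oplus>\<^bsub>A\<^esub> \<tau> j)"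
    using c by algebra
  then show ?thesis using assms by (simp add: pair_def \<tau>_add)
qed

lemma smult_pair:
  assumes "s \<in> carrier R" "r \<in> carrier R" "i \<in> I"
  shows "\<phi> s \<otimes>\<^bsub>A\<^esub> pair r i = pair (s \<otimes> r) (s \<otimes> i)"
  using assms by (simp add: pair_def \<tau>_smult A.r_distr)

lemma \<tau>_zero: "\<tau> \<zero> = \<zero>\<^bsub>A\<^esub>"
  using \<tau>_smult[of \<zero> \<zero>] by simp

lemma pair_zero: "r \<in> carrier R \<Longrightarrow> pair r \<zero> = \<phi> r"
  by (simp add: pair_def \<tau>_zero)

lemma pair_eq_iff:
  assumes "r \<in> carrier R" "i \<in> I" "s \<in> carrier R" "j \<in> I"
  shows "pair r i = pair s j \<longleftrightarrow> r = s \<and> i = j"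
proof
  assume eq: "pair r i = pair s j"
  have "pair (r \<ominus> s) (i \<ominus> j) \<oplus>\<^bsub>A\<^esub> pair s j = pair r i"
  proof -
    have "(r \<ominus> s) \<oplus> s = r" "(i \<ominus> j) \<oplus> j = i" using assms I_carrier by algebra+
    then show ?thesis using assms by (simp add: pair_add)
  qed
  then have "pair (r \<ominus> s) (i \<ominus> j) = \<zero>\<^bsub>A\<^esub>"
    using eq assms by (metis A.add.r_cancel_one' I_closed(2) R.minus_closed pair_closed)
  then have "r \<ominus> s = \<zero> \<and> i \<ominus> j = \<zero>" using assms by (intro independent) (auto simp: pair_def)
  then show "r = s \<and> i = j" using assms by (simp add: R.r_right_minus_eq)
qed simp

lemma \<tau>_uminus: "i \<in> I \<Longrightarrow> \<tau> (\<ominus> i) = \<ominus>\<^bsub>A\<^esub> \<tau> i"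
  using \<tau>_smult[of "\<ominus> \<one>" i] by (simp add: R.l_minus A.l_minus)

lemma \<tau>_mult_pair:
  assumes "i \<in> I" "r \<in> carrier R" "j \<in> I"
  shows "\<tau> i \<otimes>\<^bsub>A\<^esub> pair r j = pair (\<ominus> (b \<otimes> (i \<otimes> j))) (r \<otimes> i \<ominus> a \<otimes> (i \<otimes> j))"
proof -
  have ij: "i \<otimes> j \<in> I" "a \<otimes> (i \<otimes> j) \<in> I" "\<ominus> (a \<otimes> (i \<otimes> j)) \<in> I"
    using assms additive_subgroup.a_inv_closed[OF ideal.axioms(1)[OF I]] by auto
  have c: "\<phi> r \<in> carrier A" "\<tau> i \<in> carrier A" "\<tau> j \<in> carrier A" "\<phi> (b \<otimes> (i \<otimes> j)) \<in> carrier A"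
    "\<tau> (a \<otimes> (i \<otimes> j)) \<in> carrier A" using assms ij by auto
  have "\<tau> (r \<otimes> i \<ominus> a \<otimes> (i \<otimes> j)) = \<phi> r \<otimes>\<^bsub>A\<^esub> \<tau> i \<ominus>\<^bsub>A\<^esub> \<tau> (a \<otimes> (i \<otimes> j))"
    using assms ij by (simp add: a_minus_def \<tau>_add \<tau>_smult[of r i] \<tau>_uminus)
  moreover have "\<tau> i \<otimes>\<^bsub>A\<^esub> pair r j = \<phi> r \<otimes>\<^bsub>A\<^esub> \<tau> i \<oplus>\<^bsub>A\<^esub> \<tau> i \<otimes>\<^bsub>A\<^esub> \<tau> j"
    unfolding pair_def using c by algebra
  moreover have "\<phi> r \<otimes>\<^bsub>A\<^esub> \<tau> i \<oplus>\<^bsub>A\<^esub> \<ominus>\<^bsub>A\<^esub> (\<phi> (b \<otimes> (i \<otimes> j)) \<oplus>\<^bsub>A\<^esub> \<tau> (a \<otimes> (i \<otimes> j))) =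
      \<ominus>\<^bsub>A\<^esub> \<phi> (b \<otimes> (i \<otimes> j)) \<oplus>\<^bsub>A\<^esub> (\<phi> r \<otimes>\<^bsub>A\<^esub> \<tau> i \<ominus>\<^bsub>A\<^esub> \<tau> (a \<otimes> (i \<otimes> j)))"
    using c by algebra
  ultimately show ?thesis using assms ij by (simp add: pair_def \<tau>_\<tau>)
qed

lemma pair_in_pairs_iff:
  assumes "X \<subseteq> carrier R" "Y \<subseteq> I" "r \<in> carrier R" "i \<in> I"
  shows "pair r i \<in> pairs X Y \<longleftrightarrow> r \<in> X \<and> i \<in> Y"
proof
  assume "pair r i \<in> pairs X Y"
  then obtain s j where "s \<in> X" "j \<in> Y" "pair r i = pair s j" by (auto simp: pairs_def)
  then show "r \<in> X \<and> i \<in> Y" using assms pair_eq_iff[of r i s j] by auto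
qed (auto simp: pairs_def)

lemma pairs_carrier: "pairs (carrier R) I = carrier A"
  by (auto simp: pairs_def elim: pairE)

lemma pairs_zero: "pairs {\<zero>} {\<zero>} = {\<zero>\<^bsub>A\<^esub>}"
  by (simp add: pairs_def pair_def \<tau>_zero)

text \<open>
  The characteristic polynomial of \<open>r + i t\<close>: multiplication by it has trace \<open>2 r - a i\<close> and norm
  \<open>r\<^sup>2 - a r i + b i\<^sup>2\<close>.
\<close>

lemma trace_norm:
  assumes r: "r \<in> carrier R" and i: "i \<in> I"
  defines "t \<equiv> r \<oplus> r \<ominus> a \<otimes> i" and "n \<equiv> r \<otimes> r \<ominus> a \<otimes> (r \<otimes> i) \<oplus> b \<otimes> (i \<otimes> i)"
  shows "pair r i \<otimes>\<^bsub>A\<^esub> pair r i = \<phi> t \<otimes>\<^bsub>A\<^esub> pair r i \<ominus>\<^bsub>A\<^esub> \<phi> n"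
proof -
  have "pair r i \<otimes>\<^bsub>A\<^esub> pair r i = \<phi> r \<otimes>\<^bsub>A\<^esub> pair r i \<oplus>\<^bsub>A\<^esub> \<tau> i \<otimes>\<^bsub>A\<^esub> pair r i"
    using assms by (simp add: pair_def A.l_distr)
  also have "\<dots> = pair (r \<otimes> r \<oplus> \<ominus> (b \<otimes> (i \<otimes> i))) (r \<otimes> i \<oplus> (r \<otimes> i \<ominus> a \<otimes> (i \<otimes> i)))"
    using r i by (simp add: smult_pair \<tau>_mult_pair pair_add)
  finally have 1: "pair r i \<otimes>\<^bsub>A\<^esub> pair r i =
    pair (r \<otimes> r \<oplus> \<ominus> (b \<otimes> (i \<otimes> i))) (r \<otimes> i \<oplus> (r \<otimes> i \<ominus> a \<otimes> (i \<otimes> i)))" .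
  have tn: "t \<in> carrier R" "n \<in> carrier R" using r i by (auto simp: t_def n_def)
  have "\<phi> t \<otimes>\<^bsub>A\<^esub> pair r i \<ominus>\<^bsub>A\<^esub> \<phi> n = pair (t \<otimes> r) (t \<otimes> i) \<oplus>\<^bsub>A\<^esub> pair (\<ominus> n) \<zero>"
    using tn r i by (simp add: smult_pair pair_zero a_minus_def)
  also have "\<dots> = pair (t \<otimes> r \<oplus> \<ominus> n) (t \<otimes> i)"
    using tn r i by (simp add: pair_add)
  also have "t \<otimes> r \<oplus> \<ominus> n = r \<otimes> r \<oplus> \<ominus> (b \<otimes> (i \<otimes> i))"
    unfolding t_def n_def using r I_carrier[OF i] a b by algebra
  also have "t \<otimes> i = r \<otimes> i \<oplus> (r \<otimes> i \<ominus> a \<otimes> (i \<otimes> i))"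
    unfolding t_def using r I_carrier[OF i] a by algebra
  finally show ?thesis using 1 by simp
qed

lemma pairs_ideal:
  assumes K: "ideal K R"
  shows "ideal (pairs K (K \<inter> I)) A"
proof (rule A.ideal_criterion)
  note Kc = ideal.Icarr[OF K]
  show "pairs K (K \<inter> I) \<subseteq> carrier A" using Kc by (auto simp: pairs_def)
  have "pair \<zero> \<zero> \<in> pairs K (K \<inter> I)" using ideal_zero_closed[OF K] by (intro pairsI) auto
  then show "\<zero>\<^bsub>A\<^esub> \<in> pairs K (K \<inter> I)" by (simp add: pair_zero)
  have add: "x \<oplus>\<^bsub>A\<^esub> y \<in> pairs K (K \<inter> I)" if xy: "x \<in> pairs K (K \<inter> I)" "y \<in> pairs K (K \<inter> I)" for x y
  proof -
    obtain r i s j where *: "r \<in> K" "i \<in> K \<inter> I" "s \<in> K" "j \<in> K \<inter> I" "x = pair r i" "y = pair s j"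
      using xy unfolding pairs_def by blast
    then have "x \<oplus>\<^bsub>A\<^esub> y = pair (r \<oplus> s) (i \<oplus> j)" using Kc by (simp add: pair_add)
    moreover have "r \<oplus> s \<in> K" "i \<oplus> j \<in> K \<inter> I" using * ideal_add_closed[OF K] by auto
    ultimately show ?thesis by (simp add: pairsI)
  qed
  show "x \<oplus>\<^bsub>A\<^esub> y \<in> pairs K (K \<inter> I)" if "x \<in> pairs K (K \<inter> I)" "y \<in> pairs K (K \<inter> I)" for x y
    using add that .
  show "x \<otimes>\<^bsub>A\<^esub> y \<in> pairs K (K \<inter> I)" if x: "x \<in> carrier A" and y: "y \<in> pairs K (K \<inter> I)" for x y
  proof -
    obtain r i where x: "r \<in> carrier R" "i \<in> I" "x = pair r i" using pairE[OF x] .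
    obtain s j where y: "s \<in> K" "j \<in> K" "j \<in> I" "y = pair s j" using y unfolding pairs_def by blast
    have sc: "s \<in> carrier R" using Kc y by simp
    have "x \<otimes>\<^bsub>A\<^esub> y = \<phi> r \<otimes>\<^bsub>A\<^esub> pair s j \<oplus>\<^bsub>A\<^esub> \<tau> i \<otimes>\<^bsub>A\<^esub> pair s j"
      unfolding x y pair_def[of r i] using x(1,2) y(3) sc by (simp add: A.l_distr)
    also have "\<dots> = pair (r \<otimes> s) (r \<otimes> j) \<oplus>\<^bsub>A\<^esub> pair (\<ominus> (b \<otimes> (i \<otimes> j))) (s \<otimes> i \<ominus> a \<otimes> (i \<otimes> j))"
      using x y sc by (simp add: smult_pair \<tau>_mult_pair)
    also have "\<dots> \<in> pairs K (K \<inter> I)"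
    proof (rule add)
      show "pair (r \<otimes> s) (r \<otimes> j) \<in> pairs K (K \<inter> I)"
        using x y ideal.I_l_closed[OF K] by (intro pairsI) auto
      have ij: "i \<otimes> j \<in> K" "i \<otimes> j \<in> I" "s \<otimes> i \<in> K" "s \<otimes> i \<in> I"
        using x y sc ideal.I_l_closed[OF K] ideal.I_r_closed[OF K] by auto
      have "\<ominus> (b \<otimes> (i \<otimes> j)) \<in> K"
        using additive_subgroup.a_inv_closed[OF ideal.axioms(1)[OF K]] ideal.I_l_closed[OF K ij(1) b] by simp
      moreover have "s \<otimes> i \<ominus> a \<otimes> (i \<otimes> j) \<in> K"
        using ideal_sub_closed[OF K ij(3) ideal.I_l_closed[OF K ij(1) a]] .
      moreover have "s \<otimes> i \<ominus> a \<otimes> (i \<otimes> j) \<in> I"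
        using ideal_sub_closed[OF I ij(4) ideal.I_l_closed[OF I ij(2) a]] .
      ultimately show "pair (\<ominus> (b \<otimes> (i \<otimes> j))) (s \<otimes> i \<ominus> a \<otimes> (i \<otimes> j)) \<in> pairs K (K \<inter> I)"
        by (intro pairsI) auto
    qed
    finally show ?thesis .
  qed
qed

lemma integral_over:
  assumes K: "ideal K R" and y: "y \<in> pairs K (K \<inter> I)"
  shows "\<exists>p\<in>K. \<exists>q\<in>K. y \<otimes>\<^bsub>A\<^esub> y = \<phi> p \<otimes>\<^bsub>A\<^esub> y \<ominus>\<^bsub>A\<^esub> \<phi> q"
proof -
  obtain r i where *: "r \<in> K" "i \<in> K" "i \<in> I" "y = pair r i" using y unfolding pairs_def by blast
  have r: "r \<in> carrier R" using ideal.Icarr[OF K] * by simp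
  show ?thesis
  proof (intro bexI)
    show "y \<otimes>\<^bsub>A\<^esub> y = \<phi> (r \<oplus> r \<ominus> a \<otimes> i) \<otimes>\<^bsub>A\<^esub> y \<ominus>\<^bsub>A\<^esub> \<phi> (r \<otimes> r \<ominus> a \<otimes> (r \<otimes> i) \<oplus> b \<otimes> (i \<otimes> i))"
      using trace_norm[OF r *(3)] * by simp
    show "r \<oplus> r \<ominus> a \<otimes> i \<in> K" "r \<otimes> r \<ominus> a \<otimes> (r \<otimes> i) \<oplus> b \<otimes> (i \<otimes> i) \<in> K"
      using * r by (auto intro!: ideal_sub_closed[OF K] ideal_add_closed[OF K] ideal.I_l_closed[OF K])
  qed
qed

definition contraction :: "'c set \<Rightarrow> 'a set"
  where "contraction J = {r \<in> carrier R. \<phi> r \<in> J}"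

lemma contraction_ideal: "ideal J A \<Longrightarrow> ideal (contraction J) R"
  unfolding contraction_def
  by (rule ring_hom_ring.ideal_vimage)
    (rule ring_hom_ringI2[OF R.ring_axioms A.ring_axioms \<phi>])

lemma contraction_prime: "primeideal P A \<Longrightarrow> primeideal (contraction P) R"
  unfolding contraction_def by (rule primeideal_vimage[OF \<phi>.ring_hom_cring_axioms])

text \<open>
  The norm of \<open>r + i t\<close> is a multiple of \<open>r + i t\<close>, and it agrees with \<open>r\<^sup>2\<close> modulo the maximal ideal of \<open>R\<close>. So a
  proper ideal of \<open>A\<close> contains no element with \<open>r\<close> a unit, and \<open>A\<close> is local.
\<close>

lemma proper_ideal_subset:
  assumes J: "ideal J A" and proper: "J \<noteq> carrier A"
  shows "J \<subseteq> pairs R.\<mm> I"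
proof
  fix y assume y: "y \<in> J"
  then obtain r i where ri: "r \<in> carrier R" "i \<in> I" "y = pair r i"
    using ideal.Icarr[OF J] pairE by blast
  have "\<one>\<^bsub>A\<^esub> \<notin> J" using proper ideal.one_imp_carrier[OF J] by auto
  then have "contraction J \<noteq> carrier R" unfolding contraction_def using \<phi>.hom_one R.one_closed by force
  then have J_max: "contraction J \<subseteq> R.\<mm>"
    by (rule R.proper_ideal_subset_max_ideal[OF contraction_ideal[OF J]])
  let ?t = "r \<oplus> r \<ominus> a \<otimes> i" and ?n = "r \<otimes> r \<ominus> a \<otimes> (r \<otimes> i) \<oplus> b \<otimes> (i \<otimes> i)"
  have tn: "?t \<in> carrier R" "?n \<in> carrier R" using ri by auto
  have c: "\<phi> ?t \<in> carrier A" "\<phi> ?n \<in> carrier A" "y \<in> carrier A" using tn ri by auto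
  have yy: "y \<otimes>\<^bsub>A\<^esub> y = \<phi> ?t \<otimes>\<^bsub>A\<^esub> y \<ominus>\<^bsub>A\<^esub> \<phi> ?n" using trace_norm[OF ri(1,2)] ri by simp
  have "\<phi> ?n = \<phi> ?t \<otimes>\<^bsub>A\<^esub> y \<ominus>\<^bsub>A\<^esub> (\<phi> ?t \<otimes>\<^bsub>A\<^esub> y \<ominus>\<^bsub>A\<^esub> \<phi> ?n)" using c by algebra
  also have "\<dots> \<in> J" unfolding yy[symmetric]
    using y c by (intro ideal_sub_closed[OF J] ideal.I_l_closed[OF J]) auto
  finally have n: "?n \<in> R.\<mm>" using J_max tn by (auto simp: contraction_def)
  note mm = R.max_ideal_ideal
  have i: "i \<in> R.\<mm>" using ri I_max by auto
  have "r \<otimes> r = ?n \<oplus> (a \<otimes> (r \<otimes> i) \<ominus> b \<otimes> (i \<otimes> i))"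
    using ri I_carrier[OF ri(2)] a b by algebra
  also have "\<dots> \<in> R.\<mm>"
  proof (rule ideal_add_closed[OF mm n])
    show "a \<otimes> (r \<otimes> i) \<ominus> b \<otimes> (i \<otimes> i) \<in> R.\<mm>"
      using i ri by (intro ideal_sub_closed[OF mm] ideal.I_l_closed[OF mm]) auto
  qed
  finally have "r \<in> R.\<mm>" using primeideal.I_prime[OF R.max_ideal_prime] ri by blast
  then show "y \<in> pairs R.\<mm> I" using ri by (simp add: pairsI)
qed

lemma pairs_max_ideal: "ideal (pairs R.\<mm> I) A" "pairs R.\<mm> I \<noteq> carrier A"
proof -
  show "ideal (pairs R.\<mm> I) A"
    using pairs_ideal[OF R.max_ideal_ideal] I_max by (simp add: Int_absorb1)
  have "pair \<one> \<zero> \<notin> pairs R.\<mm> I"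
    using R.one_notin_max_ideal R.max_ideal_carrier by (subst pair_in_pairs_iff) auto
  then show "pairs R.\<mm> I \<noteq> carrier A" using pair_closed[OF R.one_closed I_closed(3)] by metis
qed

lemma maximalideal_iff: "maximalideal M A \<longleftrightarrow> M = pairs R.\<mm> I"
proof
  assume M: "maximalideal M A"
  interpret maximalideal M A by fact
  have "M \<subseteq> pairs R.\<mm> I" using proper_ideal_subset is_ideal I_notcarr by blast
  then show "M = pairs R.\<mm> I"
    using I_maximal[OF pairs_max_ideal(1)] pairs_max_ideal ideal.Icarr[OF pairs_max_ideal(1)] by auto
next
  assume M: "M = pairs R.\<mm> I"
  show "maximalideal M A"
    unfolding M using pairs_max_ideal proper_ideal_subset by (intro maximalidealI) auto
qed

text \<open>
  An ideal of \<open>A\<close> is determined, within a chain, by its contraction to \<open>R\<close> and by the second coordinates of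
  its elements. Both are ideals of \<open>R\<close>, so the chain condition passes from \<open>R\<close> to \<open>A\<close>.
\<close>

lemma noetherian_A: "noetherian_ring A"
proof (rule A.trivial_ideal_chain_imp_noetherian)
  fix C assume "C \<noteq> {}" and chain: "subset.chain {J. ideal J A} C"
  have CI: "ideal J A" if "J \<in> C" for J using chain that unfolding pred_on.chain_def by blast
  let ?S = "\<lambda>J. {i \<in> I. \<exists>r\<in>carrier R. pair r i \<in> J}"
  have S_ideal: "ideal (?S J) R" if J: "ideal J A" for J
  proof (rule R.ideal_criterion)
    show "?S J \<subseteq> carrier R" by auto
    have "pair \<zero> \<zero> \<in> J" using ideal_zero_closed[OF J] by (simp add: pair_zero)
    then show "\<zero> \<in> ?S J" by auto
    show "i \<oplus> j \<in> ?S J" if ij: "i \<in> ?S J" "j \<in> ?S J" for i j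
    proof -
      obtain r s where rs: "r \<in> carrier R" "s \<in> carrier R" "pair r i \<in> J" "pair s j \<in> J" using ij by auto
      then have "pair (r \<oplus> s) (i \<oplus> j) \<in> J" using ideal_add_closed[OF J rs(3,4)] ij by (simp add: pair_add)
      then show ?thesis using ij rs by auto
    qed
    show "s \<otimes> i \<in> ?S J" if si: "s \<in> carrier R" "i \<in> ?S J" for s i
    proof -
      obtain r where r: "r \<in> carrier R" "pair r i \<in> J" using si by auto
      then have "\<phi> s \<otimes>\<^bsub>A\<^esub> pair r i \<in> J" using ideal.I_l_closed[OF J] si by auto
      then have "pair (s \<otimes> r) (s \<otimes> i) \<in> J" using r si by (simp add: smult_pair)
      then show ?thesis using si r by auto
    qed
  qed
  have eq: "J = J'"
    if J: "ideal J A" "ideal J' A" "J \<subseteq> J'" "contraction J' \<subseteq> contraction J" "?S J' \<subseteq> ?S J" for J J'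
  proof (rule antisym[OF J(3)], rule subsetI)
    fix y assume y: "y \<in> J'"
    then obtain r i where ri: "r \<in> carrier R" "i \<in> I" "y = pair r i"
      using ideal.Icarr[OF J(2)] pairE by blast
    then have "i \<in> ?S J" using J(5) y by auto
    then obtain s where s: "s \<in> carrier R" "pair s i \<in> J" by auto
    have "pair (r \<ominus> s) \<zero> \<oplus>\<^bsub>A\<^esub> pair s i = y"
    proof -
      have "r \<ominus> s \<oplus> s = r" using ri s by algebra
      then show ?thesis using ri s by (simp add: pair_add)
    qed
    then have y': "y = \<phi> (r \<ominus> s) \<oplus>\<^bsub>A\<^esub> pair s i" using ri s by (simp add: pair_zero)
    have "\<phi> (r \<ominus> s) = (\<phi> (r \<ominus> s) \<oplus>\<^bsub>A\<^esub> pair s i) \<ominus>\<^bsub>A\<^esub> pair s i"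
    proof -
      have "\<phi> (r \<ominus> s) \<in> carrier A" "pair s i \<in> carrier A" using ri s by auto
      then show ?thesis by algebra
    qed
    also have "\<dots> \<in> J'" unfolding y'[symmetric] using y s J by (intro ideal_sub_closed) auto
    finally have "\<phi> (r \<ominus> s) \<in> J" using J(4) ri s by (auto simp: contraction_def)
    then show "y \<in> J" unfolding y' using s J by (intro ideal_add_closed) auto
  qed
  have "\<exists>M\<in>contraction ` C. \<forall>K\<in>contraction ` C. M \<subseteq> K \<longrightarrow> K = M"
    using \<open>C \<noteq> {}\<close> CI contraction_ideal by (intro R.exists_maximal_ideal_in) auto
  then obtain J0 where J0: "J0 \<in> C" "\<forall>J\<in>C. contraction J0 \<subseteq> contraction J \<longrightarrow> contraction J = contraction J0"
    by auto
  have "\<exists>M\<in>?S ` C. \<forall>K\<in>?S ` C. M \<subseteq> K \<longrightarrow> K = M"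
    using \<open>C \<noteq> {}\<close> CI S_ideal by (intro R.exists_maximal_ideal_in) auto
  then obtain J1 where J1: "J1 \<in> C" "\<forall>J\<in>C. ?S J1 \<subseteq> ?S J \<longrightarrow> ?S J = ?S J1"
    by auto
  have comparable: "J \<subseteq> J' \<or> J' \<subseteq> J" if "J \<in> C" "J' \<in> C" for J J'
    using chain that unfolding pred_on.chain_def by blast
  have mono: "contraction J \<subseteq> contraction J'" "?S J \<subseteq> ?S J'" if "J \<subseteq> J'" for J J'
    using that by (auto simp: contraction_def)
  define M where "M = J0 \<union> J1"
  have M: "M \<in> C" "J0 \<subseteq> M" "J1 \<subseteq> M" using comparable[OF J0(1) J1(1)] J0 J1 by (auto simp: M_def sup.absorb1 sup.absorb2)
  have "J \<subseteq> M" if J: "J \<in> C" for J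
  proof (cases "M \<subseteq> J")
    case True
    have "contraction J = contraction J0" "contraction M = contraction J0" "?S J = ?S J1" "?S M = ?S J1"
      using J0(2) J1(2) J M mono order.trans[OF M(2) True] order.trans[OF M(3) True] by auto
    then have "M = J" using eq[OF CI[OF M(1)] CI[OF J] True] by simp
    then show ?thesis by simp
  qed (use comparable[OF J M(1)] in auto)
  then have "\<Union>C = M" using M by auto
  then show "\<Union>C \<in> C" using M by simp
qed

sublocale A: noetherian_local_ring A
  using maximalideal_iff
  by (intro noetherian_local_ring.intro noetherian_local_ring_axioms.intro noetherian_A A.cring_axioms) auto

lemma max_ideal_A: "max_ideal A = pairs R.\<mm> I"
  using A.max_ideal_maximal maximalideal_iff by simp

lemma \<phi>_max_ideal: "r \<in> R.\<mm> \<Longrightarrow> \<phi> r \<in> max_ideal A"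
  using pair_zero[of r] R.max_ideal_carrier[of r] I_closed(3) unfolding max_ideal_A pairs_def
  by (metis (mono_tags, lifting) mem_Collect_eq)

end

context ideal_extension
begin

lemma add_multiples_pairs:
  assumes X: "ideal X R" and Y: "ideal Y R" "Y \<subseteq> I" and x: "x \<in> carrier R"
  shows "add_multiples A (carrier A) (pairs X Y) (\<phi> x) =
    pairs (add_multiples R (carrier R) X x) (add_multiples R I Y x)"
proof -
  note c = ideal.Icarr[OF X] ideal.Icarr[OF Y(1)] subsetD[OF Y(2)]
  have key: "pair r i \<oplus>\<^bsub>A\<^esub> \<phi> x \<otimes>\<^bsub>A\<^esub> pair s j = pair (r \<oplus> x \<otimes> s) (i \<oplus> x \<otimes> j)"
    if "r \<in> X" "i \<in> Y" "s \<in> carrier R" "j \<in> I" for r i s j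
    using that c x by (simp add: smult_pair pair_add)
  show ?thesis
  proof (rule antisym; rule subsetI)
    fix y assume "y \<in> add_multiples A (carrier A) (pairs X Y) (\<phi> x)"
    then obtain n l where "n \<in> pairs X Y" and l: "l \<in> carrier A" and y: "y = n \<oplus>\<^bsub>A\<^esub> \<phi> x \<otimes>\<^bsub>A\<^esub> l"
      by (rule A.add_multiplesE)
    then obtain r i where n: "r \<in> X" "i \<in> Y" "n = pair r i" unfolding pairs_def by blast
    obtain s j where l: "s \<in> carrier R" "j \<in> I" "l = pair s j" using pairE[OF l] .
    show "y \<in> pairs (add_multiples R (carrier R) X x) (add_multiples R I Y x)"
      unfolding y n(3) l(3) key[OF n(1,2) l(1,2)]
      using n l by (intro pairsI R.add_multiplesI)
  next
    fix y assume "y \<in> pairs (add_multiples R (carrier R) X x) (add_multiples R I Y x)"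
    then obtain u v where u: "u \<in> add_multiples R (carrier R) X x" and v: "v \<in> add_multiples R I Y x"
      and y: "y = pair u v" unfolding pairs_def by blast
    obtain r s where rs: "r \<in> X" "s \<in> carrier R" "u = r \<oplus> x \<otimes> s" using u by (rule R.add_multiplesE)
    obtain i j where ij: "i \<in> Y" "j \<in> I" "v = i \<oplus> x \<otimes> j" using v by (rule R.add_multiplesE)
    show "y \<in> add_multiples A (carrier A) (pairs X Y) (\<phi> x)"
      unfolding y rs(3) ij(3) key[OF rs(1) ij(1) rs(2) ij(2), symmetric]
      using rs ij by (intro A.add_multiplesI pairsI) auto
  qed
qed

lemma nonzerodivisor_on_pairs_iff:
  assumes X: "ideal X R" and Y: "ideal Y R" "Y \<subseteq> I" and x: "x \<in> carrier R"
  shows "nonzerodivisor_on A (carrier A) (pairs X Y) (\<phi> x) \<longleftrightarrow>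
    nonzerodivisor_on R (carrier R) X x \<and> nonzerodivisor_on R I Y x"
proof -
  have Xc: "X \<subseteq> carrier R" using ideal.Icarr[OF X] by auto
  have zero: "\<zero> \<in> X" "\<zero> \<in> Y" using ideal_zero_closed X Y by auto
  have mem: "\<phi> x \<otimes>\<^bsub>A\<^esub> pair r i \<in> pairs X Y \<longleftrightarrow> x \<otimes> r \<in> X \<and> x \<otimes> i \<in> Y"
    if "r \<in> carrier R" "i \<in> I" for r i
    using that x Xc Y by (simp add: smult_pair pair_in_pairs_iff)
  have "nonzerodivisor_on A (carrier A) (pairs X Y) (\<phi> x) \<longleftrightarrow>
      (\<forall>r\<in>carrier R. \<forall>i\<in>I. x \<otimes> r \<in> X \<and> x \<otimes> i \<in> Y \<longrightarrow> r \<in> X \<and> i \<in> Y)"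
    unfolding nonzerodivisor_on_def
  proof (intro iffI ballI impI)
    fix r i assume *: "\<forall>l\<in>carrier A. \<phi> x \<otimes>\<^bsub>A\<^esub> l \<in> pairs X Y \<longrightarrow> l \<in> pairs X Y"
      and ri: "r \<in> carrier R" "i \<in> I" "x \<otimes> r \<in> X \<and> x \<otimes> i \<in> Y"
    then have "pair r i \<in> pairs X Y" using mem[OF ri(1,2)] by simp
    then show "r \<in> X \<and> i \<in> Y" using pair_in_pairs_iff[OF Xc Y(2) ri(1,2)] by simp
  next
    fix l assume *: "\<forall>r\<in>carrier R. \<forall>i\<in>I. x \<otimes> r \<in> X \<and> x \<otimes> i \<in> Y \<longrightarrow> r \<in> X \<and> i \<in> Y"
      and l: "l \<in> carrier A" "\<phi> x \<otimes>\<^bsub>A\<^esub> l \<in> pairs X Y"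
    obtain r i where ri: "r \<in> carrier R" "i \<in> I" "l = pair r i" using pairE[OF l(1)] .
    then show "l \<in> pairs X Y" using * l(2) mem[OF ri(1,2)] pairsI by simp
  qed
  also have "\<dots> \<longleftrightarrow> nonzerodivisor_on R (carrier R) X x \<and> nonzerodivisor_on R I Y x"
    unfolding nonzerodivisor_on_def
  proof (intro iffI conjI ballI impI)
    fix r i assume *: "(\<forall>l\<in>carrier R. x \<otimes> l \<in> X \<longrightarrow> l \<in> X) \<and> (\<forall>l\<in>I. x \<otimes> l \<in> Y \<longrightarrow> l \<in> Y)"
      and "r \<in> carrier R" "i \<in> I" "x \<otimes> r \<in> X \<and> x \<otimes> i \<in> Y"
    then show "r \<in> X" "i \<in> Y" by auto
  next
    fix r assume "\<forall>r\<in>carrier R. \<forall>i\<in>I. x \<otimes> r \<in> X \<and> x \<otimes> i \<in> Y \<longrightarrow> r \<in> X \<and> i \<in> Y" "r \<in> carrier R" "x \<otimes> r \<in> X"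
    then show "r \<in> X" using zero x I_closed(3) by (metis R.r_null)
  next
    fix i assume "\<forall>r\<in>carrier R. \<forall>i\<in>I. x \<otimes> r \<in> X \<and> x \<otimes> i \<in> Y \<longrightarrow> r \<in> X \<and> i \<in> Y" "i \<in> I" "x \<otimes> i \<in> Y"
    then show "i \<in> Y" using zero x by (metis R.r_null R.zero_closed)
  qed
  finally show ?thesis .
qed

text \<open>
  Regularity splits over the direct sum \<open>R / X \<oplus> I / Y\<close>. For a single summand it includes that the summand
  does not vanish after division by \<open>xs\<close>, which Nakayama's lemma provides.
\<close>

lemma regular_on_pairs_iff:
  assumes "ideal X R" "ideal Y R" "Y \<subseteq> I" and "\<not> carrier R \<subseteq> X" "\<not> I \<subseteq> Y" and "set xs \<subseteq> R.\<mm>"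
  shows "regular_on A (carrier A) (pairs X Y) (map \<phi> xs) \<longleftrightarrow>
    regular_on R (carrier R) X xs \<and> regular_on R I Y xs"
  using assms
proof (induction xs arbitrary: X Y)
  case Nil
  then obtain r where r: "r \<in> carrier R" "r \<notin> X" by auto
  have "X \<subseteq> carrier R" using ideal.Icarr[OF Nil(1)] by auto
  then have "pair r \<zero> \<in> carrier A - pairs X Y" using Nil r by (simp add: pair_in_pairs_iff)
  then have "\<not> carrier A \<subseteq> pairs X Y" by auto
  then show ?case using Nil by simp
next
  case (Cons x xs)
  let ?X = "add_multiples R (carrier R) X x" and ?Y = "add_multiples R I Y x"
  have x: "x \<in> R.\<mm>" "x \<in> carrier R" and xs: "set xs \<subseteq> R.\<mm>" using Cons.prems R.max_ideal_carrier by auto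
  have ideals: "ideal ?X R" "ideal ?Y R"
    using R.add_multiples_ideal Cons.prems(1,2) R.oneideal I x(2) by auto
  have "?Y \<subseteq> I" using Cons.prems x(2) by (intro R.add_multiples_least[OF I]) auto
  moreover have "\<not> carrier R \<subseteq> ?X" "\<not> I \<subseteq> ?Y"
    using R.nakayama[OF Cons.prems(1) R.oneideal x(1)] R.nakayama[OF Cons.prems(2) I x(1)]
      Cons.prems(4,5) by auto
  ultimately have "regular_on A (carrier A) (pairs ?X ?Y) (map \<phi> xs) \<longleftrightarrow>
      regular_on R (carrier R) ?X xs \<and> regular_on R I ?Y xs"
    using Cons.IH[OF ideals] xs by simp
  then show ?case
    using nonzerodivisor_on_pairs_iff[OF Cons.prems(1-3) x(2)]
      add_multiples_pairs[OF Cons.prems(1-3) x(2)] by auto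
qed

lemma not_zero: "\<not> carrier R \<subseteq> {\<zero>}" "\<not> I \<subseteq> {\<zero>}" "\<not> carrier A \<subseteq> {\<zero>\<^bsub>A\<^esub>}"
proof -
  show "\<not> I \<subseteq> {\<zero>}" using I_nonzero I_closed(3) by auto
  then show R: "\<not> carrier R \<subseteq> {\<zero>}" using I_carrier by blast
  have "\<one>\<^bsub>A\<^esub> \<noteq> \<zero>\<^bsub>A\<^esub>" using A.one_notin_max_ideal ideal_zero_closed[OF A.max_ideal_ideal] by auto
  then show "\<not> carrier A \<subseteq> {\<zero>\<^bsub>A\<^esub>}" by auto
qed

lemma regular_on_A_iff:
  assumes "set xs \<subseteq> R.\<mm>"
  shows "regular_on A (carrier A) {\<zero>\<^bsub>A\<^esub>} (map \<phi> xs) \<longleftrightarrow>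
    regular_on R (carrier R) {\<zero>} xs \<and> regular_on R I {\<zero>} xs"
  using regular_on_pairs_iff[OF R.zeroideal R.zeroideal _ not_zero(1,2) assms] by (simp add: pairs_zero)

subsection \<open>Depth over \<open>A\<close> and over \<open>R\<close>\<close>

text \<open>
  No maximal annihilator of \<open>A / N\<close> contains the maximal ideal of \<open>R\<close>, since it would then contain the regular
  element \<open>y\<close>. Prime avoidance for the contracted primes yields a regular element \<open>\<phi> x\<close> with \<open>x\<close> in \<open>R\<close>, and
  \<open>A / N\<close> modulo \<open>\<phi> x\<close> still has a regular sequence shorter by one.
\<close>

lemma regular_on_from_R:
  assumes "ideal N A" "set ys \<subseteq> max_ideal A" "regular_on A (carrier A) N ys"
  shows "\<exists>xs. length xs = length ys \<and> set xs \<subseteq> R.\<mm> \<and> regular_on A (carrier A) N (map \<phi> xs)"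
  using assms
proof (induction "length ys" arbitrary: ys N)
  case 0
  then show ?case by (intro exI[of _ "[]"]) auto
next
  case (Suc n)
  note N = \<open>ideal N A\<close>
  obtain y ys' where ys: "ys = y # ys'" using Suc.hyps(2) by (cases ys) auto
  have y: "y \<in> max_ideal A" "nonzerodivisor_on A (carrier A) N y" using Suc.prems ys by auto
  let ?F = "contraction ` {P. max_annihilator A (carrier A) N P}"
  have prime: "primeideal P A" if "max_annihilator A (carrier A) N P" for P
    using A.max_annihilator_prime[OF A.oneideal N that] .
  have "\<exists>x\<in>R.\<mm>. \<forall>P\<in>?F. x \<notin> P"
  proof (rule R.prime_avoidance[OF R.max_ideal_ideal])
    show "finite ?F" using A.finite_max_annihilators[OF N A.oneideal] by simp
    show "primeideal P R" if "P \<in> ?F" for P using that prime contraction_prime by auto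
    show "\<not> R.\<mm> \<subseteq> P" if PF: "P \<in> ?F" for P
    proof
      assume sub: "R.\<mm> \<subseteq> P"
      obtain P' where P': "max_annihilator A (carrier A) N P'" "P = contraction P'" using PF by auto
      interpret P': primeideal P' A using prime P' by simp
      \<comment> \<open>As \<open>y\<close> is integral over the maximal ideal, a prime containing the latter contains \<open>y\<close>.\<close>
      have "y \<in> pairs R.\<mm> (R.\<mm> \<inter> I)" using y(1) I_max by (simp add: max_ideal_A Int_absorb1)
      then obtain p q where pq: "p \<in> R.\<mm>" "q \<in> R.\<mm>" "y \<otimes>\<^bsub>A\<^esub> y = \<phi> p \<otimes>\<^bsub>A\<^esub> y \<ominus>\<^bsub>A\<^esub> \<phi> q"
        using integral_over[OF R.max_ideal_ideal] by blast
      have yc: "y \<in> carrier A" using y(1) A.max_ideal_carrier by simp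
      have "\<phi> p \<in> P'" "\<phi> q \<in> P'" using pq sub P'(2) by (auto simp: contraction_def)
      then have "y \<otimes>\<^bsub>A\<^esub> y \<in> P'"
        unfolding pq(3) using yc by (intro ideal_sub_closed[OF P'.is_ideal] P'.I_r_closed)
      then have "y \<in> P'" using P'.I_prime yc by blast
      then show False
        using A.nonzerodivisor_iff_max_annihilators[OF N A.oneideal yc] y(2) P'(1) by blast
    qed
  qed
  then obtain x where x: "x \<in> R.\<mm>" "\<forall>P. max_annihilator A (carrier A) N P \<longrightarrow> \<phi> x \<notin> P"
    using R.max_ideal_carrier by (auto simp: contraction_def)
  have xA: "\<phi> x \<in> max_ideal A" using \<phi>_max_ideal[OF x(1)] .
  have xc: "\<phi> x \<in> carrier A" using A.max_ideal_carrier[OF xA] .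
  have reg: "nonzerodivisor_on A (carrier A) N (\<phi> x)"
    using A.nonzerodivisor_iff_max_annihilators[OF N A.oneideal xc] x(2) by simp
  obtain zs where zs: "length zs = n" "set zs \<subseteq> max_ideal A"
    "regular_on A (carrier A) (add_multiples A (carrier A) N (\<phi> x)) zs"
    using A.regular_on_quotient[OF A.oneideal N xA reg Suc.prems(3,2)] Suc.hyps(2) by metis
  obtain xs where "length xs = n" "set xs \<subseteq> R.\<mm>"
    "regular_on A (carrier A) (add_multiples A (carrier A) N (\<phi> x)) (map \<phi> xs)"
    using Suc.hyps(1)[OF zs(1)[symmetric] A.add_multiples_ideal[OF A.oneideal N xc] zs(2,3)] zs(1) by auto
  then show ?case using x reg Suc.hyps(2) by (intro exI[of _ "x # xs"]) auto
qed

subsection \<open>The dimension of \<open>A\<close>\<close>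

text \<open>
  Incomparability. If \<open>P\<close> and \<open>Q\<close> contracted to the same prime, the quadratic equation of some \<open>y\<close> in \<open>Q - P\<close> would
  put first its constant term and then \<open>p - y\<close> into \<open>P\<close>, so \<open>p\<close> into \<open>Q\<close>, hence into \<open>P\<close>, and finally \<open>y\<close> into \<open>P\<close>.
\<close>

lemma contraction_strict:
  assumes P: "primeideal P A" and Q: "primeideal Q A" and PQ: "P \<subset> Q"
  shows "contraction P \<subset> contraction Q"
proof -
  interpret P: primeideal P A by fact
  interpret Q: primeideal Q A by fact
  have sub: "contraction P \<subseteq> contraction Q" using PQ by (auto simp: contraction_def)
  have "contraction P \<noteq> contraction Q"
  proof
    assume eq: "contraction P = contraction Q"
    obtain y where y: "y \<in> Q" "y \<notin> P" using PQ by auto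
    have yc: "y \<in> carrier A" using Q.Icarr y by simp
    then have "y \<in> pairs (carrier R) (carrier R \<inter> I)"
      using pairs_carrier I_carrier by (simp add: Int_absorb1 subsetI)
    then obtain p q where pq: "p \<in> carrier R" "q \<in> carrier R" "y \<otimes>\<^bsub>A\<^esub> y = \<phi> p \<otimes>\<^bsub>A\<^esub> y \<ominus>\<^bsub>A\<^esub> \<phi> q"
      using integral_over[OF R.oneideal] by blast
    have c: "\<phi> p \<in> carrier A" "\<phi> q \<in> carrier A" using pq by auto
    have "\<phi> q = \<phi> p \<otimes>\<^bsub>A\<^esub> y \<ominus>\<^bsub>A\<^esub> (\<phi> p \<otimes>\<^bsub>A\<^esub> y \<ominus>\<^bsub>A\<^esub> \<phi> q)" using c yc by algebra
    also have "\<dots> \<in> Q" unfolding pq(3)[symmetric]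
      using y c yc by (intro ideal_sub_closed[OF Q.is_ideal] Q.I_l_closed)
    finally have "\<phi> q \<in> P" using eq pq(2) by (auto simp: contraction_def)
    moreover have "y \<otimes>\<^bsub>A\<^esub> (\<phi> p \<ominus>\<^bsub>A\<^esub> y) = \<phi> p \<otimes>\<^bsub>A\<^esub> y \<ominus>\<^bsub>A\<^esub> y \<otimes>\<^bsub>A\<^esub> y" using c yc by algebra
    then have "y \<otimes>\<^bsub>A\<^esub> (\<phi> p \<ominus>\<^bsub>A\<^esub> y) = \<phi> q" unfolding pq(3) using c yc by algebra
    ultimately have "\<phi> p \<ominus>\<^bsub>A\<^esub> y \<in> P" using P.I_prime[of y "\<phi> p \<ominus>\<^bsub>A\<^esub> y"] y yc c by auto
    then have "(\<phi> p \<ominus>\<^bsub>A\<^esub> y) \<oplus>\<^bsub>A\<^esub> y \<in> Q" using PQ y by (intro ideal_add_closed[OF Q.is_ideal]) auto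
    moreover have "(\<phi> p \<ominus>\<^bsub>A\<^esub> y) \<oplus>\<^bsub>A\<^esub> y = \<phi> p" using c yc by algebra
    ultimately have "\<phi> p \<in> P" using eq pq(1) by (auto simp: contraction_def)
    then have "\<phi> p \<ominus>\<^bsub>A\<^esub> (\<phi> p \<ominus>\<^bsub>A\<^esub> y) \<in> P"
      using \<open>\<phi> p \<ominus>\<^bsub>A\<^esub> y \<in> P\<close> by (rule ideal_sub_closed[OF P.is_ideal])
    moreover have "\<phi> p \<ominus>\<^bsub>A\<^esub> (\<phi> p \<ominus>\<^bsub>A\<^esub> y) = y" using c yc by algebra
    ultimately show False using y by simp
  qed
  then show ?thesis using sub by auto
qed

text \<open>
  Going up is contained in this form, since \<open>J\<close> can be a prime whose contraction lies in \<open>p\<close>. The prime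
  \<open>P\<close> is found disjoint from the image of the complement of \<open>p\<close>, once \<open>J + p A\<close> is known to be disjoint from it;
  that follows from integrality.
\<close>

lemma lying_over:
  assumes J: "ideal J A" and p: "primeideal p R" and sub: "contraction J \<subseteq> p"
  obtains P where "primeideal P A" "J \<subseteq> P" "contraction P = p"
proof -
  interpret p: primeideal p R by fact
  let ?E = "pairs p (p \<inter> I)"
  have E: "ideal ?E A" using pairs_ideal[OF p.is_ideal] .
  let ?K = "J <+>\<^bsub>A\<^esub> ?E" and ?T = "\<phi> ` (carrier R - p)"
  have K: "ideal ?K A" using A.add_ideals[OF J E] .
  have one: "\<one> \<notin> p" using p.I_notcarr p.one_imp_carrier by auto
  have disj: "?K \<inter> ?T = {}"
  proof (rule ccontr)
    assume "?K \<inter> ?T \<noteq> {}"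
    then obtain r where r: "r \<in> carrier R" "r \<notin> p" "\<phi> r \<in> ?K" by auto
    obtain x y where x: "x \<in> J" and y: "y \<in> ?E" and req: "\<phi> r = x \<oplus>\<^bsub>A\<^esub> y"
      using r(3) unfolding set_add_def' by auto
    obtain s q where sq: "s \<in> p" "q \<in> p" "y \<otimes>\<^bsub>A\<^esub> y = \<phi> s \<otimes>\<^bsub>A\<^esub> y \<ominus>\<^bsub>A\<^esub> \<phi> q"
      using integral_over[OF p.is_ideal y] by blast
    have sqc: "s \<in> carrier R" "q \<in> carrier R" using sq p.Icarr by auto
    have c: "x \<in> carrier A" "y \<in> carrier A" "\<phi> s \<in> carrier A" "\<phi> q \<in> carrier A" "\<phi> r \<in> carrier A"
      using ideal.Icarr[OF J x] ideal.Icarr[OF E y] sqc r by auto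
    \<comment> \<open>Modulo \<open>J\<close>, \<open>r\<close> satisfies the quadratic equation of \<open>y\<close>.\<close>
    have "\<phi> (r \<otimes> r \<ominus> s \<otimes> r \<oplus> q) = \<phi> r \<otimes>\<^bsub>A\<^esub> \<phi> r \<ominus>\<^bsub>A\<^esub> \<phi> s \<otimes>\<^bsub>A\<^esub> \<phi> r \<oplus>\<^bsub>A\<^esub> \<phi> q"
      using r sqc by (simp add: a_minus_def)
    also have "\<dots> = (x \<oplus>\<^bsub>A\<^esub> y \<oplus>\<^bsub>A\<^esub> y \<ominus>\<^bsub>A\<^esub> \<phi> s) \<otimes>\<^bsub>A\<^esub> x \<oplus>\<^bsub>A\<^esub> (y \<otimes>\<^bsub>A\<^esub> y \<ominus>\<^bsub>A\<^esub> \<phi> s \<otimes>\<^bsub>A\<^esub> y \<oplus>\<^bsub>A\<^esub> \<phi> q)"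
      unfolding req using c by algebra
    also have "y \<otimes>\<^bsub>A\<^esub> y \<ominus>\<^bsub>A\<^esub> \<phi> s \<otimes>\<^bsub>A\<^esub> y \<oplus>\<^bsub>A\<^esub> \<phi> q = \<zero>\<^bsub>A\<^esub>"
      unfolding sq(3) using c by algebra
    also have "(x \<oplus>\<^bsub>A\<^esub> y \<oplus>\<^bsub>A\<^esub> y \<ominus>\<^bsub>A\<^esub> \<phi> s) \<otimes>\<^bsub>A\<^esub> x \<oplus>\<^bsub>A\<^esub> \<zero>\<^bsub>A\<^esub> \<in> J"
      using ideal.I_l_closed[OF J x, of "x \<oplus>\<^bsub>A\<^esub> y \<oplus>\<^bsub>A\<^esub> y \<ominus>\<^bsub>A\<^esub> \<phi> s"] c by simp
    finally have rr: "r \<otimes> r \<ominus> s \<otimes> r \<oplus> q \<in> p" using sub r sqc by (auto simp: contraction_def)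
    have "s \<otimes> r \<ominus> q \<in> p" using sq r p.I_r_closed by (intro ideal_sub_closed[OF p.is_ideal]) auto
    then have "(r \<otimes> r \<ominus> s \<otimes> r \<oplus> q) \<oplus> (s \<otimes> r \<ominus> q) \<in> p"
      by (intro ideal_add_closed[OF p.is_ideal rr])
    moreover have "(r \<otimes> r \<ominus> s \<otimes> r \<oplus> q) \<oplus> (s \<otimes> r \<ominus> q) = r \<otimes> r" using r sqc by algebra
    ultimately show False using p.I_prime[of r r] r by auto
  qed
  have "?T \<subseteq> carrier A" "\<one>\<^bsub>A\<^esub> \<in> ?T" using one \<phi>.hom_one R.one_closed by force+
  moreover have mult: "s \<otimes>\<^bsub>A\<^esub> t \<in> ?T" if st: "s \<in> ?T" "t \<in> ?T" for s t
  proof -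
    obtain u v where *: "u \<in> carrier R - p" "v \<in> carrier R - p" "s = \<phi> u" "t = \<phi> v" using st by auto
    then have "s \<otimes>\<^bsub>A\<^esub> t = \<phi> (u \<otimes> v)" "u \<otimes> v \<in> carrier R - p" using p.I_prime[of u v] by auto
    then show ?thesis by auto
  qed
  ultimately obtain P where P: "primeideal P A" "?K \<subseteq> P" "P \<inter> ?T = {}"
    using A.exists_prime_disjoint[OF K _ _ _ disj] by metis
  have "x \<in> ?K" if x: "x \<in> J \<union> ?E" for x
  proof -
    have c: "x \<in> carrier A" using x ideal.Icarr[OF J] ideal.Icarr[OF E] by auto
    have "x = x \<oplus>\<^bsub>A\<^esub> \<zero>\<^bsub>A\<^esub>" "x = \<zero>\<^bsub>A\<^esub> \<oplus>\<^bsub>A\<^esub> x" using c by simp_all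
    then show ?thesis using x ideal_zero_closed[OF J] ideal_zero_closed[OF E] unfolding set_add_def' by blast
  qed
  then have "J \<subseteq> P" "?E \<subseteq> P" using P(2) by auto
  moreover have "contraction P = p"
  proof (rule antisym)
    show "contraction P \<subseteq> p" using P(3) by (auto simp: contraction_def)
    show "p \<subseteq> contraction P"
    proof
      fix r assume r: "r \<in> p"
      then have "pair r \<zero> \<in> ?E" using ideal_zero_closed[OF p.is_ideal] by (intro pairsI) auto
      then show "r \<in> contraction P"
        using r p.Icarr[OF r] \<open>?E \<subseteq> P\<close> by (auto simp: contraction_def pair_zero)
    qed
  qed
  ultimately show thesis using that P(1) by blast
qed

lemma krull_dim_A: "krull_dim A = krull_dim R"
proof (rule antisym; rule enat_le_if_initial)
  fix n assume "enat n \<le> krull_dim A"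
  then obtain P where P: "prime_chain A P n" using enat_le_krull_dim_iff[OF A.max_ideal_prime] by blast
  then have "prime_chain R (\<lambda>i. contraction (P i)) n"
    using contraction_prime contraction_strict by (simp add: prime_chain_def)
  then show "enat n \<le> krull_dim R" using enat_le_krull_dim_iff[OF R.max_ideal_prime] by blast
next
  have chain: "\<exists>P. prime_chain A P n \<and> contraction (P n) = p n" if "prime_chain R p n" for p n
    using that
  proof (induction n)
    case 0
    have "contraction {\<zero>\<^bsub>A\<^esub>} \<subseteq> p 0"
    proof
      fix r assume "r \<in> contraction {\<zero>\<^bsub>A\<^esub>}"
      then have "r \<in> carrier R" "pair r \<zero> = pair \<zero> \<zero>" by (auto simp: contraction_def pair_zero)
      then have "r = \<zero>" using pair_eq_iff[of r \<zero> \<zero> \<zero>] by simp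
      then show "r \<in> p 0" using 0 ideal_zero_closed[OF primeideal.axioms(1)] by (auto simp: prime_chain_def)
    qed
    then obtain P where "primeideal P A" "contraction P = p 0"
      using lying_over[OF A.zeroideal, of "p 0"] 0 by (metis le_refl prime_chain_def)
    then show ?case by (intro exI[of _ "\<lambda>_. P"]) (simp add: prime_chain_def)
  next
    case (Suc n)
    then obtain P where P: "prime_chain A P n" "contraction (P n) = p n"
      using prime_chain_mono[of R p "Suc n" n] by auto
    have p: "primeideal (p (Suc n)) R" "p n \<subset> p (Suc n)" using Suc.prems by (auto simp: prime_chain_def)
    have "ideal (P n) A" using P by (auto simp: prime_chain_def intro: primeideal.axioms(1))
    then obtain Q where Q: "primeideal Q A" "P n \<subseteq> Q" "contraction Q = p (Suc n)"
      using lying_over[of "P n" "p (Suc n)"] p P(2) by auto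
    have "P n \<noteq> Q" using P(2) Q(3) p(2) by auto
    then have "prime_chain A (P(Suc n := Q)) (Suc n)"
      using P(1) Q by (auto simp: prime_chain_def le_Suc_eq less_Suc_eq)
    moreover have "contraction ((P(Suc n := Q)) (Suc n)) = p (Suc n)" using Q(3) by simp
    ultimately show ?case by blast
  qed
  fix n assume "enat n \<le> krull_dim R"
  then obtain p where "prime_chain R p n" using enat_le_krull_dim_iff[OF R.max_ideal_prime] by blast
  then show "enat n \<le> krull_dim A" using chain enat_le_krull_dim_iff[OF A.max_ideal_prime] by blast
qed

end

section \<open>The equivalences\<close>

lemma (in noetherian_local_ring) depth_le_krull_dim:
  assumes L: "ideal L R" and N: "ideal N R" and "set ys \<subseteq> \<mm>" "regular_on R L N ys"
  shows "enat (length ys) \<le> krull_dim R"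
proof -
  have "set ys \<subseteq> carrier R" using assms max_ideal_carrier by auto
  then obtain u where u: "u \<in> L" "u \<notin> N" using regular_on_imp_nonzero[OF L N] assms by blast
  obtain P where P: "max_annihilator R L N P" using annihilator_below_max[OF N L u] .
  then obtain v where v: "v \<in> L" "v \<notin> N" "P = colon R N v" unfolding max_annihilator_def by blast
  have "primeideal P R" using max_annihilator_prime[OF L N P] .
  then show ?thesis
    using prime_chain_from_associated_prime[OF L N assms(3,4) v(1,2)] v(3)
      enat_le_krull_dim_iff[OF max_ideal_prime] by blast
qed

lemma (in ideal_as_module) finitely_generatedI:
  assumes "finite G" "G \<subseteq> L" and "\<And>H. submodule H R M \<Longrightarrow> G \<subseteq> H \<Longrightarrow> L \<subseteq> H"
  shows "finitely_generated_module R M"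
proof -
  have "submodule L R M" using submoduleI[OF L] by simp
  then have "L = submodule_span R M G"
    using assms unfolding submodule_span_def by (intro antisym Inter_greatest Inter_lower) auto
  then show ?thesis using assms module_M unfolding finitely_generated_module_def by auto
qed

context ideal_extension
begin

lemma R_mod: "ideal_as_module R R (\<lambda>r. r) (carrier R)"
  by (intro ideal_as_module.intro ideal_as_module_axioms.intro R.oneideal
      ring_hom_cring.intro ring_hom_cring_axioms.intro R.cring_axioms) (simp add: ring_hom_def)

lemma I_mod: "ideal_as_module R R (\<lambda>r. r) I"
  using R_mod I by (simp add: ideal_as_module_def ideal_as_module_axioms_def)

lemma A_mod: "ideal_as_module R A \<phi> (carrier A)"
  by (intro ideal_as_module.intro ideal_as_module_axioms.intro A.oneideal \<phi>.ring_hom_cring_axioms)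

lemma A_self: "ideal_as_module A A (\<lambda>r. r) (carrier A)"
  by (intro ideal_as_module.intro ideal_as_module_axioms.intro A.oneideal
      ring_hom_cring.intro ring_hom_cring_axioms.intro A.cring_axioms) (simp add: ring_hom_def)

lemma module_carrier_trivial:
  "(self_module R)\<lparr>carrier := carrier R\<rparr> = self_module R"
  "(restrict_scalars A \<phi>)\<lparr>carrier := carrier A\<rparr> = restrict_scalars A \<phi>"
  "(self_module A)\<lparr>carrier := carrier A\<rparr> = self_module A"
  by (simp_all add: restrict_scalars_def)

lemmas modules =
  ideal_as_module.M_def[OF R_mod, unfolded module_carrier_trivial]
  ideal_as_module.M_def[OF I_mod]
  ideal_as_module.M_def[OF A_mod, unfolded module_carrier_trivial]
  ideal_as_module.M_def[OF A_self, unfolded module_carrier_trivial]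

lemma carriers_nonzero: "carrier R \<noteq> {\<zero>}" "carrier A \<noteq> {\<zero>\<^bsub>A\<^esub>}"
  using not_zero by auto

lemma enat_le_depth_R:
  "enat n \<le> depth R (self_module R) \<longleftrightarrow>
    (\<exists>xs. length xs = n \<and> set xs \<subseteq> R.\<mm> \<and> regular_on R (carrier R) {\<zero>} xs)"
  using ideal_as_module.enat_le_depth_iff[OF R_mod R.noetherian_local_ring_axioms carriers_nonzero(1)]
  by (simp add: modules)

lemma enat_le_depth_I:
  "enat n \<le> depth R (ideal_module R I) \<longleftrightarrow>
    (\<exists>xs. length xs = n \<and> set xs \<subseteq> R.\<mm> \<and> regular_on R I {\<zero>} xs)"
  using ideal_as_module.enat_le_depth_iff[OF I_mod R.noetherian_local_ring_axioms I_nonzero]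
  by (simp add: modules)

lemma enat_le_depth_A_over_R:
  "enat n \<le> depth R (restrict_scalars A \<phi>) \<longleftrightarrow>
    (\<exists>xs. length xs = n \<and> set xs \<subseteq> R.\<mm> \<and> regular_on A (carrier A) {\<zero>\<^bsub>A\<^esub>} (map \<phi> xs))"
  using ideal_as_module.enat_le_depth_iff[OF A_mod R.noetherian_local_ring_axioms carriers_nonzero(2)]
  by (simp add: modules)

lemma enat_le_depth_A:
  "enat n \<le> depth A (self_module A) \<longleftrightarrow>
    (\<exists>ys. length ys = n \<and> set ys \<subseteq> max_ideal A \<and> regular_on A (carrier A) {\<zero>\<^bsub>A\<^esub>} ys)"
  using ideal_as_module.enat_le_depth_iff[OF A_self A.noetherian_local_ring_axioms carriers_nonzero(2)]
  by (simp add: modules)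

lemma depth_R_le: "depth R (self_module R) \<le> krull_dim R"
proof (rule enat_le_if_initial)
  fix n assume "enat n \<le> depth R (self_module R)"
  then obtain xs where xs: "length xs = n" "set xs \<subseteq> R.\<mm>" "regular_on R (carrier R) {\<zero>} xs"
    unfolding enat_le_depth_R by blast
  then show "enat n \<le> krull_dim R" using R.depth_le_krull_dim[OF R.oneideal R.zeroideal xs(2,3)] by simp
qed

lemma depth_I_le: "depth R (ideal_module R I) \<le> krull_dim R"
proof (rule enat_le_if_initial)
  fix n assume "enat n \<le> depth R (ideal_module R I)"
  then obtain xs where xs: "length xs = n" "set xs \<subseteq> R.\<mm>" "regular_on R I {\<zero>} xs"
    unfolding enat_le_depth_I by blast
  then show "enat n \<le> krull_dim R" using R.depth_le_krull_dim[OF I R.zeroideal xs(2,3)] by simp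
qed

lemma depth_A_over_R_le:
  "depth R (restrict_scalars A \<phi>) \<le> depth R (self_module R)" (is "?A \<le> ?R")
  "depth R (restrict_scalars A \<phi>) \<le> depth R (ideal_module R I)" (is "_ \<le> ?I")
proof -
  have "enat n \<le> ?R \<and> enat n \<le> ?I" if "enat n \<le> ?A" for n
    using that regular_on_A_iff
    unfolding enat_le_depth_R enat_le_depth_I enat_le_depth_A_over_R by blast
  then show "?A \<le> ?R" "?A \<le> ?I" by (simp_all add: enat_le_if_initial)
qed

lemma depth_A: "depth A (self_module A) = depth R (restrict_scalars A \<phi>)"
proof (rule antisym; rule enat_le_if_initial)
  fix n assume "enat n \<le> depth A (self_module A)"
  then obtain ys where ys: "length ys = n" "set ys \<subseteq> max_ideal A"
    "regular_on A (carrier A) {\<zero>\<^bsub>A\<^esub>} ys"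
    unfolding enat_le_depth_A by blast
  show "enat n \<le> depth R (restrict_scalars A \<phi>)"
    using regular_on_from_R[OF A.zeroideal ys(2,3)] ys(1) unfolding enat_le_depth_A_over_R by simp
next
  fix n assume "enat n \<le> depth R (restrict_scalars A \<phi>)"
  then obtain xs where xs: "length xs = n" "set xs \<subseteq> R.\<mm>" "regular_on A (carrier A) {\<zero>\<^bsub>A\<^esub>} (map \<phi> xs)"
    unfolding enat_le_depth_A_over_R by blast
  then have "set (map \<phi> xs) \<subseteq> max_ideal A" using \<phi>_max_ideal by auto
  then show "enat n \<le> depth A (self_module A)"
    unfolding enat_le_depth_A using xs by (intro exI[of _ "map \<phi> xs"]) auto
qed

text \<open>
  A sequence that generates a proper ideal automatically lies in the maximal ideal.
\<close>

lemma regular_sequence_R_iff: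
  "regular_sequence R (self_module R) xs \<longleftrightarrow> set xs \<subseteq> R.\<mm> \<and> regular_on R (carrier R) {\<zero>} xs"
proof
  assume "regular_sequence R (self_module R) xs"
  then have xs: "set xs \<subseteq> carrier R" "regular_on R (carrier R) {\<zero>} xs"
    using ideal_as_module.regular_sequence_iff[OF R_mod, unfolded modules] by auto
  let ?F = "foldl (add_multiples R (carrier R)) {\<zero>} xs"
  have F: "ideal ?F R" "\<And>x. x \<in> set xs \<Longrightarrow> x \<otimes> \<one> \<in> ?F"
    using ideal_as_module.foldl_ideal[OF R_mod R.zeroideal xs(1)] by auto
  have "?F \<noteq> carrier R" using xs(2) unfolding regular_on_iff_nth by auto
  then have "?F \<subseteq> R.\<mm>" using R.proper_ideal_subset_max_ideal[OF F(1)] by simp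
  moreover have "x \<in> ?F" if "x \<in> set xs" for x using F(2)[OF that] that xs(1) by (simp add: subset_iff)
  ultimately show "set xs \<subseteq> R.\<mm> \<and> regular_on R (carrier R) {\<zero>} xs" using xs by blast
next
  assume "set xs \<subseteq> R.\<mm> \<and> regular_on R (carrier R) {\<zero>} xs"
  then show "regular_sequence R (self_module R) xs"
    using ideal_as_module.regular_sequence_iff[OF R_mod, unfolded modules] R.max_ideal_carrier by auto
qed

lemma regular_sequence_A_iff:
  assumes "set xs \<subseteq> R.\<mm>"
  shows "regular_sequence R (restrict_scalars A \<phi>) xs \<longleftrightarrow>
    regular_on R (carrier R) {\<zero>} xs \<and> regular_on R I {\<zero>} xs"
  using ideal_as_module.regular_sequence_iff[OF A_mod, unfolded modules] regular_on_A_iff[OF assms] assms R.max_ideal_carrier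
  by blast

lemma module_dim_A: "module_dim R (restrict_scalars A \<phi>) = krull_dim R"
proof -
  have "annihilator R (restrict_scalars A \<phi>) = {\<zero>}"
  proof
    show "annihilator R (restrict_scalars A \<phi>) \<subseteq> {\<zero>}"
    proof
      fix r assume "r \<in> annihilator R (restrict_scalars A \<phi>)"
      then have r: "r \<in> carrier R" "\<forall>x\<in>carrier A. \<phi> r \<otimes>\<^bsub>A\<^esub> x = \<zero>\<^bsub>A\<^esub>"
        by (simp_all add: annihilator_def restrict_scalars_def)
      then have "\<phi> r \<otimes>\<^bsub>A\<^esub> \<one>\<^bsub>A\<^esub> = \<zero>\<^bsub>A\<^esub>" using A.one_closed by blast
      then have "\<phi> r \<oplus>\<^bsub>A\<^esub> \<tau> \<zero> = \<zero>\<^bsub>A\<^esub>" using r(1) by (simp add: \<tau>_zero)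
      then show "r \<in> {\<zero>}" using independent[OF r(1) I_closed(3)] by simp
    qed
    show "{\<zero>} \<subseteq> annihilator R (restrict_scalars A \<phi>)"
      by (simp add: annihilator_def restrict_scalars_def)
  qed
  then show ?thesis
    unfolding module_dim_def using krull_dim_quotient_zero[OF R.cring_axioms R.max_ideal_prime] by simp
qed

lemma finitely_generated_I: "finitely_generated_module R (ideal_module R I)"
proof -
  obtain G where G: "G \<subseteq> carrier R" "finite G" "I = genideal R G" using R.finetely_gen[OF I] by blast
  note I_facts = ideal_as_module.M_simps[OF I_mod, unfolded modules]
  show ?thesis
  proof (rule ideal_as_module.finitely_generatedI[OF I_mod, unfolded modules, OF G(2)])
    show "G \<subseteq> I" using R.genideal_self[OF G(1)] G(3) by simp
    fix H assume H: "submodule H R (ideal_module R I)" "G \<subseteq> H"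
    note sub = module.submoduleE[OF ideal_as_module.module_M[OF I_mod, unfolded modules] H(1), unfolded I_facts]
    have "ideal H R"
    proof (rule R.ideal_criterion)
      show "H \<subseteq> carrier R" using sub(1) by auto
      show "\<zero> \<in> H" using subgroup.one_closed[OF submodule.axioms(1)[OF H(1)]] by (simp add: I_facts)
      show "x \<oplus> y \<in> H" if "x \<in> H" "y \<in> H" for x y using sub(5)[OF that] by simp
      show "r \<otimes> x \<in> H" if "r \<in> carrier R" "x \<in> H" for r x using sub(4)[OF that] by simp
    qed
    then show "I \<subseteq> H" unfolding G(3) using H(2) by (rule R.genideal_minimal)
  qed
qed

lemma finitely_generated_A: "finitely_generated_module R (restrict_scalars A \<phi>)"
proof -
  obtain G where G: "G \<subseteq> carrier R" "finite G" "I = genideal R G" using R.finetely_gen[OF I] by blast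
  have GI: "G \<subseteq> I" using R.genideal_self[OF G(1)] G(3) by simp
  note A_facts = ideal_as_module.M_simps[OF A_mod, unfolded modules]
  show ?thesis
  proof (rule ideal_as_module.finitely_generatedI[OF A_mod, unfolded modules])
    show "finite (insert \<one>\<^bsub>A\<^esub> (\<tau> ` G))" using G by simp
    show "insert \<one>\<^bsub>A\<^esub> (\<tau> ` G) \<subseteq> carrier A" using GI by auto
    fix H assume H: "submodule H R (restrict_scalars A \<phi>)" "insert \<one>\<^bsub>A\<^esub> (\<tau> ` G) \<subseteq> H"
    note sub = module.submoduleE[OF ideal_as_module.module_M[OF A_mod, unfolded modules] H(1), unfolded A_facts]
    have zero: "\<zero>\<^bsub>A\<^esub> \<in> H" using subgroup.one_closed[OF submodule.axioms(1)[OF H(1)]] by (simp add: A_facts)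
    have "ideal {i \<in> I. \<tau> i \<in> H} R"
    proof (rule R.ideal_criterion)
      show "{i \<in> I. \<tau> i \<in> H} \<subseteq> carrier R" by auto
      show "\<zero> \<in> {i \<in> I. \<tau> i \<in> H}" using zero by (simp add: \<tau>_zero)
      show "x \<oplus> y \<in> {i \<in> I. \<tau> i \<in> H}" if "x \<in> {i \<in> I. \<tau> i \<in> H}" "y \<in> {i \<in> I. \<tau> i \<in> H}" for x y
        using that sub(5)[of "\<tau> x" "\<tau> y"] by (simp add: \<tau>_add)
      show "r \<otimes> x \<in> {i \<in> I. \<tau> i \<in> H}" if "r \<in> carrier R" "x \<in> {i \<in> I. \<tau> i \<in> H}" for r x
        using that sub(4)[of r "\<tau> x"] by (simp add: \<tau>_smult)
    qed
    moreover have "G \<subseteq> {i \<in> I. \<tau> i \<in> H}" using GI H(2) by auto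
    ultimately have "genideal R G \<subseteq> {i \<in> I. \<tau> i \<in> H}" by (rule R.genideal_minimal)
    then have \<tau>H: "\<tau> i \<in> H" if "i \<in> I" for i using that G(3) by auto
    have \<phi>H: "\<phi> r \<in> H" if "r \<in> carrier R" for r using sub(4)[OF that, of "\<one>\<^bsub>A\<^esub>"] H(2) that by simp
    show "carrier A \<subseteq> H"
    proof
      fix x assume "x \<in> carrier A"
      then obtain r i where "r \<in> carrier R" "i \<in> I" "x = pair r i" by (rule pairE)
      then show "x \<in> H" using sub(5)[OF \<phi>H \<tau>H] by (simp add: pair_def)
    qed
  qed
qed

lemma cohen_macaulay_R_iff: "cohen_macaulay_local_ring R \<longleftrightarrow> depth R (self_module R) = krull_dim R"
  unfolding cohen_macaulay_local_ring_def using R.noetherian_local_ring_axioms by simp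

lemma cohen_macaulay_A_iff: "cohen_macaulay_local_ring A \<longleftrightarrow> depth A (self_module A) = krull_dim A"
  unfolding cohen_macaulay_local_ring_def using A.noetherian_local_ring_axioms by simp

lemma maximal_cohen_macaulay_I_iff:
  "maximal_cohen_macaulay_module R (ideal_module R I) \<longleftrightarrow> depth R (ideal_module R I) = krull_dim R"
  unfolding maximal_cohen_macaulay_module_def
  using R.noetherian_local_ring_axioms finitely_generated_I by simp

lemma cohen_macaulay_A_over_R_iff:
  "cohen_macaulay_module R (restrict_scalars A \<phi>) \<longleftrightarrow> depth R (restrict_scalars A \<phi>) = krull_dim R"
proof -
  have "carrier (restrict_scalars A \<phi>) \<noteq> {\<zero>\<^bsub>restrict_scalars A \<phi>\<^esub>}"
    using carriers_nonzero(2) by (simp add: restrict_scalars_def)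
  then show ?thesis
    unfolding cohen_macaulay_module_def module_dim_A
    using R.noetherian_local_ring_axioms finitely_generated_A by simp
qed

lemma maximal_cohen_macaulay_imp_regular:
  assumes depth: "depth R (ideal_module R I) = krull_dim R"
    and xs: "set xs \<subseteq> R.\<mm>" "regular_on R (carrier R) {\<zero>} xs"
  shows "regular_on R I {\<zero>} xs"
proof -
  \<comment> \<open>Regular sequences have bounded length, so the dimension is finite.\<close>
  obtain n where "\<not> enat n \<le> krull_dim R"
    using R.regular_sequence_length_bounded[OF I R.zeroideal] depth enat_le_depth_I by metis
  then obtain d where d: "krull_dim R = enat d" by (cases "krull_dim R") auto
  then obtain ys where ys: "length ys = d" "set ys \<subseteq> R.\<mm>" "regular_on R I {\<zero>} ys"
    using enat_le_depth_I[of d] depth by auto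
  show ?thesis
  proof (rule R.regular_on_transfer[OF I R.zeroideal R.zeroideal xs _ _ ys(2,3)])
    show "r \<otimes> u \<in> {\<zero>}" if "r \<in> {\<zero>}" "u \<in> I" for r u using that by simp
    show "n \<le> length ys" if "prime_chain R Q n" for Q n
      using that enat_le_krull_dim_iff[OF R.max_ideal_prime, of n] d ys(1) by auto
  qed
qed

theorem cohen_macaulay_equivalences:
  "(cohen_macaulay_local_ring R \<and> maximal_cohen_macaulay_module R (ideal_module R I)
      \<longleftrightarrow> cohen_macaulay_module R (restrict_scalars A \<phi>))
   \<and> (cohen_macaulay_module R (restrict_scalars A \<phi>) \<longleftrightarrow> cohen_macaulay_local_ring A)
   \<and> (cohen_macaulay_local_ring A \<longleftrightarrow> cohen_macaulay_local_ring R \<and>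
        (\<forall>xs. regular_sequence R (self_module R) xs \<longrightarrow>
          regular_sequence R (restrict_scalars A \<phi>) xs))"
proof -
  let ?dR = "depth R (self_module R)" and ?dI = "depth R (ideal_module R I)"
    and ?dA = "depth R (restrict_scalars A \<phi>)" and ?d = "krull_dim R"
  let ?C4 = "\<forall>xs. regular_sequence R (self_module R) xs \<longrightarrow>
          regular_sequence R (restrict_scalars A \<phi>) xs"
  have 21: "?dR = ?d \<and> ?dI = ?d" if "?dA = ?d"
    using that depth_A_over_R_le depth_R_le depth_I_le by (auto intro: antisym)
  have 14: "?C4" if "?dI = ?d"
    using maximal_cohen_macaulay_imp_regular[OF that] regular_sequence_A_iff
    unfolding regular_sequence_R_iff by blast
  have 42: "?dA = ?d" if R: "?dR = ?d" and C4: "?C4"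
  proof (rule antisym)
    show "?dA \<le> ?d" using depth_A_over_R_le(1) depth_R_le by (rule order.trans)
    show "?d \<le> ?dA"
    proof (rule enat_le_if_initial)
      fix n assume "enat n \<le> ?d"
      then obtain xs where xs: "length xs = n" "set xs \<subseteq> R.\<mm>" "regular_on R (carrier R) {\<zero>} xs"
        using R enat_le_depth_R by auto
      then have "regular_on A (carrier A) {\<zero>\<^bsub>A\<^esub>} (map \<phi> xs)"
        using C4 regular_sequence_R_iff regular_sequence_A_iff regular_on_A_iff by blast
      then show "enat n \<le> ?dA" using xs enat_le_depth_A_over_R by auto
    qed
  qed
  show ?thesis
    unfolding cohen_macaulay_R_iff cohen_macaulay_A_iff maximal_cohen_macaulay_I_iff
      cohen_macaulay_A_over_R_iff depth_A krull_dim_A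
    using 21 14 42 by blast
qed

end

section \<open>The rings \<open>R(I)\<^bsub>a,b\<^esub>\<close>\<close>

lemma (in ring) finsum_in_ideal:
  assumes "ideal J R" "finite X" "f \<in> X \<rightarrow> J"
  shows "finsum R f X \<in> J"
  using assms(2,3)
proof (induction X rule: finite_induct)
  case empty
  then show ?case using ideal_zero_closed[OF assms(1)] by simp
next
  case (insert x X)
  have "f \<in> X \<rightarrow> carrier R" "f x \<in> carrier R" using insert.prems ideal.Icarr[OF assms(1)] by auto
  then show ?case using insert ideal_add_closed[OF assms(1)] by (auto simp: Pi_def)
qed

locale rees = cring R for R :: "('a, 'm) ring_scheme" (structure) +
  fixes I :: "'a set" and a b :: 'a
  assumes I: "ideal I R" and a [simp]: "a \<in> carrier R" and b [simp]: "b \<in> carrier R"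
begin

abbreviation P where "P \<equiv> UP R"

interpretation U: UP_cring R P
  by (intro UP_cring.intro cring_axioms)

definition ideal_power :: "nat \<Rightarrow> 'a set" where "ideal_power n = I [^]\<^bsub>ideals_set R\<^esub> n"

lemma ideals_monoid: "comm_monoid (ideals_set R)"
  by (rule ideals_set_is_comm_monoid)

lemma I_in_ideals_set: "I \<in> carrier (ideals_set R)"
  using I by (simp add: ideals_set_def)

lemma ideal_power_ideal: "ideal (ideal_power n) R"
  using monoid.nat_pow_closed[OF comm_monoid.axioms(1)[OF ideals_monoid] I_in_ideals_set, of n]
  by (simp add: ideal_power_def ideals_set_def)

lemma ideal_power_mult:
  assumes "x \<in> ideal_power n" "y \<in> ideal_power m" shows "x \<otimes> y \<in> ideal_power (n + m)"
proof -
  have "ideal_power (n + m) = ideal_prod R (ideal_power n) (ideal_power m)"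
    using monoid.nat_pow_mult[OF comm_monoid.axioms(1)[OF ideals_monoid] I_in_ideals_set, of n m]
    by (simp add: ideal_power_def ideals_set_def)
  then show ?thesis using assms ideal_prod.prod by simp
qed

lemma ideal_power_0: "ideal_power 0 = carrier R"
  by (simp add: ideal_power_def nat_pow_def ideals_set_def)

lemma ideal_power_1: "ideal_power (Suc 0) = I"
  using monoid.nat_pow_eone[OF comm_monoid.axioms(1)[OF ideals_monoid] I_in_ideals_set]
  by (simp add: ideal_power_def)

lemma ideal_power_Suc: "ideal_power (Suc n) \<subseteq> ideal_power n"
proof -
  have "ideal_power (Suc n) = ideal_prod R (ideal_power n) I"
    by (simp add: ideal_power_def nat_pow_def ideals_set_def)
  then show ?thesis using ideal_prod_inter[OF ideal_power_ideal I] by auto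
qed

abbreviation S where "S \<equiv> rees_algebra R I"

lemma S_carrier: "p \<in> carrier S \<longleftrightarrow> p \<in> carrier P \<and> (\<forall>n. coeff P p n \<in> ideal_power n)"
  by (simp add: rees_algebra_def ideal_power_def)

lemma S_ops: "x \<oplus>\<^bsub>S\<^esub> y = x \<oplus>\<^bsub>P\<^esub> y" "x \<otimes>\<^bsub>S\<^esub> y = x \<otimes>\<^bsub>P\<^esub> y" "\<zero>\<^bsub>S\<^esub> = \<zero>\<^bsub>P\<^esub>" "\<one>\<^bsub>S\<^esub> = \<one>\<^bsub>P\<^esub>"
  by (simp_all add: rees_algebra_def)

lemma S_cring: "cring S"
proof -
  note zero = ideal_zero_closed[OF ideal_power_ideal]
  have sub: "carrier S \<subseteq> carrier P" by (auto simp: S_carrier)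
  have "subring (carrier S) P"
  proof (rule ring.subringI[OF U.UP_ring sub])
    show "\<one>\<^bsub>P\<^esub> \<in> carrier S" using zero by (auto simp: S_carrier ideal_power_0)
    show "\<ominus>\<^bsub>P\<^esub> p \<in> carrier S" if "p \<in> carrier S" for p
      using that additive_subgroup.a_inv_closed[OF ideal.axioms(1)[OF ideal_power_ideal]]
      by (simp add: S_carrier)
    show "p \<oplus>\<^bsub>P\<^esub> q \<in> carrier S" if "p \<in> carrier S" "q \<in> carrier S" for p q
      using that ideal_add_closed[OF ideal_power_ideal] by (simp add: S_carrier)
    show "p \<otimes>\<^bsub>P\<^esub> q \<in> carrier S" if pq: "p \<in> carrier S" "q \<in> carrier S" for p q
      unfolding S_carrier
    proof (intro conjI allI)
      show "p \<otimes>\<^bsub>P\<^esub> q \<in> carrier P" using pq by (simp add: S_carrier)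
      fix n
      have "coeff P p i \<otimes> coeff P q (n - i) \<in> ideal_power n" if "i \<le> n" for i
        using ideal_power_mult[of _ i _ "n - i"] pq that by (simp add: S_carrier)
      then show "coeff P (p \<otimes>\<^bsub>P\<^esub> q) n \<in> ideal_power n"
        using pq by (auto simp: S_carrier intro!: finsum_in_ideal[OF ideal_power_ideal])
    qed
  qed
  then have "cring (P\<lparr>carrier := carrier S\<rparr>)"
    using cring.subcringI'[OF U.UP_cring] ring.subcring_iff[OF U.UP_ring sub] by simp
  then show ?thesis by (simp add: rees_algebra_def)
qed

lemma monom_in_S [simp]:
  assumes "c \<in> ideal_power n" shows "monom P c n \<in> carrier S"
proof -
  have "c \<in> carrier R" using ideal.Icarr[OF ideal_power_ideal assms] .
  then show ?thesis using assms ideal_zero_closed[OF ideal_power_ideal] by (simp add: S_carrier)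
qed

abbreviation g where "g \<equiv> quadratic_poly R a b"

lemma g_carrier [simp]: "g \<in> carrier P"
  by (simp add: quadratic_poly_def)

abbreviation K where "K \<equiv> rees_kernel R I a b"

lemma K_ideal: "ideal K S"
proof -
  have "ring_hom_ring S P (\<lambda>x. x)"
    by (rule ring_hom_ringI2[OF cring.axioms(1)[OF S_cring] U.UP_ring])
      (auto simp: ring_hom_def S_carrier S_ops)
  then have "ideal {r \<in> carrier S. r \<in> PIdl\<^bsub>P\<^esub> g} S"
    by (rule ring_hom_ring.ideal_vimage) (rule cring.cgenideal_ideal[OF U.UP_cring g_carrier])
  moreover have "{r \<in> carrier S. r \<in> PIdl\<^bsub>P\<^esub> g} = K" by (auto simp: rees_kernel_def)
  ultimately show ?thesis by simp
qed

abbreviation A where "A \<equiv> rees_quotient R I a b"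

lemma A_cring: "cring A"
  unfolding rees_quotient_def by (rule ideal.quotient_is_cring[OF K_ideal S_cring])

definition proj where "proj p = K +>\<^bsub>S\<^esub> p"

lemma proj_hom: "proj \<in> ring_hom S A"
  using ideal.rcos_ring_hom[OF K_ideal] unfolding rees_quotient_def proj_def[abs_def] .

lemma proj_closed: "p \<in> carrier S \<Longrightarrow> proj p \<in> carrier A"
  using ring_hom_memE(1)[OF proj_hom] .

lemma proj_add_mult:
  assumes "p \<in> carrier S" "q \<in> carrier S"
  shows "proj (p \<oplus>\<^bsub>P\<^esub> q) = proj p \<oplus>\<^bsub>A\<^esub> proj q" "proj (p \<otimes>\<^bsub>P\<^esub> q) = proj p \<otimes>\<^bsub>A\<^esub> proj q"
  using ring_hom_memE[OF proj_hom] assms unfolding S_ops by auto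

lemma proj_surj: "carrier A = proj ` carrier S"
  by (auto simp: rees_quotient_def FactRing_simps proj_def)

lemma proj_zero_iff:
  assumes p: "p \<in> carrier S" shows "proj p = \<zero>\<^bsub>A\<^esub> \<longleftrightarrow> p \<in> K"
proof -
  interpret K: ideal K S by (rule K_ideal)
  have "\<zero>\<^bsub>A\<^esub> = K" by (simp add: rees_quotient_def FactRing_def)
  then show ?thesis
    using K.rcos_const_imp_mem[OF p] K.a_rcos_zero[OF K_ideal, of p] unfolding proj_def by auto
qed

definition const where "const r = proj (monom P r 0)"
definition lin where "lin i = proj (monom P i 1)"

lemma mon0 [simp]: "r \<in> carrier R \<Longrightarrow> monom P r 0 \<in> carrier S"
  by (simp add: ideal_power_0)

lemma mon1 [simp]: "i \<in> I \<Longrightarrow> monom P i (Suc 0) \<in> carrier S"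
  by (simp add: ideal_power_1)

lemma I_carr [simp]: "i \<in> I \<Longrightarrow> i \<in> carrier R"
  using ideal.Icarr[OF I] .

lemma const_hom: "const \<in> ring_hom R A"
proof (rule ring_hom_memI)
  show "const r \<in> carrier A" if "r \<in> carrier R" for r
    using that by (simp add: const_def proj_closed proj_add_mult)
  show "const (r \<otimes> s) = const r \<otimes>\<^bsub>A\<^esub> const s" if "r \<in> carrier R" "s \<in> carrier R" for r s
    using that U.monom_mult[of r s 0 0] by (simp add: const_def proj_closed proj_add_mult)
  show "const (r \<oplus> s) = const r \<oplus>\<^bsub>A\<^esub> const s" if "r \<in> carrier R" "s \<in> carrier R" for r s
    using that by (simp add: const_def proj_closed proj_add_mult)
  show "const \<one> = \<one>\<^bsub>A\<^esub>" using ring_hom_memE(4)[OF proj_hom] by (simp add: const_def S_ops)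
qed

lemma g_mult_monom:
  assumes c: "c \<in> carrier R"
  shows "monom P c k \<otimes>\<^bsub>P\<^esub> g =
    monom P c (k + 2) \<oplus>\<^bsub>P\<^esub> (monom P (c \<otimes> a) (k + 1) \<oplus>\<^bsub>P\<^esub> monom P (c \<otimes> b) k)"
proof -
  have "monom P c k \<otimes>\<^bsub>P\<^esub> g = monom P c k \<otimes>\<^bsub>P\<^esub> monom P \<one> 2 \<oplus>\<^bsub>P\<^esub>
      (monom P c k \<otimes>\<^bsub>P\<^esub> monom P a 1 \<oplus>\<^bsub>P\<^esub> monom P c k \<otimes>\<^bsub>P\<^esub> monom P b 0)"
    unfolding quadratic_poly_def using c by (simp add: U.UP_r_distr U.UP_a_assoc)
  then show ?thesis
    using c U.monom_mult[of c \<one> k 2] U.monom_mult[of c a k 1] U.monom_mult[of c b k 0] by simp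
qed

text \<open>Multiplying \<open>t\<^sup>2 + a t + b\<close> by \<open>c t\<^sup>k\<close> lowers the degree of the classes of monomials.\<close>

lemma proj_monom_reduce:
  assumes c: "c \<in> ideal_power (k + 2)"
  shows "proj (monom P c (k + 2)) = \<ominus>\<^bsub>A\<^esub> (proj (monom P (c \<otimes> a) (k + 1)) \<oplus>\<^bsub>A\<^esub> proj (monom P (c \<otimes> b) k))"
proof -
  interpret A: cring A by (rule A_cring)
  have cc: "c \<in> carrier R" using ideal.Icarr[OF ideal_power_ideal c] .
  have pw: "c \<in> ideal_power (k + 1)" "c \<in> ideal_power k"
    using c ideal_power_Suc[of "k + 1"] ideal_power_Suc[of k] by auto
  have S: "monom P c (k + 2) \<in> carrier S" "monom P (c \<otimes> a) (k + 1) \<in> carrier S"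
      "monom P (c \<otimes> b) k \<in> carrier S"
    using c pw ideal.I_r_closed[OF ideal_power_ideal] by auto
  interpret S: cring S by (rule S_cring)
  have S': "monom P (c \<otimes> a) (k + 1) \<oplus>\<^bsub>P\<^esub> monom P (c \<otimes> b) k \<in> carrier S"
    using S.a_closed[OF S(2,3)] by (simp add: S_ops)
  have "monom P c k \<otimes>\<^bsub>P\<^esub> g \<in> K"
  proof -
    have "monom P c k \<otimes>\<^bsub>P\<^esub> g \<in> PIdl\<^bsub>P\<^esub> g" unfolding cgenideal_def using U.monom_closed[OF cc] by blast
    then show ?thesis
      using S.a_closed[OF S(1) S'] by (simp add: rees_kernel_def g_mult_monom[OF cc] S_ops)
  qed
  then have "proj (monom P c k \<otimes>\<^bsub>P\<^esub> g) = \<zero>\<^bsub>A\<^esub>"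
    using proj_zero_iff ideal.Icarr[OF K_ideal] by blast
  then have "proj (monom P c (k + 2)) \<oplus>\<^bsub>A\<^esub>
      (proj (monom P (c \<otimes> a) (k + 1)) \<oplus>\<^bsub>A\<^esub> proj (monom P (c \<otimes> b) k)) = \<zero>\<^bsub>A\<^esub>"
    unfolding g_mult_monom[OF cc] by (simp only: proj_add_mult(1)[OF S(1) S'] proj_add_mult(1)[OF S(2,3)])
  then show ?thesis
    using A.minus_equality proj_closed S by (metis A.a_closed)
qed

text \<open>
  The classes of polynomials of degree at most \<open>1\<close>.
\<close>

definition linear_classes where "linear_classes = {const r \<oplus>\<^bsub>A\<^esub> lin i | r i. r \<in> carrier R \<and> i \<in> I}"

lemma const_lin_closed [simp]:
  "r \<in> carrier R \<Longrightarrow> const r \<in> carrier A" "i \<in> I \<Longrightarrow> lin i \<in> carrier A"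
  by (simp_all add: const_def lin_def proj_closed proj_add_mult)

lemma lin_add: "i \<in> I \<Longrightarrow> j \<in> I \<Longrightarrow> lin (i \<oplus> j) = lin i \<oplus>\<^bsub>A\<^esub> lin j"
  by (simp add: lin_def proj_closed proj_add_mult)

lemma lin_smult: "r \<in> carrier R \<Longrightarrow> i \<in> I \<Longrightarrow> lin (r \<otimes> i) = const r \<otimes>\<^bsub>A\<^esub> lin i"
  using U.monom_mult[of r i 0 1] by (simp add: lin_def const_def proj_closed proj_add_mult)

lemma linear_classes_add:
  assumes "x \<in> linear_classes" "y \<in> linear_classes" shows "x \<oplus>\<^bsub>A\<^esub> y \<in> linear_classes"
proof -
  interpret A: cring A by (rule A_cring)
  obtain r i s j where *: "r \<in> carrier R" "i \<in> I" "s \<in> carrier R" "j \<in> I"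
    "x = const r \<oplus>\<^bsub>A\<^esub> lin i" "y = const s \<oplus>\<^bsub>A\<^esub> lin j"
    using assms unfolding linear_classes_def by blast
  have "x \<oplus>\<^bsub>A\<^esub> y = const (r \<oplus> s) \<oplus>\<^bsub>A\<^esub> lin (i \<oplus> j)"
    unfolding * using * ring_hom_memE(3)[OF const_hom] by (simp add: lin_add A.a_ac)
  then show ?thesis unfolding linear_classes_def using * ideal_add_closed[OF I] by blast
qed

lemma linear_classes_smult:
  assumes "s \<in> carrier R" "x \<in> linear_classes" shows "const s \<otimes>\<^bsub>A\<^esub> x \<in> linear_classes"
proof -
  interpret A: cring A by (rule A_cring)
  obtain r i where *: "r \<in> carrier R" "i \<in> I" "x = const r \<oplus>\<^bsub>A\<^esub> lin i"
    using assms unfolding linear_classes_def by blast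
  have "const s \<otimes>\<^bsub>A\<^esub> x = const (s \<otimes> r) \<oplus>\<^bsub>A\<^esub> lin (s \<otimes> i)"
    unfolding * using * assms ring_hom_memE(2)[OF const_hom] by (simp add: lin_smult A.r_distr)
  then show ?thesis unfolding linear_classes_def using * assms ideal.I_l_closed[OF I] by blast
qed

lemma linear_classes_minus:
  assumes "x \<in> linear_classes" shows "\<ominus>\<^bsub>A\<^esub> x \<in> linear_classes"
proof -
  interpret A: cring A by (rule A_cring)
  interpret h: ring_hom_cring R A const
    by (intro ring_hom_cring.intro ring_hom_cring_axioms.intro cring_axioms A_cring const_hom)
  have "x \<in> carrier A" using assms by (auto simp: linear_classes_def)
  then have "const (\<ominus> \<one>) \<otimes>\<^bsub>A\<^esub> x = \<ominus>\<^bsub>A\<^esub> x" by (simp add: A.l_minus)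
  then show ?thesis using linear_classes_smult[OF _ assms, of "\<ominus> \<one>"] by simp
qed

lemma const_in_linear_classes: "r \<in> carrier R \<Longrightarrow> const r \<in> linear_classes"
  and lin_in_linear_classes: "i \<in> I \<Longrightarrow> lin i \<in> linear_classes"
proof -
  interpret A: cring A by (rule A_cring)
  have z: "lin \<zero> = \<zero>\<^bsub>A\<^esub>" "const \<zero> = \<zero>\<^bsub>A\<^esub>"
    using proj_zero_iff[of "\<zero>\<^bsub>P\<^esub>"] ideal_zero_closed[OF K_ideal] cring.cring_simprules(2)[OF S_cring]
    by (auto simp: lin_def const_def S_ops)
  show "const r \<in> linear_classes" if "r \<in> carrier R"
    unfolding linear_classes_def using that z ideal_zero_closed[OF I]
    by (intro CollectI exI[of _ r] exI[of _ \<zero>]) simp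
  show "lin i \<in> linear_classes" if "i \<in> I"
    unfolding linear_classes_def using that z
    by (intro CollectI exI[of _ \<zero>] exI[of _ i]) simp
qed

lemma proj_monom_linear:
  "c \<in> ideal_power n \<Longrightarrow> proj (monom P c n) \<in> linear_classes"
proof (induction n arbitrary: c rule: less_induct)
  case (less n)
  consider "n = 0" | "n = 1" | k where "n = k + 2"
    by (metis One_nat_def add_2_eq_Suc' not0_implies_Suc)
  then show ?case
  proof cases
    case 1
    then show ?thesis using const_in_linear_classes[of c] less.prems by (simp add: const_def ideal_power_0)
  next
    case 2
    then show ?thesis using lin_in_linear_classes[of c] less.prems by (simp add: lin_def ideal_power_1)
  next
    case (3 k)
    then have c: "c \<in> ideal_power (k + 2)" using less.prems by simp
    have pw: "c \<otimes> a \<in> ideal_power (k + 1)" "c \<otimes> b \<in> ideal_power k"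
      using c ideal_power_Suc[of "k + 1"] ideal_power_Suc[of k] ideal.I_r_closed[OF ideal_power_ideal] by auto
    show ?thesis
      unfolding 3 proj_monom_reduce[OF c]
      using 3 pw by (intro linear_classes_minus linear_classes_add less.IH) auto
  qed
qed

lemma linear_classes_all: "carrier A \<subseteq> linear_classes"
proof
  interpret S: cring S by (rule S_cring)
  fix x assume "x \<in> carrier A"
  then obtain p where p: "p \<in> carrier S" "x = proj p" using proj_surj by auto
  have pc: "coeff P p i \<in> ideal_power i" "p \<in> carrier P" for i using p by (auto simp: S_carrier)
  have "(\<Oplus>\<^bsub>P\<^esub>i\<in>X. monom P (coeff P p i) i) \<in> carrier S \<and>
      proj (\<Oplus>\<^bsub>P\<^esub>i\<in>X. monom P (coeff P p i) i) \<in> linear_classes" if "finite X" for X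
    using that
  proof (induction X rule: finite_induct)
    case empty
    have "\<zero>\<^bsub>P\<^esub> \<in> carrier S" using S.zero_closed by (simp add: S_ops)
    moreover have "proj \<zero>\<^bsub>P\<^esub> \<in> linear_classes" using const_in_linear_classes[of \<zero>] by (simp add: const_def)
    ultimately show ?case by simp
  next
    case (insert i X)
    have m: "monom P (coeff P p i) i \<in> carrier S" using pc by simp
    have "(\<Oplus>\<^bsub>P\<^esub>i\<in>insert i X. monom P (coeff P p i) i) =
        monom P (coeff P p i) i \<oplus>\<^bsub>P\<^esub> (\<Oplus>\<^bsub>P\<^esub>i\<in>X. monom P (coeff P p i) i)"
      using insert pc
      by (intro abelian_monoid.finsum_insert abelian_group.axioms(1) ring.is_abelian_group U.UP_ring) auto
    moreover have "monom P (coeff P p i) i \<oplus>\<^bsub>P\<^esub> (\<Oplus>\<^bsub>P\<^esub>i\<in>X. monom P (coeff P p i) i) \<in> carrier S"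
      using S.a_closed[OF m] insert.IH by (simp add: S_ops)
    ultimately show ?case
      using insert.IH proj_add_mult(1)[OF m] linear_classes_add proj_monom_linear[OF pc(1)] by simp
  qed
  from this[of "{..deg R p}"] show "x \<in> linear_classes" using U.up_repr[OF pc(2)] p by simp
qed

lemma coeff_mult_monom:
  assumes "p \<in> carrier P" "c \<in> carrier R"
  shows "coeff P (p \<otimes>\<^bsub>P\<^esub> monom P c m) (n + m) = coeff P p n \<otimes> c"
proof -
  have "coeff P (p \<otimes>\<^bsub>P\<^esub> monom P c m) (n + m) =
      (\<Oplus>i\<in>{..n + m}. coeff P p i \<otimes> (if m = n + m - i then c else \<zero>))"
    using assms by simp
  also have "\<dots> = (\<Oplus>i\<in>{..n + m}. if n = i then coeff P p i \<otimes> c else \<zero>)"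
    using assms by (intro add.finprod_cong') (auto simp: Pi_def)
  also have "\<dots> = coeff P p n \<otimes> c"
    using assms by (subst add.finprod_singleton) (auto simp: Pi_def)
  finally show ?thesis .
qed

text \<open>As \<open>t\<^sup>2 + a t + b\<close> is monic, its nonzero multiples have a nonzero coefficient of index at
  least \<open>2\<close>.\<close>

lemma const_lin_independent:
  assumes r: "r \<in> carrier R" and i: "i \<in> I" and zero: "const r \<oplus>\<^bsub>A\<^esub> lin i = \<zero>\<^bsub>A\<^esub>"
  shows "r = \<zero> \<and> i = \<zero>"
proof -
  interpret S: cring S by (rule S_cring)
  let ?f = "monom P r 0 \<oplus>\<^bsub>P\<^esub> monom P i (Suc 0)"
  have "?f \<in> carrier S" using S.a_closed[OF mon0[OF r] mon1[OF i]] by (simp add: S_ops)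
  moreover have "proj ?f = \<zero>\<^bsub>A\<^esub>" using zero r i by (simp add: const_def lin_def proj_closed proj_add_mult)
  ultimately have "?f \<in> PIdl\<^bsub>P\<^esub> g" using proj_zero_iff by (auto simp: rees_kernel_def)
  then obtain q where q: "q \<in> carrier P" "?f = q \<otimes>\<^bsub>P\<^esub> g" unfolding cgenideal_def by blast
  have "q = \<zero>\<^bsub>P\<^esub>"
  proof (rule ccontr)
    assume nz: "q \<noteq> \<zero>\<^bsub>P\<^esub>"
    let ?d = "deg R q"
    have above: "coeff P q (?d + 1) = \<zero>" "coeff P q (?d + 2) = \<zero>" using q by (auto intro: U.deg_aboveD)
    have "q \<otimes>\<^bsub>P\<^esub> g = q \<otimes>\<^bsub>P\<^esub> monom P \<one> 2 \<oplus>\<^bsub>P\<^esub> q \<otimes>\<^bsub>P\<^esub> monom P a 1 \<oplus>\<^bsub>P\<^esub> q \<otimes>\<^bsub>P\<^esub> monom P b 0"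
      unfolding quadratic_poly_def using q by (simp add: U.UP_r_distr)
    then have "coeff P (q \<otimes>\<^bsub>P\<^esub> g) (?d + 2) =
        coeff P (q \<otimes>\<^bsub>P\<^esub> monom P \<one> 2) (?d + 2) \<oplus> coeff P (q \<otimes>\<^bsub>P\<^esub> monom P a 1) ((?d + 1) + 1) \<oplus>
        coeff P (q \<otimes>\<^bsub>P\<^esub> monom P b 0) ((?d + 2) + 0)"
      using q(1) by (simp del: U.coeff_mult)
    also have "\<dots> = coeff P q ?d \<otimes> \<one> \<oplus> coeff P q (?d + 1) \<otimes> a \<oplus> coeff P q (?d + 2) \<otimes> b"
      using q(1) by (simp only: coeff_mult_monom one_closed a b)
    also have "\<dots> = coeff P q ?d" unfolding above using q(1) by simp
    finally have "coeff P (q \<otimes>\<^bsub>P\<^esub> g) (?d + 2) = coeff P q ?d" .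
    moreover have "coeff P ?f (?d + 2) = \<zero>" using r i by simp
    ultimately show False using U.lcoeff_nonzero[OF nz q(1)] q(2) by simp
  qed
  then have f: "?f = \<zero>\<^bsub>P\<^esub>" using q by simp
  have "coeff P ?f 0 = r" "coeff P ?f 1 = i" using r i by simp_all
  then show ?thesis unfolding f by simp
qed

lemma lin_lin:
  assumes "i \<in> I" "j \<in> I"
  shows "lin i \<otimes>\<^bsub>A\<^esub> lin j = \<ominus>\<^bsub>A\<^esub> (const (b \<otimes> (i \<otimes> j)) \<oplus>\<^bsub>A\<^esub> lin (a \<otimes> (i \<otimes> j)))"
proof -
  interpret A: cring A by (rule A_cring)
  have ij: "i \<otimes> j \<in> ideal_power (0 + 2)" "i \<otimes> j \<in> carrier R" "i \<otimes> j \<in> I"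
    using ideal_power_mult[of i 1 j 1] assms ideal.I_l_closed[OF I] by (auto simp: ideal_power_1 numeral_2_eq_2)
  have "lin i \<otimes>\<^bsub>A\<^esub> lin j = proj (monom P (i \<otimes> j) (0 + 2))"
    using assms U.monom_mult[of i j 1 1] by (simp add: lin_def proj_closed proj_add_mult numeral_2_eq_2)
  also have "\<dots> = \<ominus>\<^bsub>A\<^esub> (lin ((i \<otimes> j) \<otimes> a) \<oplus>\<^bsub>A\<^esub> const ((i \<otimes> j) \<otimes> b))"
    unfolding proj_monom_reduce[OF ij(1)] by (simp add: lin_def const_def)
  also have "(i \<otimes> j) \<otimes> a = a \<otimes> (i \<otimes> j)" using ij(2) a by (rule m_comm)
  also have "(i \<otimes> j) \<otimes> b = b \<otimes> (i \<otimes> j)" using ij(2) b by (rule m_comm)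
  also have "lin (a \<otimes> (i \<otimes> j)) \<oplus>\<^bsub>A\<^esub> const (b \<otimes> (i \<otimes> j)) = const (b \<otimes> (i \<otimes> j)) \<oplus>\<^bsub>A\<^esub> lin (a \<otimes> (i \<otimes> j))"
    using ij ideal.I_l_closed[OF I] by (intro A.a_comm) auto
  finally show ?thesis .
qed

lemma rees_quotient_module_eq: "rees_quotient_module R I a b = restrict_scalars A const"
  unfolding rees_quotient_module_def const_def[abs_def] proj_def ..

end

theorem ideal_extension_rees_quotient:
  fixes R (structure)
  assumes R: "noetherian_local_ring R" and I: "ideal I R" "I \<noteq> {\<zero>}" "I \<noteq> carrier R"
    and ab: "a \<in> carrier R" "b \<in> carrier R"
  shows "ideal_extension R (rees_quotient R I a b) I a b (rees.const R I a b) (rees.lin R I a b)"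
proof -
  interpret R: noetherian_local_ring R by fact
  interpret rees R I a b by (intro rees.intro rees_axioms.intro R.cring_axioms I ab)
  show ?thesis
  proof (intro ideal_extension.intro ideal_extension_axioms.intro R A_cring I ab const_hom)
    show "\<exists>r\<in>carrier R. \<exists>i\<in>I. x = const r \<oplus>\<^bsub>A\<^esub> lin i" if "x \<in> carrier A" for x
      using that linear_classes_all unfolding linear_classes_def by blast
  qed (fact assms const_lin_closed lin_add lin_smult lin_lin const_lin_independent)+
qed

theorem proposition1p2:
  fixes R :: "('a, 'm) ring_scheme" and I :: "'a set" and a b :: 'a
  assumes "noetherian_local_ring R"
    and "ideal I R" and "I \<noteq> {\<zero>\<^bsub>R\<^esub>}" and "I \<noteq> carrier R"
    and "a \<in> carrier R" and "b \<in> carrier R"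
  shows
    "(cohen_macaulay_local_ring R \<and> maximal_cohen_macaulay_module R (ideal_module R I)
        \<longleftrightarrow> cohen_macaulay_module R (rees_quotient_module R I a b))
     \<and> (cohen_macaulay_module R (rees_quotient_module R I a b)
        \<longleftrightarrow> cohen_macaulay_local_ring (rees_quotient R I a b))
     \<and> (cohen_macaulay_local_ring (rees_quotient R I a b)
        \<longleftrightarrow> cohen_macaulay_local_ring R \<and>
            (\<forall>xs. regular_sequence R (self_module R) xs \<longrightarrow>
                  regular_sequence R (rees_quotient_module R I a b) xs))"
proof -
  have "rees R I a b"
    using assms by (intro rees.intro rees_axioms.intro) (auto simp: noetherian_local_ring_def)
  then show ?thesis
    using ideal_extension.cohen_macaulay_equivalences[OF ideal_extension_rees_quotient[OF assms]]
    by (simp only: rees.rees_quotient_module_eq)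
qed

end
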